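(* Let $f,g\in\mathbb{C}[x,y]$, let $m\ge 2$ be the degree of the polynomial vector field $(f,g)$, and consider $\dot x(t)=f(x,y)$, $\dot y(t)=g(x,y)$ in complex time $t$. Let $(u,z)=(0,e)$ be any equilibrium of the blow-up equation $$\frac{du}{dt_1}=-u\,f_1(u,z),\qquad \frac{dz}{dt_1}=-z\,f_1(u,z)+g_1(u,z),\qquad dt=u^{m-1}\,dt_1,$$ in blow-up variables $u=1/x$, $z=y/x$, where $f_1(u,z)=u^mf(1/u,z/u)$ and $g_1(u,z)=u^mg(1/u,z/u)$. Assume the linearization at $(0,e)$ has negative integer coprime eigenvalues $\lambda_1=-n_1$ (belonging to the $u$-component, i.e. $\lambda_1=-f_1(0,e)$) and $\lambda_2=-n_2$ (i.e. $\lambda_2=\partial_z(-zf_1+g_1)(0,e)$), with nonresonant but rational spectral quotient $\lambda=n_1/n_2>0$; in other words, both $\lambda$ and $1/\lambda$ are positive and lie in $(\mathbb{Q}\setminus\mathbb{Z})\cup\{1\}$. In case $\lambda=1$, assume that the eigenvalue $\lambda_1=\lambda_2=-1$ is semisimple, i.e. without Jordan block of length 2. Then there exist discrepancy-free minimal blow-up loops $(\gamma^t,\gamma^{uz})$, locally around blow-up of $(x(t),y(t))$ at $t=T=0$ and $(u,z)=(0,e)$, with the following properties. (i) The local leaf $\mathcal{L}$ of $\gamma^{uz}$ closes to a Riemann surface $\mathcal{R}=\mathcal{L}\cup\{(0,e)\}$ with branching point $(u,z)=(0,e)$. (ii) In a suitable regular parametrization $\Theta:\{|\vartheta|\le 1\}\to\mathcal{R}$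 by the complex unit disk, there are complex analytic expansions $$t-T=a_t\,\vartheta^{(m-1)n_1}+\dots,\qquad u=a_u\,\vartheta^{n_1}+\dots$$ (dots denoting higher order terms in $\vartheta$) with nonzero coefficients $a_t,a_u$, such that $\gamma^{uz}=\Theta(\mathbb{S}^1)$. (iii) The winding numbers of the projected closed loops $\gamma^t$ (around $T$) and $\gamma^u$ (around $u=0$) are $\mathfrak{w}_t=(m-1)\,n_1>0$ and $\mathfrak{w}_u=n_1>0$. (iv) The real-time blow-up star in the local leaf $\mathcal{L}\subset\mathcal{R}$ is parametrized, alternatingly, by the $\mathfrak{w}_t=(m-1)n_1$ real analytic blow-up branches and the $\mathfrak{w}_t$ real analytic blow-down branches of $\vartheta$ in the expansion of $t-T$ in (ii), along which $t$ is real with $t\le T$ and $t\ge T$, respectively. Analogous results hold for the blow-up variables $v=1/y$, $w=x/y$ replacing $u,z$, with $\frac{dv}{dt_2}=-v\,g_2(v,w)$, $\frac{dw}{dt_2}=-w\,g_2(v,w)+f_2(v,w)$, $dt=v^{m-1}dt_2$, where $f_2(v,w)=v^mf(w/v,1/v)$ and $g_2(v,w)=v^mg(w/v,1/v)$. Reversing time, the statements remain true for blow-down at positive eigenvalues $\lambda_1=n_1$, $\lambda_2=n_2$.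
   Context: Leafs: a leaf is a nonstationary solution orbit, in complex time, of the polynomial blow-up equation; it is a complex one-dimensional curve. A local leaf is a maximal orbit within a small neighborhood of the equilibrium. The line $\{u=0\}$ is invariant; leafs of interest lie in $\{u\neq0\}$. On such a leaf, solutions $(u,z)$ are parametrized by original time $t$ via $dt=u^{m-1}dt_1$. Blow-up: $(u(t),z(t))\to(0,e)$ as $t\to T=0$ in finite original time $t$. Blow-down is the same in reverse time. Blow-up loop: let $\mathcal{L}$ be the local leaf of a blow-up solution. Let $\gamma^t:[0,2\pi]\to\mathbb{C}\setminus\{T\}$, $s\mapsto t(s)$, be a closed curve near $T$, with nonzero winding number $\mathfrak{w}_t=\mathfrak{w}(\gamma^t)$ around $T$ (chosen positive without loss of generality). Let $\gamma^{uz}(s):=(u(t(s)),z(t(s)))\in\mathcal{L}$ be the solution continued along $\gamma^t$. The pair $(\gamma^t,\gamma^{uz})$ is a (discrepancy-free) blow-up loop if $\gamma^{uz}$ closes up, i.e. $\gamma^{uz}(2\pi)=\gamma^{uz}(0)$. It is minimal if $\mathfrak{w}(\gamma^t)>0$ is minimal among all blow-up loops in the local leaf $\mathcal{L}$. $\gamma^u\subset\mathbb{C}\setminus\{0\}$ denotes the projection of $\gamma^{uz}$ to the $u$-component and $\mathfrak{w}_u$ its winding number around $0$. Real-time blow-up star: for a minimal blow-up loop with winding number $\mathfrak{w}_t$ in $\mathcal{L}$, the collection of all $\mathfrak{w}_t$ complex blow-up branches of solutions (real $t\nearrow T$) and all $\mathfrak{w}_t$ blow-down continuations (real $t\searrow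 T$), which alternate in $\mathcal{L}$. *)

theory Defs
  imports "HOL-Complex_Analysis.Complex_Analysis" "HOL-Computational_Algebra.Polynomial"
begin

type_synonym c2 = "complex \<times> complex"

section \<open>Polynomials in two variables and the two blow-up charts\<close>

text \<open>A polynomial in \<open>x, y\<close> is an element of \<open>C[x][y]\<close>: the coefficient of \<open>x^i y^j\<close>
  is \<open>coeff (coeff p j) i\<close>.\<close>

definition bipoly :: "complex poly poly \<Rightarrow> complex \<Rightarrow> complex \<Rightarrow> complex" where
  "bipoly p x y = poly (poly p [:y:]) x"

definition total_degree :: "complex poly poly \<Rightarrow> nat" where
  "total_degree p = Max (insert 0 {i + j | i j. coeff (coeff p j) i \<noteq> 0})"

definition poly_field :: "complex poly poly \<Rightarrow> complex poly poly \<Rightarrow> c2 \<Rightarrow> c2" where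
  "poly_field f g = (\<lambda>(x, y). (bipoly f x y, bipoly g x y))"

text \<open>\<open>blowup_x m p u z\<close> is the polynomial \<open>u^m p(1/u, z/u)\<close> and \<open>blowup_y m p v w\<close> is the
  polynomial \<open>v^m p(w/v, 1/v)\<close>, both including their values at \<open>u = 0\<close> and \<open>v = 0\<close>; see the
  lemmas \<open>blowup_x_eq\<close> and \<open>blowup_y_eq\<close>. The truncated subtraction is harmless because
  \<open>i + j \<le> m\<close> for every monomial that occurs.\<close>

definition blowup_x :: "nat \<Rightarrow> complex poly poly \<Rightarrow> complex \<Rightarrow> complex \<Rightarrow> complex" where
  "blowup_x m p u z =
     (\<Sum>j\<le>degree p. \<Sum>i\<le>degree (coeff p j). coeff (coeff p j) i * u ^ (m - (i + j)) * z ^ j)"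

definition blowup_y :: "nat \<Rightarrow> complex poly poly \<Rightarrow> complex \<Rightarrow> complex \<Rightarrow> complex" where
  "blowup_y m p v w =
     (\<Sum>j\<le>degree p. \<Sum>i\<le>degree (coeff p j). coeff (coeff p j) i * v ^ (m - (i + j)) * w ^ i)"

lemma bipoly_altdef:
  "bipoly p x y = (\<Sum>j\<le>degree p. \<Sum>i\<le>degree (coeff p j). coeff (coeff p j) i * x ^ i * y ^ j)"
proof -
  have "poly (poly p [:y:]) x = (\<Sum>j\<le>degree p. poly (coeff p j) x * y ^ j)"
    by (simp add: poly_altdef[of p] poly_sum)
  also have "\<dots> = (\<Sum>j\<le>degree p. \<Sum>i\<le>degree (coeff p j). coeff (coeff p j) i * x ^ i * y ^ j)"
    by (intro sum.cong refl) (simp add: poly_altdef sum_distrib_right)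
  finally show ?thesis by (simp add: bipoly_def)
qed

lemma finite_monomials: "finite {i + j | i j. coeff (coeff p j) i \<noteq> (0::complex)}"
proof -
  have "{i + j | i j. coeff (coeff p j) i \<noteq> 0}
          \<subseteq> (\<lambda>(j, i). i + j) ` (SIGMA j:{..degree p}. {..degree (coeff p j)})"
  proof
    fix n assume "n \<in> {i + j | i j. coeff (coeff p j) i \<noteq> 0}"
    then obtain i j where *: "n = i + j" "coeff (coeff p j) i \<noteq> 0" by blast
    have "coeff p j \<noteq> 0" using *(2) by auto
    then have "j \<le> degree p" "i \<le> degree (coeff p j)" using *(2) by (auto intro: le_degree)
    then show "n \<in> (\<lambda>(j, i). i + j) ` (SIGMA j:{..degree p}. {..degree (coeff p j)})"
      using * by (auto intro!: image_eqI[of _ _ "(j, i)"])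
  qed
  then show ?thesis by (rule finite_subset) auto
qed

lemma total_degree_ge: "coeff (coeff p j) i \<noteq> 0 \<Longrightarrow> i + j \<le> total_degree p"
  unfolding total_degree_def using finite_monomials[of p] by (intro Max_ge) auto

lemma blowup_x_eq:
  assumes "u \<noteq> 0" "total_degree p \<le> m"
  shows "blowup_x m p u z = u ^ m * bipoly p (1 / u) (z / u)"
  unfolding blowup_x_def bipoly_altdef sum_distrib_left
proof (intro sum.cong refl)
  fix i j
  show "coeff (coeff p j) i * u ^ (m - (i + j)) * z ^ j =
        u ^ m * (coeff (coeff p j) i * (1 / u) ^ i * (z / u) ^ j)"
  proof (cases "coeff (coeff p j) i = 0")
    case False
    then have "i + j \<le> m" using total_degree_ge assms(2) le_trans by blast
    then show ?thesis using assms(1) by (simp add: power_diff power_divide power_add)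
  qed simp
qed

lemma blowup_y_eq:
  assumes "v \<noteq> 0" "total_degree p \<le> m"
  shows "blowup_y m p v w = v ^ m * bipoly p (w / v) (1 / v)"
  unfolding blowup_y_def bipoly_altdef sum_distrib_left
proof (intro sum.cong refl)
  fix i j
  show "coeff (coeff p j) i * v ^ (m - (i + j)) * w ^ i =
        v ^ m * (coeff (coeff p j) i * (w / v) ^ i * (1 / v) ^ j)"
  proof (cases "coeff (coeff p j) i = 0")
    case False
    then have "i + j \<le> m" using total_degree_ge assms(2) le_trans by blast
    then show ?thesis using assms(1) by (simp add: power_diff power_divide power_add)
  qed simp
qed

text \<open>Chart \<open>X\<close> has coordinates \<open>u = 1/x, z = y/x\<close>; chart \<open>Y\<close> has coordinates
  \<open>v = 1/y, w = x/y\<close>. In both charts the first coordinate vanishes at blow-up.\<close>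

datatype chart = X | Y

fun to_xy :: "chart \<Rightarrow> c2 \<Rightarrow> c2" where
  "to_xy X (u, z) = (1 / u, z / u)"
| "to_xy Y (v, w) = (w / v, 1 / v)"

fun radial :: "chart \<Rightarrow> nat \<Rightarrow> complex poly poly \<Rightarrow> complex poly poly \<Rightarrow> complex \<Rightarrow> complex \<Rightarrow> complex"
  where
  "radial X m f g u z = blowup_x m f u z"
| "radial Y m f g v w = blowup_y m g v w"

fun angular :: "chart \<Rightarrow> nat \<Rightarrow> complex poly poly \<Rightarrow> complex poly poly \<Rightarrow> complex \<Rightarrow> complex \<Rightarrow> complex"
  where
  "angular X m f g u z = blowup_x m g u z"
| "angular Y m f g v w = blowup_y m f v w"

text \<open>The blow-up equation in rescaled time: \<open>u' = -u f1\<close>, \<open>z' = -z f1 + g1\<close> in chart \<open>X\<close>, and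
  \<open>v' = -v g2\<close>, \<open>w' = -w g2 + f2\<close> in chart \<open>Y\<close>.\<close>

definition blowup_field ::
  "chart \<Rightarrow> nat \<Rightarrow> complex poly poly \<Rightarrow> complex poly poly \<Rightarrow> c2 \<Rightarrow> c2" where
  "blowup_field c m f g =
     (\<lambda>(u, z). (- u * radial c m f g u z, - z * radial c m f g u z + angular c m f g u z))"

text \<open>The same equation in original time \<open>t\<close>, where \<open>dt = u^(m-1) dt_1\<close>; meaningful for
  \<open>u \<noteq> 0\<close> only.\<close>

definition original_time_field ::
  "chart \<Rightarrow> nat \<Rightarrow> complex poly poly \<Rightarrow> complex poly poly \<Rightarrow> c2 \<Rightarrow> c2" where
  "original_time_field c m f g p =
     (fst (blowup_field c m f g p) / fst p ^ (m - 1), snd (blowup_field c m f g p) / fst p ^ (m - 1))"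

section \<open>Complex-time solutions, continuation, local leafs\<close>

definition solves :: "(c2 \<Rightarrow> c2) \<Rightarrow> complex set \<Rightarrow> (complex \<Rightarrow> c2) \<Rightarrow> bool" where
  "solves F D \<phi> \<longleftrightarrow> (\<forall>t\<in>D.
     ((\<lambda>s. fst (\<phi> s)) has_field_derivative fst (F (\<phi> t))) (at t) \<and>
     ((\<lambda>s. snd (\<phi> s)) has_field_derivative snd (F (\<phi> t))) (at t))"

text \<open>\<open>\<gamma>p\<close> is a solution continued along the path \<open>\<gamma>t\<close> in complex time. As in the library,
  paths are parametrized by \<open>{0..1}\<close>.\<close>

definition continued_along :: "(c2 \<Rightarrow> c2) \<Rightarrow> (real \<Rightarrow> complex) \<Rightarrow> (real \<Rightarrow> c2) \<Rightarrow> bool" where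
  "continued_along F \<gamma>t \<gamma>p \<longleftrightarrow> path \<gamma>t \<and> path \<gamma>p \<and>
     (\<forall>s\<in>{0..1}. \<exists>D \<phi> \<eta>. open D \<and> solves F D \<phi> \<and> \<eta> > 0 \<and>
        (\<forall>s'\<in>{0..1}. \<bar>s' - s\<bar> < \<eta> \<longrightarrow> \<gamma>t s' \<in> D \<and> \<gamma>p s' = \<phi> (\<gamma>t s')))"

definition complex_orbit :: "(c2 \<Rightarrow> c2) \<Rightarrow> c2 set \<Rightarrow> c2 \<Rightarrow> c2 set" where
  "complex_orbit F U p = {q. \<exists>\<gamma>t \<gamma>p. continued_along F \<gamma>t \<gamma>p \<and> path_image \<gamma>p \<subseteq> U \<and>
     pathstart \<gamma>p = p \<and> pathfinish \<gamma>p = q}"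

definition local_leaf :: "(c2 \<Rightarrow> c2) \<Rightarrow> c2 set \<Rightarrow> c2 set \<Rightarrow> bool" where
  "local_leaf F U L \<longleftrightarrow> (\<exists>p\<in>U. F p \<noteq> 0 \<and> L = complex_orbit F U p)"

text \<open>An eigenvalue is semisimple if it has no generalized eigenvectors of height 2, i.e. no
  Jordan block of length at least 2.\<close>

definition semisimple_eigenvalue :: "(c2 \<Rightarrow> c2) \<Rightarrow> complex \<Rightarrow> bool" where
  "semisimple_eigenvalue J \<mu> \<longleftrightarrow>
     (let N = (\<lambda>v. J v - (\<mu> * fst v, \<mu> * snd v)) in \<forall>v. N (N v) = 0 \<longrightarrow> N v = 0)"

section \<open>Blow-up and blow-down branches and loops\<close>

datatype direction = Blow_up | Blow_down

fun dir_sign :: "direction \<Rightarrow> real" where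
  "dir_sign Blow_up = -1"
| "dir_sign Blow_down = 1"

fun time_interval :: "direction \<Rightarrow> real \<Rightarrow> real \<Rightarrow> real set" where
  "time_interval Blow_up T \<delta> = {T - \<delta> <..< T}"
| "time_interval Blow_down T \<delta> = {T <..< T + \<delta>}"

text \<open>A real-time branch in \<open>L\<close>: a solution \<open>(x(t), y(t))\<close> of the original equation, expressed in
  the chart, which converges to the equilibrium \<open>P\<close> on the line at infinity as \<open>t \<nearrow> T\<close>
  (blow-up), or as \<open>t \<searrow> T\<close> (blow-down).\<close>

definition real_branch ::
  "chart \<Rightarrow> complex poly poly \<Rightarrow> complex poly poly \<Rightarrow> c2 set \<Rightarrow> c2 \<Rightarrow> real \<Rightarrow>
   direction \<Rightarrow> real \<Rightarrow> (real \<Rightarrow> c2) \<Rightarrow> bool" where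
  "real_branch c f g L P T d \<delta> \<beta> \<longleftrightarrow> \<delta> > 0 \<and>
     (\<forall>t\<in>time_interval d T \<delta>. fst (\<beta> t) \<noteq> 0 \<and> \<beta> t \<in> L \<and>
        ((\<lambda>s. to_xy c (\<beta> s)) has_vector_derivative poly_field f g (to_xy c (\<beta> t))) (at t)) \<and>
     (\<beta> \<longlongrightarrow> P) (at T within time_interval d T \<delta>)"

text \<open>A (discrepancy-free) blow-up loop, resp. blow-down loop, in \<open>L\<close>. The paths \<open>\<sigma>t, \<sigma>p\<close>
  express that \<open>\<gamma>p\<close> continues a solution which blows up (or down) at the very time \<open>T\<close> that
  \<open>\<gamma>t\<close> winds around; original time is otherwise only determined up to a constant.\<close>

definition blowup_loop ::
  "chart \<Rightarrow> nat \<Rightarrow> complex poly poly \<Rightarrow> complex poly poly \<Rightarrow> c2 set \<Rightarrow> c2 \<Rightarrow> real \<Rightarrow>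
   direction \<Rightarrow> (real \<Rightarrow> complex) \<Rightarrow> (real \<Rightarrow> c2) \<Rightarrow> bool" where
  "blowup_loop c m f g L P T d \<gamma>t \<gamma>p \<longleftrightarrow>
     continued_along (original_time_field c m f g) \<gamma>t \<gamma>p \<and> path_image \<gamma>p \<subseteq> L \<and>
     pathfinish \<gamma>t = pathstart \<gamma>t \<and> pathfinish \<gamma>p = pathstart \<gamma>p \<and>
     of_real T \<notin> path_image \<gamma>t \<and> Re (winding_number \<gamma>t (of_real T)) > 0 \<and>
     (\<exists>\<delta> \<beta> t0 \<sigma>t \<sigma>p. real_branch c f g L P T d \<delta> \<beta> \<and> t0 \<in> time_interval d T \<delta> \<and>
        continued_along (original_time_field c m f g) \<sigma>t \<sigma>p \<and> path_image \<sigma>p \<subseteq> L \<and>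
        pathstart \<sigma>t = of_real t0 \<and> pathstart \<sigma>p = \<beta> t0 \<and>
        pathfinish \<sigma>t = pathstart \<gamma>t \<and> pathfinish \<sigma>p = pathstart \<gamma>p)"

definition minimal_blowup_loop ::
  "chart \<Rightarrow> nat \<Rightarrow> complex poly poly \<Rightarrow> complex poly poly \<Rightarrow> c2 set \<Rightarrow> c2 \<Rightarrow> real \<Rightarrow>
   direction \<Rightarrow> (real \<Rightarrow> complex) \<Rightarrow> (real \<Rightarrow> c2) \<Rightarrow> bool" where
  "minimal_blowup_loop c m f g L P T d \<gamma>t \<gamma>p \<longleftrightarrow> blowup_loop c m f g L P T d \<gamma>t \<gamma>p \<and>
     (\<forall>\<gamma>t' \<gamma>p'. blowup_loop c m f g L P T d \<gamma>t' \<gamma>p' \<longrightarrow>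
        Re (winding_number \<gamma>t (of_real T)) \<le> Re (winding_number \<gamma>t' (of_real T)))"

text \<open>\<open>\<tau>\<close> is original time as a function on the leaf \<open>L\<close>: \<open>d\<tau> = u^(m-1) dt_1\<close> along all solutions
  of the blow-up equation in \<open>L\<close>.\<close>

definition leaf_time ::
  "chart \<Rightarrow> nat \<Rightarrow> complex poly poly \<Rightarrow> complex poly poly \<Rightarrow> c2 set \<Rightarrow> (c2 \<Rightarrow> complex) \<Rightarrow> bool" where
  "leaf_time c m f g L \<tau> \<longleftrightarrow>
     (\<forall>D \<phi>. open D \<and> solves (blowup_field c m f g) D \<phi> \<and> \<phi> ` D \<subseteq> L \<longrightarrow>
        (\<forall>t1\<in>D. ((\<lambda>s. \<tau> (\<phi> s)) has_field_derivative fst (\<phi> t1) ^ (m - 1)) (at t1)))"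

section \<open>Riemann surfaces\<close>

definition complex_atlas :: "'a topology \<Rightarrow> ('a set \<times> ('a \<Rightarrow> complex)) set \<Rightarrow> bool" where
  "complex_atlas S A \<longleftrightarrow> (\<Union>(V, \<kappa>)\<in>A. V) = topspace S \<and>
     (\<forall>(V, \<kappa>)\<in>A. openin S V \<and> open (\<kappa> ` V) \<and>
        homeomorphic_map (subtopology S V) (top_of_set (\<kappa> ` V)) \<kappa>) \<and>
     (\<forall>(V, \<kappa>)\<in>A. \<forall>(W, \<mu>)\<in>A. (\<mu> \<circ> inv_into V \<kappa>) holomorphic_on \<kappa> ` (V \<inter> W))"

definition riemann_surface :: "'a topology \<Rightarrow> ('a set \<times> ('a \<Rightarrow> complex)) set \<Rightarrow> bool" where
  "riemann_surface S A \<longleftrightarrow>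
     topspace S \<noteq> {} \<and> connected_space S \<and> Hausdorff_space S \<and> complex_atlas S A"

text \<open>A regular (i.e. locally biholomorphic) map from \<open>D\<close> to the surface with atlas \<open>A\<close>.\<close>

definition regular_into ::
  "('a set \<times> ('a \<Rightarrow> complex)) set \<Rightarrow> complex set \<Rightarrow> (complex \<Rightarrow> 'a) \<Rightarrow> bool" where
  "regular_into A D \<phi> \<longleftrightarrow> (\<forall>(V, \<kappa>)\<in>A. open (D \<inter> \<phi> -` V) \<and>
     (\<kappa> \<circ> \<phi>) holomorphic_on (D \<inter> \<phi> -` V) \<and> (\<forall>t\<in>D \<inter> \<phi> -` V. deriv (\<kappa> \<circ> \<phi>) t \<noteq> 0))"

text \<open>The complex structure on the surface restricts to that of the leaf, for which complex time
  is a local coordinate.\<close>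

definition extends_leaf :: "(c2 \<Rightarrow> c2) \<Rightarrow> c2 set \<Rightarrow> (c2 set \<times> (c2 \<Rightarrow> complex)) set \<Rightarrow> bool" where
  "extends_leaf F L A \<longleftrightarrow>
     (\<forall>D \<phi>. open D \<and> solves F D \<phi> \<and> \<phi> ` D \<subseteq> L \<longrightarrow> regular_into A D \<phi>)"

text \<open>The function \<open>h\<close> on the surface is holomorphic near \<open>p\<close> with multiplicity (ramification
  index) \<open>k\<close> at \<open>p\<close>.\<close>

definition ramification ::
  "('a set \<times> ('a \<Rightarrow> complex)) set \<Rightarrow> ('a \<Rightarrow> complex) \<Rightarrow> 'a \<Rightarrow> nat \<Rightarrow> bool" where
  "ramification A h p k \<longleftrightarrow> (\<forall>(V, \<kappa>)\<in>A. p \<in> V \<longrightarrow>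
     (\<lambda>\<zeta>. h (inv_into V \<kappa> \<zeta>)) analytic_on {\<kappa> p} \<and>
     zorder (\<lambda>\<zeta>. h (inv_into V \<kappa> \<zeta>) - h p) (\<kappa> p) = int k)"

text \<open>\<open>h(\<theta>) = a \<theta>^k + higher order terms\<close>, a power series expansion convergent on the disk of
  radius \<open>r\<close>.\<close>

definition expansion :: "(complex \<Rightarrow> complex) \<Rightarrow> real \<Rightarrow> complex \<Rightarrow> nat \<Rightarrow> bool" where
  "expansion h r a k \<longleftrightarrow> (\<exists>b. (\<forall>j<k. b j = 0) \<and> b k = a \<and>
     (\<forall>\<theta>\<in>ball 0 r. (\<lambda>j. b j * \<theta> ^ j) sums h \<theta>))"

text \<open>Real-time star of the local leaf \<open>L\<close> in the parameter disk of \<open>\<Theta>\<close>: \<open>2 w\<close> curves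
  \<open>\<xi> k\<close> emanating from \<open>0\<close>, real analytic in \<open>s = \<bar>t - T\<bar>^(1/w)\<close>, in cyclic order around \<open>0\<close>,
  alternatingly blow-up (\<open>t = T - s^w\<close>, even \<open>k\<close>) and blow-down (\<open>t = T + s^w\<close>, odd \<open>k\<close>). They
  are disjoint except for \<open>0\<close>, they exhaust the set of real times in the disk, and they
  represent each real-time branch in \<open>L\<close> exactly once.\<close>

definition ray_dir :: "nat \<Rightarrow> direction" where
  "ray_dir k = (if even k then Blow_up else Blow_down)"

definition real_time_star ::
  "chart \<Rightarrow> complex poly poly \<Rightarrow> complex poly poly \<Rightarrow> c2 set \<Rightarrow> c2 \<Rightarrow> real \<Rightarrow>
   (c2 \<Rightarrow> complex) \<Rightarrow> (complex \<Rightarrow> c2) \<Rightarrow> real \<Rightarrow> nat \<Rightarrow>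
   (nat \<Rightarrow> complex \<Rightarrow> complex) \<Rightarrow> (nat \<Rightarrow> real) \<Rightarrow> bool" where
  "real_time_star c f g L P T \<tau> \<Theta> r w \<xi> \<rho> \<longleftrightarrow>
     (\<forall>k<2*w. \<rho> k > 0 \<and> \<xi> k analytic_on of_real ` {0..<\<rho> k} \<and> \<xi> k 0 = 0 \<and>
        (\<forall>s\<in>{0..<\<rho> k}. \<xi> k (of_real s) \<in> ball 0 r \<and>
           \<tau> (\<Theta> (\<xi> k (of_real s))) = of_real (T + dir_sign (ray_dir k) * s ^ w)) \<and>
        real_branch c f g L P T (ray_dir k) (\<rho> k ^ w)
          (\<lambda>t. \<Theta> (\<xi> k (of_real (root w \<bar>t - T\<bar>))))) \<and>
     (\<exists>a. a \<noteq> 0 \<and> (\<forall>k<2*w. deriv (\<xi> k) 0 = a * cis (pi * real k / real w))) \<and>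
     (\<forall>k<2*w. \<forall>l<2*w. k \<noteq> l \<longrightarrow>
        \<xi> k ` of_real ` {0<..<\<rho> k} \<inter> \<xi> l ` of_real ` {0<..<\<rho> l} = {}) \<and>
     (\<forall>d. {\<theta> \<in> ball 0 r. \<tau> (\<Theta> \<theta>) \<in> \<real> \<and> dir_sign d * (Re (\<tau> (\<Theta> \<theta>)) - T) \<ge> 0} =
        (\<Union>k\<in>{k. k < 2*w \<and> ray_dir k = d}. \<xi> k ` of_real ` {0..<\<rho> k})) \<and>
     (\<forall>d \<delta> \<beta>. real_branch c f g L P T d \<delta> \<beta> \<longrightarrow>
        (\<exists>!k. k < 2*w \<and> ray_dir k = d \<and> \<delta> \<le> \<rho> k ^ w \<and>
           (\<forall>t\<in>time_interval d T \<delta>. \<beta> t = \<Theta> (\<xi> k (of_real (root w \<bar>t - T\<bar>))))))"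

end

theory Submission
  imports Defs
begin

text \<open>
  The theorem concerns a single leaf, and so it suffices to construct one solution curve through the
  node, without a linearization of the whole vector field. After a sign change the blow-up equation
  reads \<open>u' = n1 u + \<dots>\<close>, \<open>z' = k u + n2 (z - e) + \<dots>\<close>. Along \<open>u = t^n1\<close> it is a scalar Briot-Bouquet equation
  \<open>t y' B(t^n1, y) = A(t^n1, y)\<close> for \<open>y = z - e\<close>, singular at \<open>t = 0\<close>. Nonresonance (or, for \<open>n1 = n2 = 1\<close>,
  semisimplicity) provides a polynomial \<open>Q\<close> such that \<open>Q(t^n1)\<close> solves it up to order \<open>n2\<close>; then
  \<open>y = Q(t^n1) + t^n2 v\<close> turns it into a regular equation for \<open>v\<close>, which has a holomorphic solution with
  \<open>v(0) = 1\<close> (\<open>exists_small_defect\<close>, \<open>briot_bouquet_solution\<close>, \<open>node_curve\<close>). Coprimality of \<open>n1\<close> and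
  \<open>n2\<close> makes the resulting curve injective (\<open>monomial_curve_injective\<close>).

  Time along the curve has a zero of order \<open>w = (m - 1) n1\<close> at the node. Taking a multiple of its
  \<open>w\<close>-th root as the parameter \<open>\<theta>\<close>, original time becomes exactly \<open>(\<delta> \<theta>)^w\<close> (\<open>time_normalized_curve\<close>). In this
  parameter the statements about time are explicit: the expansion is a monomial, the times
  are real exactly on \<open>2 w\<close> equally spaced rays, alternatingly negative and positive, and the unit circle
  is a loop which winds \<open>w\<close> times around \<open>0\<close>.

  To make the image \<open>L\<close> of a punctured disk a local leaf, the neighborhood is taken to be a
  ball minus the image of the boundary circle. Uniqueness of solutions then shows that nothing
  leaves \<open>L\<close> (\<open>local_leaf\<close>). Because the disk is a global coordinate on \<open>L\<close>, every loop in \<open>L\<close>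
  comes from a closed path \<open>\<psi>\<close> in the punctured disk. Its time differs from \<open>(\<delta> \<psi>)^w\<close> by a constant, which
  vanishes since the loop is connected to a real branch that blows up at time \<open>0\<close>
  (\<open>leaf_time_along\<close>, \<open>real_branch_time\<close>). So the winding number in time is a multiple of \<open>w\<close>, and the
  circle is minimal (\<open>loop_winding_number\<close>). In the same way every real branch has real time
  \<open>(\<delta> \<psi>)^w\<close>, so that it stays on one of the rays (\<open>real_branch_is_ray\<close>).
\<close>

section \<open>Polynomial functions of two variables\<close>

lemma bipoly_pCons: "bipoly (pCons a p) x y = poly a x + y * bipoly p x y"
  by (simp add: bipoly_def)

lemma bipoly_0 [simp]: "bipoly 0 x y = 0"
  by (simp add: bipoly_def)

lemma poly_poly_eq_bipoly: "poly (poly p w) x = bipoly p x (poly w x)"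
  by (induction p) (simp_all add: bipoly_pCons)

text \<open>A working class of vector fields and coordinate changes: it contains everything below that is
  polynomial, is closed under substitution, and supplies both holomorphy along curves and local
  Lipschitz bounds.\<close>

definition polyfun2 :: "(complex \<Rightarrow> complex \<Rightarrow> complex) \<Rightarrow> bool" where
  "polyfun2 h \<longleftrightarrow> (\<exists>p. \<forall>x y. h x y = bipoly p x y)"

named_theorems polyfun2_intros

lemma polyfun2_bipoly [polyfun2_intros]: "polyfun2 (bipoly p)"
  unfolding polyfun2_def by blast

lemma polyfun2_const [polyfun2_intros]: "polyfun2 (\<lambda>x y. a)"
  unfolding polyfun2_def by (rule exI[of _ "[:[:a:]:]"]) (simp add: bipoly_def)

lemma polyfun2_fst [polyfun2_intros]: "polyfun2 (\<lambda>x y. x)"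
  unfolding polyfun2_def by (rule exI[of _ "[:[:0, 1:]:]"]) (simp add: bipoly_def)

lemma polyfun2_snd [polyfun2_intros]: "polyfun2 (\<lambda>x y. y)"
  unfolding polyfun2_def by (rule exI[of _ "[:0, 1:]"]) (simp add: bipoly_def)

lemma polyfun2_add [polyfun2_intros]:
  assumes "polyfun2 g" "polyfun2 h"
  shows "polyfun2 (\<lambda>x y. g x y + h x y)"
proof -
  obtain p q where "\<forall>x y. g x y = bipoly p x y" "\<forall>x y. h x y = bipoly q x y"
    using assms unfolding polyfun2_def by blast
  then show ?thesis
    unfolding polyfun2_def by (intro exI[of _ "p + q"]) (simp add: bipoly_def)
qed

lemma polyfun2_mult [polyfun2_intros]:
  assumes "polyfun2 g" "polyfun2 h"
  shows "polyfun2 (\<lambda>x y. g x y * h x y)"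
proof -
  obtain p q where "\<forall>x y. g x y = bipoly p x y" "\<forall>x y. h x y = bipoly q x y"
    using assms unfolding polyfun2_def by blast
  then show ?thesis
    unfolding polyfun2_def by (intro exI[of _ "p * q"]) (simp add: bipoly_def)
qed

lemma polyfun2_uminus [polyfun2_intros]: "polyfun2 h \<Longrightarrow> polyfun2 (\<lambda>x y. - h x y)"
  using polyfun2_mult[OF polyfun2_const[of "-1"], of h] by simp

lemma polyfun2_power [polyfun2_intros]: "polyfun2 h \<Longrightarrow> polyfun2 (\<lambda>x y. h x y ^ n)"
  by (induction n) (auto intro: polyfun2_intros)

lemma polyfun2_sum [polyfun2_intros]:
  "(\<And>i. i \<in> I \<Longrightarrow> polyfun2 (h i)) \<Longrightarrow> polyfun2 (\<lambda>x y. \<Sum>i\<in>I. h i x y)"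
  by (induction I rule: infinite_finite_induct) (auto intro: polyfun2_intros)

lemma polyfun2_poly [polyfun2_intros]: "polyfun2 h \<Longrightarrow> polyfun2 (\<lambda>x y. poly p (h x y))"
  by (induction p) (auto intro: polyfun2_intros)

lemma polyfun2_compose:
  assumes "polyfun2 h" "polyfun2 g1" "polyfun2 g2"
  shows "polyfun2 (\<lambda>x y. h (g1 x y) (g2 x y))"
proof -
  obtain p where p: "\<forall>x y. h x y = bipoly p x y" using assms(1) unfolding polyfun2_def by blast
  have "polyfun2 (\<lambda>x y. bipoly p (g1 x y) (g2 x y))"
    by (induction p) (auto simp: bipoly_pCons intro!: polyfun2_add polyfun2_mult polyfun2_poly polyfun2_const assms(2,3))
  then show ?thesis using p by simp
qed

lemma polyfun2_holomorphic:
  assumes "polyfun2 h" "g1 holomorphic_on S" "g2 holomorphic_on S"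
  shows "(\<lambda>t. h (g1 t) (g2 t)) holomorphic_on S"
proof -
  obtain p where p: "\<forall>x y. h x y = bipoly p x y" using assms(1) unfolding polyfun2_def by blast
  have "(\<lambda>t. bipoly p (g1 t) (g2 t)) holomorphic_on S"
    using assms(2,3) by (induction p) (auto simp: bipoly_pCons intro!: holomorphic_intros)
  then show ?thesis using p by simp
qed

lemma poly_locally_lipschitz:
  fixes p :: "complex poly"
  shows "\<exists>K\<ge>0. \<forall>x x'. norm x \<le> r \<longrightarrow> norm x' \<le> r \<longrightarrow>
           norm (poly p x) \<le> K \<and> norm (poly p x - poly p x') \<le> K * norm (x - x')"
proof -
  have "compact (poly p ` cball 0 r)" "compact (poly (pderiv p) ` cball 0 r)"
    by (intro compact_continuous_image continuous_intros compact_cball)+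
  then obtain K1 K2 where K: "\<forall>x\<in>cball 0 r. norm (poly p x) \<le> K1"
      "\<forall>x\<in>cball 0 r. norm (poly (pderiv p) x) \<le> K2"
    using compact_imp_bounded bounded_iff by (metis (no_types, lifting) image_eqI)
  define K where "K = max 0 (max K1 K2)"
  have "norm (poly p x - poly p x') \<le> K * norm (x - x')" if "norm x \<le> r" "norm x' \<le> r" for x x'
  proof (rule field_differentiable_bound[of "cball 0 r" "poly p" "poly (pderiv p)"])
    show "norm (poly (pderiv p) z) \<le> K" if "z \<in> cball 0 r" for z
      using K(2) that unfolding K_def by (simp add: le_max_iff_disj)
  qed (use that in \<open>auto intro: poly_DERIV DERIV_subset\<close>)
  moreover have "norm (poly p x) \<le> K" if "norm x \<le> r" for x
    using K(1) that unfolding K_def by (simp add: le_max_iff_disj)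
  ultimately show ?thesis by (intro exI[of _ K]) (auto simp: K_def)
qed

lemma polyfun2_locally_lipschitz:
  assumes "polyfun2 h"
  shows "\<exists>K\<ge>0. \<forall>x y x' y'. norm x \<le> r \<longrightarrow> norm y \<le> r \<longrightarrow> norm x' \<le> r \<longrightarrow> norm y' \<le> r \<longrightarrow>
           norm (h x y) \<le> K \<and> norm (h x y - h x' y') \<le> K * (norm (x - x') + norm (y - y'))"
proof -
  obtain p where p: "\<forall>x y. h x y = bipoly p x y" using assms(1) unfolding polyfun2_def by blast
  have "\<exists>K\<ge>0. \<forall>x y x' y'. norm x \<le> r \<longrightarrow> norm y \<le> r \<longrightarrow> norm x' \<le> r \<longrightarrow> norm y' \<le> r \<longrightarrow>
     norm (bipoly p x y) \<le> K \<and>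
     norm (bipoly p x y - bipoly p x' y') \<le> K * (norm (x - x') + norm (y - y'))"
  proof (induction p)
    case 0
    show ?case by (rule exI[of _ 0]) auto
  next
    case (pCons a p)
    obtain K where K: "K \<ge> 0" "\<And>x y x' y'. norm x \<le> r \<Longrightarrow> norm y \<le> r \<Longrightarrow> norm x' \<le> r \<Longrightarrow> norm y' \<le> r \<Longrightarrow>
     norm (bipoly p x y) \<le> K \<and>
     norm (bipoly p x y - bipoly p x' y') \<le> K * (norm (x - x') + norm (y - y'))"
      using pCons.IH by blast
    obtain C where C: "C \<ge> 0" "\<And>x x'. norm x \<le> r \<Longrightarrow> norm x' \<le> r \<Longrightarrow>
           norm (poly a x) \<le> C \<and> norm (poly a x - poly a x') \<le> C * norm (x - x')"
      using poly_locally_lipschitz[of r a] by blast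
    define M where "M = C + \<bar>r\<bar> * K + K"
    have "norm (bipoly (pCons a p) x y) \<le> M \<and>
       norm (bipoly (pCons a p) x y - bipoly (pCons a p) x' y') \<le> M * (norm (x - x') + norm (y - y'))"
      if n: "norm x \<le> r" "norm y \<le> r" "norm x' \<le> r" "norm y' \<le> r" for x y x' y'
    proof
      have r: "\<bar>r\<bar> = r" using n(1) norm_ge_zero[of x] by linarith
      have "norm (y * bipoly p x y) \<le> r * K"
        using K(2)[OF n] n(2) by (auto simp: norm_mult intro!: mult_mono elim: order_trans[OF norm_ge_zero])
      then have "norm (poly a x + y * bipoly p x y) \<le> C + r * K"
        using C(2)[OF n(1) n(3)] by (intro norm_triangle_mono) auto
      then show "norm (bipoly (pCons a p) x y) \<le> M"
        using K(1) by (simp add: bipoly_pCons M_def r)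
      have "bipoly (pCons a p) x y - bipoly (pCons a p) x' y' =
          (poly a x - poly a x') + (y * (bipoly p x y - bipoly p x' y') + (y - y') * bipoly p x' y')"
        by (simp add: bipoly_pCons algebra_simps)
      also have "norm \<dots> \<le> C * norm (x - x') +
           (r * (K * (norm (x - x') + norm (y - y'))) + norm (y - y') * K)"
      proof (intro norm_triangle_mono)
        show "norm (poly a x - poly a x') \<le> C * norm (x - x')" using C(2) n by blast
        show "norm (y * (bipoly p x y - bipoly p x' y')) \<le> r * (K * (norm (x - x') + norm (y - y')))"
          using n(2) K(2)[OF n] unfolding norm_mult by (intro mult_mono) (auto elim: order_trans[OF norm_ge_zero])
        show "norm ((y - y') * bipoly p x' y') \<le> norm (y - y') * K"
          using K(2)[OF n(3,4,1,2)] unfolding norm_mult by (intro mult_left_mono) auto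
      qed
      also have "\<dots> \<le> M * (norm (x - x') + norm (y - y'))"
        using C(1) K(1) by (simp add: M_def r algebra_simps)
      finally show "norm (bipoly (pCons a p) x y - bipoly (pCons a p) x' y')
                      \<le> M * (norm (x - x') + norm (y - y'))" .
    qed
    moreover have "M \<ge> 0" using K(1) C(1) by (simp add: M_def)
    ultimately show ?case by blast
  qed
  then show ?thesis using p by simp
qed

section \<open>Removing the nonresonant part of a Briot-Bouquet equation\<close>

text \<open>The remainder \<open>R\<close> is one polynomial for all increments \<open>w\<close>. Used with coefficients in
  \<open>C[x]\<close>, this is a second order expansion along the graph of a polynomial \<open>a\<close>.\<close>

lemma poly_taylor2:
  fixes p :: "'a :: {comm_ring_1, semiring_no_zero_divisors} poly"
  shows "\<exists>R. \<forall>w. poly p (a + w) = poly p a + w * poly (pderiv p) a + w\<^sup>2 * poly R w"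
proof (induction p)
  case 0
  show ?case by (rule exI[of _ 0]) simp
next
  case (pCons c p)
  then obtain R where R: "\<And>w. poly p (a + w) = poly p a + w * poly (pderiv p) a + w\<^sup>2 * poly R w"
    by blast
  show ?case
  proof (intro exI allI)
    fix w
    show "poly (pCons c p) (a + w) = poly (pCons c p) a + w * poly (pderiv (pCons c p)) a +
            w\<^sup>2 * poly ([:poly (pderiv p) a:] + smult a R + pCons 0 R) w"
      by (simp add: R pderiv_pCons algebra_simps power2_eq_square)
  qed
qed

text \<open>The defect of the polynomial \<open>Q\<close> as a solution of the singular equation
  \<open>n x y'(x) B(x, y) = A(x, y)\<close>.\<close>

definition defect :: "nat \<Rightarrow> complex poly poly \<Rightarrow> complex poly poly \<Rightarrow> complex poly \<Rightarrow> complex poly" where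
  "defect n A B Q = poly A Q - of_nat n * pCons 0 (pderiv Q) * poly B Q"

lemma dvd_x_power_SucI:
  fixes p q :: "complex poly"
  assumes "p = monom 1 j * q" "poly q 0 = 0"
  shows "monom 1 (Suc j) dvd p"
proof -
  have "[:0, 1:] dvd q" using assms(2) by (simp add: dvd_iff_poly_eq_0)
  then obtain s where "q = [:0, 1:] * s" by (rule dvdE)
  then have "p = monom 1 (Suc j) * s" using assms(1) by (simp add: monom_Suc mult.assoc)
  then show ?thesis by simp
qed

text \<open>Adding \<open>q x^j\<close> to \<open>Q\<close> changes the coefficient of \<open>x^j\<close> in the defect by
  \<open>q s n1 (n2 - n1 j)\<close>, and no lower coefficient. Hence this coefficient can be removed unless
  \<open>n1 j = n2\<close>, which is the resonance.\<close>

lemma defect_improve: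
  assumes A: "poly (poly (pderiv A) 0) 0 = s * of_nat n1 * of_nat n2"
    and B: "poly (poly B 0) 0 = s * of_nat n1" and s: "s \<noteq> 0" "n1 > 0"
    and Q: "poly Q 0 = 0" "monom 1 j dvd defect n1 A B Q" and j: "j > 0" "n1 * j \<noteq> n2"
  shows "\<exists>Q'. poly Q' 0 = 0 \<and> monom 1 (Suc j) dvd defect n1 A B Q'"
proof -
  obtain r where r: "defect n1 A B Q = monom 1 j * r" using Q(2) by (rule dvdE)
  define q where "q = - poly r 0 / (s * of_nat n1 * (of_nat n2 - of_nat (n1 * j)))"
  define w where "w = monom q j"
  obtain RA where RA: "\<And>w. poly A (Q + w) = poly A Q + w * poly (pderiv A) Q + w\<^sup>2 * poly RA w"
    using poly_taylor2 by blast
  obtain RB where RB: "\<And>w. poly B (Q + w) = poly B Q + w * poly (pderiv B) Q + w\<^sup>2 * poly RB w"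
    using poly_taylor2 by blast
  define B1 where "B1 = poly (pderiv B) Q + w * poly RB w"
  define S where "S = w * poly RA w - of_nat n1 * pCons 0 (pderiv Q) * B1 - of_nat (n1 * j) * w * B1"
  have w': "pCons 0 (pderiv w) = of_nat j * w"
    using j unfolding w_def
    by (cases j) (simp_all add: pderiv_monom of_nat_poly smult_monom flip: monom_Suc)
  have w0: "poly w 0 = 0" using j unfolding w_def by (simp add: poly_monom)
  have wm: "w = monom 1 j * [:q:]" unfolding w_def by (simp add: smult_monom mult.commute)
  have "pCons 0 (pderiv (Q + w)) = pCons 0 (pderiv Q) + of_nat j * w"
    using w' by (metis add_pCons add_0 pderiv_add)
  then have "defect n1 A B (Q + w) = defect n1 A B Q +
      w * (poly (pderiv A) Q - of_nat (n1 * j) * poly B Q + S)"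
    unfolding defect_def RA RB S_def B1_def by (simp add: algebra_simps power2_eq_square)
  also have "\<dots> = monom 1 j * (r + [:q:] * (poly (pderiv A) Q - of_nat (n1 * j) * poly B Q + S))"
    unfolding r by (subst (1) wm) (simp add: algebra_simps)
  finally have "defect n1 A B (Q + w) =
      monom 1 j * (r + [:q:] * (poly (pderiv A) Q - of_nat (n1 * j) * poly B Q + S))" .
  moreover have "poly (r + [:q:] * (poly (pderiv A) Q - of_nat (n1 * j) * poly B Q + S)) 0 = 0"
  proof -
    have "poly (poly (pderiv A) Q) 0 = s * of_nat n1 * of_nat n2" "poly (poly B Q) 0 = s * of_nat n1"
      using A B Q(1) by (simp_all add: poly_poly_eq_bipoly)
    moreover have "poly S 0 = 0" unfolding S_def using w0 by simp
    moreover have "of_nat n2 - of_nat (n1 * j) \<noteq> (0::complex)"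
      using j(2) by (metis of_nat_eq_iff right_minus_eq)
    ultimately show ?thesis using s unfolding q_def
      by (simp add: field_simps)
  qed
  ultimately have "monom 1 (Suc j) dvd defect n1 A B (Q + w)" by (rule dvd_x_power_SucI)
  then show ?thesis using Q(1) w0 by (intro exI[of _ "Q + w"]) simp
qed

lemma exists_small_defect:
  assumes A: "poly (poly (pderiv A) 0) 0 = s * of_nat n1 * of_nat n2" "poly (poly A 0) 0 = 0"
    and B: "poly (poly B 0) 0 = s * of_nat n1" and s: "s \<noteq> 0" "n1 > 0"
    and J: "\<And>j. 0 < j \<Longrightarrow> j \<le> J \<Longrightarrow> n1 * j \<noteq> n2"
  shows "\<exists>Q. poly Q 0 = 0 \<and> monom 1 (Suc J) dvd defect n1 A B Q"
  using J
proof (induction J)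
  case 0
  have "defect n1 A B 0 = monom 1 0 * poly A 0" by (simp add: defect_def)
  then have "monom 1 (Suc 0) dvd defect n1 A B 0" using A(2) by (rule dvd_x_power_SucI)
  then show ?case by (intro exI[of _ 0]) simp
next
  case (Suc J)
  then have "\<exists>Q. poly Q 0 = 0 \<and> monom 1 (Suc J) dvd defect n1 A B Q" by simp
  then obtain Q where Q: "poly Q 0 = 0" "monom 1 (Suc J) dvd defect n1 A B Q" by blast
  show ?case by (rule defect_improve[OF A(1) B s Q]) (use Suc.prems[of "Suc J"] in auto)
qed

text \<open>The term linear in \<open>y\<close> vanishes at \<open>x = 0\<close>, because \<open>A\<close> contributes \<open>s n1 n2\<close> to its
  coefficient there, and the product of \<open>n2 y\<close> and \<open>B\<close> takes \<open>n2 (s n1)\<close> away. This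
  gains the extra factor \<open>x\<close> that makes the equation regular after rescaling \<open>y\<close>.\<close>

lemma defect_expansion:
  assumes A: "poly (poly (pderiv A) 0) 0 = s * of_nat n1 * of_nat n2"
    and B: "poly (poly B 0) 0 = s * of_nat n1"
    and Q: "poly Q 0 = 0" "monom 1 J dvd defect n1 A B Q"
  shows "\<exists>r l R. \<forall>x y. bipoly A x (poly Q x + y) -
     (of_nat n1 * x * poly (pderiv Q) x + of_nat n2 * y) * bipoly B x (poly Q x + y) =
     x ^ J * poly r x + y * x * poly l x + y\<^sup>2 * bipoly R x y"
proof -
  obtain r where r: "defect n1 A B Q = monom 1 J * r" using Q(2) by (rule dvdE)
  obtain RA where RA: "\<And>w. poly A (Q + w) = poly A Q + w * poly (pderiv A) Q + w\<^sup>2 * poly RA w"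
    using poly_taylor2 by blast
  obtain RB where RB: "\<And>w. poly B (Q + w) = poly B Q + w * poly (pderiv B) Q + w\<^sup>2 * poly RB w"
    using poly_taylor2 by blast
  define xQ' where "xQ' = of_nat n1 * pCons 0 (pderiv Q)"
  define L where "L = poly (pderiv A) Q - xQ' * poly (pderiv B) Q - of_nat n2 * poly B Q"
  have "poly L 0 = 0" unfolding L_def xQ'_def using A B Q(1) by (simp add: poly_poly_eq_bipoly)
  then have "[:0, 1:] dvd L" by (simp add: dvd_iff_poly_eq_0)
  then obtain l where l: "L = [:0, 1:] * l" by (rule dvdE)
  define R where "R = RA - [:xQ':] * RB - of_nat n2 * [:poly (pderiv B) Q:] - of_nat n2 * pCons 0 RB"
  have eq: "poly A (Q + w) - (xQ' + of_nat n2 * w) * poly B (Q + w) =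
     defect n1 A B Q + w * L + w\<^sup>2 * poly R w" for w
    unfolding RA RB defect_def L_def R_def xQ'_def[symmetric]
    by (simp add: algebra_simps power2_eq_square)
  show ?thesis
  proof (intro exI allI)
    fix x y :: complex
    have "poly (poly A (Q + [:y:]) - (xQ' + of_nat n2 * [:y:]) * poly B (Q + [:y:])) x =
       poly (monom 1 J * r + [:y:] * ([:0, 1:] * l) + [:y:]\<^sup>2 * poly R [:y:]) x"
      unfolding eq r l ..
    then show "bipoly A x (poly Q x + y) -
     (of_nat n1 * x * poly (pderiv Q) x + of_nat n2 * y) * bipoly B x (poly Q x + y) =
     x ^ J * poly r x + y * x * poly l x + y\<^sup>2 * bipoly R x y"
      by (simp add: poly_poly_eq_bipoly xQ'_def poly_monom algebra_simps)
  qed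
qed

section \<open>A holomorphic initial value problem\<close>

lemma holomorphic_primitive:
  assumes "f holomorphic_on S" "open S" "convex S"
  shows "\<exists>V. V a = b \<and> V holomorphic_on S \<and>
    (\<forall>z\<in>S. DERIV V z :> f z \<and> deriv V z = f z)"
proof -
  obtain V0 where V0: "\<And>z. z \<in> S \<Longrightarrow> (V0 has_field_derivative f z) (at z within S)"
    using holomorphic_convex_primitive'[OF assms(3,2,1)] by blast
  define V where "V z = V0 z - V0 a + b" for z
  have V: "DERIV V z :> f z" if "z \<in> S" for z
    using V0[OF that] at_within_open[OF that assms(2)] unfolding V_def
    by (auto intro!: derivative_eq_intros)
  then have "V holomorphic_on S" using holomorphic_on_open[OF assms(2)] by blast
  then show ?thesis using V DERIV_imp_deriv by (intro exI[of _ V]) (auto simp: V_def)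
qed

lemma primitive_diff_bound:
  fixes V W :: "complex \<Rightarrow> complex"
  assumes "\<forall>z\<in>ball 0 \<rho>. DERIV V z :> f z"
    and "\<forall>z\<in>ball 0 \<rho>. DERIV W z :> g z"
    and "V 0 = W 0" and "\<And>z. z \<in> ball 0 \<rho> \<Longrightarrow> norm (f z - g z) \<le> B" and z: "z \<in> ball 0 \<rho>"
  shows "norm (V z - W z) \<le> B * \<rho>"
proof -
  have "norm ((V z - W z) - (V 0 - W 0)) \<le> B * norm (z - 0)"
  proof (rule field_differentiable_bound[of "ball 0 \<rho>" _ "\<lambda>z. f z - g z"])
    show "((\<lambda>z. V z - W z) has_field_derivative f z - g z) (at z within ball 0 \<rho>)"
      if "z \<in> ball 0 \<rho>" for z
      using assms(1,2) that by (intro DERIV_diff) (auto intro: has_field_derivative_at_within)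
    show "0 \<in> ball 0 \<rho>" using z by (auto intro: le_less_trans[OF norm_ge_zero])
  qed (use assms in auto)
  also have "\<dots> \<le> B * \<rho>"
  proof (rule mult_left_mono)
    show "0 \<le> B" using assms(4)[OF z] norm_ge_zero order_trans by blast
  qed (use z in auto)
  finally show ?thesis using assms(3) by simp
qed

text \<open>Picard iteration on a small disk: the iterates are holomorphic, converge uniformly, and
  so have a holomorphic limit, which coincides with the primitive that it determines.\<close>

lemma holomorphic_picard:
  fixes N :: "complex \<Rightarrow> complex \<Rightarrow> complex"
  assumes hol: "\<And>v \<rho>. \<rho> \<le> \<delta> \<Longrightarrow> v holomorphic_on ball 0 \<rho> \<Longrightarrow> v ` ball 0 \<rho> \<subseteq> cball b \<delta> \<Longrightarrow>
            (\<lambda>t. N t (v t)) holomorphic_on ball 0 \<rho>"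
    and bound: "\<And>t v. t \<in> ball 0 \<delta> \<Longrightarrow> v \<in> cball b \<delta> \<Longrightarrow> norm (N t v) \<le> K"
    and lip: "\<And>t v w. t \<in> ball 0 \<delta> \<Longrightarrow> v \<in> cball b \<delta> \<Longrightarrow> w \<in> cball b \<delta> \<Longrightarrow>
            norm (N t v - N t w) \<le> K * norm (v - w)"
    and K: "K > 0" and \<delta>: "\<delta> > 0"
  shows "\<exists>\<rho>>0. \<exists>v. \<rho> \<le> \<delta> \<and> v holomorphic_on ball 0 \<rho> \<and> v 0 = b \<and> v ` ball 0 \<rho> \<subseteq> cball b \<delta> \<and>
     (\<forall>t\<in>ball 0 \<rho>. DERIV v t :> N t (v t))"
proof -
  \<comment> \<open>The second bound keeps the iterates within distance \<open>\<delta>\<close> of \<open>b\<close>, the third makes the iteration contract by \<open>1/2\<close>.\<close>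
  define \<rho> where "\<rho> = min \<delta> (min (\<delta> / K) (1 / (2 * K)))"
  have \<rho>: "\<rho> > 0" "\<rho> \<le> \<delta>" "K * \<rho> \<le> \<delta>" "K * \<rho> \<le> 1 / 2"
  proof -
    show "\<rho> > 0" "\<rho> \<le> \<delta>" using K \<delta> by (auto simp: \<rho>_def)
    have "K * \<rho> \<le> K * (\<delta> / K)" "K * \<rho> \<le> K * (1 / (2 * K))"
      using K by (intro mult_left_mono; simp add: \<rho>_def)+
    then show "K * \<rho> \<le> \<delta>" "K * \<rho> \<le> 1 / 2" using K by auto
  qed
  have sub: "ball 0 \<rho> \<subseteq> ball (0::complex) \<delta>" using \<rho>(2) by auto
  define good where "good v \<longleftrightarrow> v holomorphic_on ball 0 \<rho> \<and> v ` ball 0 \<rho> \<subseteq> cball b \<delta>" for v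
  have good_mem: "v t \<in> cball b \<delta>" if "good v" "t \<in> ball 0 \<rho>" for v t
    using that by (simp add: good_def image_subset_iff)
  define step where "step v =
    (SOME V. V 0 = b \<and> (\<forall>t\<in>ball 0 \<rho>. DERIV V t :> N t (v t)))" for v
  have step: "step v 0 = b" "\<forall>t\<in>ball 0 \<rho>. DERIV (step v) t :> N t (v t)"
    if "good v" for v
  proof -
    have "(\<lambda>t. N t (v t)) holomorphic_on ball 0 \<rho>" using that \<rho>(2) hol by (auto simp: good_def)
    then have "\<exists>V. V 0 = b \<and> (\<forall>t\<in>ball 0 \<rho>. DERIV V t :> N t (v t))"
      using holomorphic_primitive[OF _ open_ball convex_ball] by blast
    from someI_ex[OF this]
    show "step v 0 = b" "\<forall>t\<in>ball 0 \<rho>. DERIV (step v) t :> N t (v t)"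
      unfolding step_def by blast+
  qed
  have good_step: "good (step v)" if v: "good v" for v
    unfolding good_def
  proof (intro conjI subsetI)
    show "step v holomorphic_on ball 0 \<rho>"
      using step(2)[OF v] by (auto simp: holomorphic_on_open)
    fix y assume "y \<in> step v ` ball 0 \<rho>"
    then obtain t where t: "t \<in> ball 0 \<rho>" "y = step v t" by blast
    have "norm (step v t - b) \<le> K * \<rho>"
    proof (rule primitive_diff_bound[OF step(2)[OF v], of "\<lambda>_. b" "\<lambda>_. 0"])
      show "norm (N s (v s) - 0) \<le> K" if "s \<in> ball 0 \<rho>" for s
        using bound[of s "v s"] subsetD[OF sub that] v that by (simp add: good_def image_subset_iff)
    qed (use t step(1)[OF v] in auto)
    then show "y \<in> cball b \<delta>" using \<rho>(3) t(2) by (simp add: dist_norm norm_minus_commute)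
  qed
  have contract: "norm (step v t - step w t) \<le> B / 2"
    if v: "good v" "good w" and B: "\<And>s. s \<in> ball 0 \<rho> \<Longrightarrow> norm (v s - w s) \<le> B"
      and t: "t \<in> ball 0 \<rho>" for v w t B
  proof -
    have B0: "B \<ge> 0" using B[OF t] norm_ge_zero order_trans by blast
    have "norm (step v t - step w t) \<le> (K * B) * \<rho>"
    proof (rule primitive_diff_bound[OF step(2)[OF v(1)] step(2)[OF v(2)] _ _ t])
      show "norm (N s (v s) - N s (w s)) \<le> K * B" if s: "s \<in> ball 0 \<rho>" for s
      proof -
        have "norm (N s (v s) - N s (w s)) \<le> K * norm (v s - w s)"
          using lip[of s "v s" "w s"] subsetD[OF sub s] v s by (simp add: good_def image_subset_iff)
        also have "\<dots> \<le> K * B" using K B[OF s] by (intro mult_left_mono) auto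
        finally show ?thesis .
      qed
    qed (use step(1) v in auto)
    also have "\<dots> = (K * \<rho>) * B" by simp
    also have "\<dots> \<le> (1 / 2) * B" using \<rho>(4) B0 by (intro mult_right_mono) auto
    finally show ?thesis by simp
  qed
  define it where "it n = (step ^^ n) (\<lambda>_. b)" for n
  have it_Suc: "it (Suc n) = step (it n)" for n by (simp add: it_def)
  have good_it: "good (it n)" for n
  proof (induction n)
    case 0
    show ?case using \<delta> by (auto simp: it_def good_def)
  qed (simp add: it_Suc good_step)
  have diff: "norm (it (Suc n) t - it n t) \<le> \<delta> / 2 ^ n" if "t \<in> ball 0 \<rho>" for n t
    using that
  proof (induction n arbitrary: t)
    case 0
    then have "it (Suc 0) t \<in> cball b \<delta>" using good_mem[OF good_it] by blast
    then show ?case by (simp add: it_def dist_norm norm_minus_commute)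
  next
    case (Suc n)
    have "norm (step (it (Suc n)) t - step (it n) t) \<le> (\<delta> / 2 ^ n) / 2"
      by (rule contract[OF good_it good_it Suc.IH Suc.prems])
    then show ?case by (simp add: it_Suc)
  qed
  have "uniformly_convergent_on (ball 0 \<rho>) (\<lambda>n t. \<Sum>i<n. it (Suc i) t - it i t)"
  proof (rule Weierstrass_m_test'[where M = "\<lambda>n. \<delta> / 2 ^ n"])
    show "summable (\<lambda>n. \<delta> / 2 ^ n :: real)"
      using summable_mult[OF summable_geometric[of "1/2::real"], of \<delta>]
      by (simp add: power_divide)
  qed (use diff in auto)
  then have "uniformly_convergent_on (ball 0 \<rho>) (\<lambda>n t. it n t - it 0 t)"
    by (simp only: sum_lessThan_telescope[of "\<lambda>i. it i t" for t])
  then obtain l where l: "uniform_limit (ball 0 \<rho>) (\<lambda>n t. it n t - b) l sequentially"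
    unfolding uniformly_convergent_on_def by (auto simp: it_def)
  define v where "v t = l t + b" for t
  have v: "uniform_limit (ball 0 \<rho>) it v sequentially"
    using uniform_limit_add[OF l uniform_limit_const[where c = "\<lambda>_. b"]] by (simp add: v_def[abs_def])
  have v_hol: "v holomorphic_on ball 0 \<rho>"
  proof (rule holomorphic_uniform_sequence[OF open_ball, where f = it])
    show "it n holomorphic_on ball 0 \<rho>" for n using good_it by (simp add: good_def)
    fix x :: complex assume "x \<in> ball 0 \<rho>"
    then obtain d where "0 < d" "cball x d \<subseteq> ball 0 \<rho>"
      using open_ball[of "0::complex" \<rho>] unfolding open_contains_cball by blast
    then show "\<exists>d>0. cball x d \<subseteq> ball 0 \<rho> \<and> uniform_limit (cball x d) it v sequentially"
      using uniform_limit_on_subset[OF v] by blast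
  qed
  have lim: "(\<lambda>n. it n t) \<longlonglongrightarrow> v t" if "t \<in> ball 0 \<rho>" for t
    using tendsto_uniform_limitI[OF v that] .
  have v_good: "good v"
    unfolding good_def
  proof (intro conjI v_hol subsetI)
    fix y assume "y \<in> v ` ball 0 \<rho>"
    then obtain t where t: "t \<in> ball 0 \<rho>" "y = v t" by blast
    show "y \<in> cball b \<delta>" unfolding t(2)
      by (rule Lim_in_closed_set[OF closed_cball _ _ lim[OF t(1)]])
         (use good_mem[OF good_it t(1)] in auto)
  qed
  have fix_v: "step v t = v t" if t: "t \<in> ball 0 \<rho>" for t
  proof -
    have "(\<lambda>n. it (Suc n) t) \<longlonglongrightarrow> step v t"
    proof (rule LIMSEQ_I)
      fix e :: real assume e: "e > 0"
      then obtain n0 where n0: "\<And>n s. n \<ge> n0 \<Longrightarrow> s \<in> ball 0 \<rho> \<Longrightarrow> dist (it n s) (v s) < e"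
        using v unfolding uniform_limit_iff eventually_sequentially by meson
      have "norm (it (Suc n) t - step v t) < e" if "n \<ge> n0" for n
      proof -
        have "norm (it (Suc n) t - step v t) \<le> e / 2"
          unfolding it_Suc by (rule contract[OF good_it v_good _ t])
            (use n0[OF that] in \<open>auto simp: dist_norm less_imp_le\<close>)
        then show ?thesis using e by linarith
      qed
      then show "\<exists>no. \<forall>n\<ge>no. norm (it (Suc n) t - step v t) < e" by blast
    qed
    then show ?thesis using LIMSEQ_Suc[OF lim[OF t]] LIMSEQ_unique by blast
  qed
  have "DERIV v t :> N t (v t)" if t: "t \<in> ball 0 \<rho>" for t
    using step(2)[OF v_good] t fix_v has_field_derivative_transform_within_open[OF _ open_ball t]
    by blast
  moreover have "v 0 = b" using fix_v[of 0] step(1)[OF v_good] \<rho>(1) by simp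
  ultimately show ?thesis using \<rho> v_good unfolding good_def by blast
qed

text \<open>Near the initial value the denominator stays away from zero, so that the quotient inherits a
  bound and a Lipschitz constant from numerator and denominator.\<close>

lemma rational_ode_solution:
  assumes P: "polyfun2 P" and Q: "polyfun2 Q" and nz: "Q 0 b \<noteq> 0"
  shows "\<exists>\<rho>>0. \<exists>v. v holomorphic_on ball 0 \<rho> \<and> v 0 = b \<and>
     (\<forall>t\<in>ball 0 \<rho>. Q t (v t) \<noteq> 0 \<and> DERIV v t :> P t (v t) / Q t (v t))"
proof -
  obtain KP where KP: "KP \<ge> 0" "\<And>x y x' y'. norm x \<le> norm b + 1 \<Longrightarrow> norm y \<le> norm b + 1 \<Longrightarrow>
      norm x' \<le> norm b + 1 \<Longrightarrow> norm y' \<le> norm b + 1 \<Longrightarrow>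
      norm (P x y) \<le> KP \<and> norm (P x y - P x' y') \<le> KP * (norm (x - x') + norm (y - y'))"
    using polyfun2_locally_lipschitz[OF P] by metis
  obtain KQ where KQ: "KQ \<ge> 0" "\<And>x y x' y'. norm x \<le> norm b + 1 \<Longrightarrow> norm y \<le> norm b + 1 \<Longrightarrow>
      norm x' \<le> norm b + 1 \<Longrightarrow> norm y' \<le> norm b + 1 \<Longrightarrow>
      norm (Q x y) \<le> KQ \<and> norm (Q x y - Q x' y') \<le> KQ * (norm (x - x') + norm (y - y'))"
    using polyfun2_locally_lipschitz[OF Q] by metis
  \<comment> \<open>On the bidisk of radius \<open>\<delta>\<close> the denominator varies by at most \<open>q\<close>, half of its initial modulus.\<close>
  define q where "q = norm (Q 0 b) / 2"
  define \<delta> where "\<delta> = min 1 (q / (2 * (KQ + 1)))"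
  have q: "q > 0" using nz by (simp add: q_def)
  have \<delta>: "\<delta> > 0" "\<delta> \<le> 1" "KQ * (\<delta> + \<delta>) \<le> q"
  proof -
    show "\<delta> > 0" "\<delta> \<le> 1" using q KQ(1) by (auto simp: \<delta>_def)
    have "KQ * (\<delta> + \<delta>) \<le> (KQ + 1) * (2 * (q / (2 * (KQ + 1))))"
      using KQ(1) \<open>\<delta> > 0\<close> by (intro mult_mono) (auto simp: \<delta>_def)
    also have "\<dots> = q" using KQ(1) by (simp add: field_simps add_nonneg_eq_0_iff)
    finally show "KQ * (\<delta> + \<delta>) \<le> q" .
  qed
  have dom: "norm t \<le> norm b + 1 \<and> norm v \<le> norm b + 1 \<and> q \<le> norm (Q t v)"
    if "t \<in> ball 0 \<delta>" "v \<in> cball b \<delta>" for t v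
  proof -
    have v: "norm (v - b) \<le> \<delta>" using that(2) by (simp add: dist_norm norm_minus_commute)
    have 1: "norm t \<le> norm b + 1" using that(1) \<delta>(2) norm_ge_zero[of b]
      unfolding mem_ball_0 by linarith
    have 2: "norm v \<le> norm b + 1" using v \<delta>(2) norm_triangle_ineq2[of v b] by linarith
    have "norm (Q t v - Q 0 b) \<le> KQ * (norm (t - 0) + norm (v - b))"
      using KQ(2)[OF 1 2, of 0 b] by simp
    also have "\<dots> \<le> KQ * (\<delta> + \<delta>)" using that v KQ(1) by (intro mult_left_mono add_mono) auto
    finally have "norm (Q t v - Q 0 b) \<le> q" using \<delta>(3) by linarith
    then have "norm (Q t v) \<ge> q"
      using norm_triangle_ineq3[of "Q t v" "Q 0 b"] unfolding q_def by linarith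
    with 1 2 show ?thesis by simp
  qed
  define K where "K = KP / q + (KP * KQ + KQ * KP) / (q * q) + 1"
  have K: "K > 0" using KP(1) KQ(1) q by (simp add: K_def add_nonneg_pos)
  have "\<exists>\<rho>>0. \<exists>v. \<rho> \<le> \<delta> \<and> v holomorphic_on ball 0 \<rho> \<and> v 0 = b \<and> v ` ball 0 \<rho> \<subseteq> cball b \<delta> \<and>
     (\<forall>t\<in>ball 0 \<rho>. DERIV v t :> P t (v t) / Q t (v t))"
  proof (rule holomorphic_picard[where K = K and N = "\<lambda>t v. P t v / Q t v"])
    show "(\<lambda>t. P t (v t) / Q t (v t)) holomorphic_on ball 0 \<rho>"
      if "\<rho> \<le> \<delta>" "v holomorphic_on ball 0 \<rho>" "v ` ball 0 \<rho> \<subseteq> cball b \<delta>" for v \<rho>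
    proof (intro holomorphic_on_divide polyfun2_holomorphic[OF P] polyfun2_holomorphic[OF Q] holomorphic_on_ident that(2))
      fix t :: complex assume t: "t \<in> ball 0 \<rho>"
      then have "q \<le> norm (Q t (v t))" using dom[of t "v t"] that by (simp add: image_subset_iff)
      then show "Q t (v t) \<noteq> 0" using q by auto
    qed
    show "norm (P t v / Q t v) \<le> K" if tv: "t \<in> ball 0 \<delta>" "v \<in> cball b \<delta>" for t v
    proof -
      have "norm (P t v / Q t v) \<le> KP / q"
        unfolding norm_divide using dom[OF tv] KP q by (intro frac_le) auto
      then show ?thesis unfolding K_def using KP(1) KQ(1) q by (simp add: add_increasing2)
    qed
    show "norm (P t v / Q t v - P t w / Q t w) \<le> K * norm (v - w)"
      if tv: "t \<in> ball 0 \<delta>" "v \<in> cball b \<delta>" "w \<in> cball b \<delta>" for t v w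
    proof -
      note dv = dom[OF tv(1,2)] and dw = dom[OF tv(1,3)]
      have nz: "Q t v \<noteq> 0" "Q t w \<noteq> 0" using dv dw q by auto
      have "P t v / Q t v - P t w / Q t w =
          (P t v * (Q t w - Q t v) + Q t v * (P t v - P t w)) / (Q t v * Q t w)"
        using nz by (simp add: field_simps)
      also have "norm \<dots> \<le> (KP * (KQ * norm (v - w)) + KQ * (KP * norm (v - w))) / (q * q)"
        unfolding norm_divide
      proof (intro frac_le)
        have "norm (Q t w - Q t v) \<le> KQ * norm (v - w)"
          using KQ(2)[of t w t v] dv dw by (simp add: norm_minus_commute)
        then have 1: "norm (P t v * (Q t w - Q t v)) \<le> KP * (KQ * norm (v - w))"
          using KP dv dw unfolding norm_mult by (intro mult_mono) auto
        have "norm (P t v - P t w) \<le> KP * norm (v - w)"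
          using KP(2)[of t v t w] dv dw by simp
        then have 2: "norm (Q t v * (P t v - P t w)) \<le> KQ * (KP * norm (v - w))"
          using KQ dv dw unfolding norm_mult by (intro mult_mono) auto
        show "norm (P t v * (Q t w - Q t v) + Q t v * (P t v - P t w))
                \<le> KP * (KQ * norm (v - w)) + KQ * (KP * norm (v - w))"
          by (rule norm_triangle_mono[OF 1 2])
        show "q * q \<le> norm (Q t v * Q t w)"
          unfolding norm_mult using dv dw q by (intro mult_mono) auto
      qed (use q KP(1) KQ(1) in auto)
      also have "\<dots> = (KP * KQ + KQ * KP) / (q * q) * norm (v - w)" by (simp add: algebra_simps)
      also have "\<dots> \<le> K * norm (v - w)"
        unfolding K_def using KP(1) q by (intro mult_right_mono) auto
      finally show ?thesis .
    qed
  qed (fact K \<delta>(1))+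
  then obtain \<rho> v where v: "\<rho> > 0" "\<rho> \<le> \<delta>" "v holomorphic_on ball 0 \<rho>" "v 0 = b"
    "v ` ball 0 \<rho> \<subseteq> cball b \<delta>"
    "\<forall>t\<in>ball 0 \<rho>. DERIV v t :> P t (v t) / Q t (v t)" by blast
  moreover have "Q t (v t) \<noteq> 0" if "t \<in> ball 0 \<rho>" for t
    using dom[of t "v t"] v(2,5) that q by (fastforce simp: image_subset_iff)
  ultimately show ?thesis by blast
qed

section \<open>The solution curve through the node\<close>

text \<open>In terms of \<open>x = t^n1\<close> and \<open>y = Q(x) + t^n2 v\<close> every term of the singular equation is
  divisible by \<open>t^(n2+1)\<close>. After division it is a regular initial value problem for \<open>v\<close>, whose
  initial value is free; the choice \<open>v(0) = 1\<close> selects a curve that contains the monomial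
  \<open>t^n2\<close>.\<close>

lemma briot_bouquet_solution:
  assumes A: "poly (poly (pderiv A) 0) 0 = s * of_nat n1 * of_nat n2"
    and B: "poly (poly B 0) 0 = s * of_nat n1" and s: "s \<noteq> 0" and n: "n1 > 0" "n2 > 0"
    and Q: "poly Q 0 = 0" "monom 1 J dvd defect n1 A B Q" "n2 < n1 * J"
  shows "\<exists>\<rho>>0. \<exists>v. v holomorphic_on ball 0 \<rho> \<and> v 0 = 1 \<and>
    (\<forall>t\<in>ball 0 \<rho>. let y = \<lambda>t. poly Q (t ^ n1) + t ^ n2 * v t in
       bipoly B (t ^ n1) (y t) \<noteq> 0 \<and>
       (\<exists>y'. DERIV y t :> y' \<and>
          t * y' * bipoly B (t ^ n1) (y t) = bipoly A (t ^ n1) (y t)))"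
proof -
  obtain r l R where eq: "\<And>x y. bipoly A x (poly Q x + y) -
     (of_nat n1 * x * poly (pderiv Q) x + of_nat n2 * y) * bipoly B x (poly Q x + y) =
     x ^ J * poly r x + y * x * poly l x + y\<^sup>2 * bipoly R x y"
    using defect_expansion[OF A B Q(1,2)] by blast
  obtain k where k: "n1 * J = n2 + 1 + k" using Q(3) less_imp_Suc_add by fastforce
  obtain k1 k2 where k12: "n1 = Suc k1" "n2 = Suc k2" using n gr0_conv_Suc by metis
  define Num where "Num t v =
    t ^ k * poly r (t ^ n1) + v * t ^ k1 * poly l (t ^ n1) + t ^ k2 * v\<^sup>2 * bipoly R (t ^ n1) (t ^ n2 * v)"
    for t v
  define Den where "Den t v = bipoly B (t ^ n1) (poly Q (t ^ n1) + t ^ n2 * v)" for t v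
  have num: "bipoly A (t ^ n1) (poly Q (t ^ n1) + t ^ n2 * v) -
     (of_nat n1 * t ^ n1 * poly (pderiv Q) (t ^ n1) + of_nat n2 * (t ^ n2 * v)) * Den t v =
     t ^ (n2 + 1) * Num t v" for t v
  proof -
    have e1: "(t ^ n1) ^ J = t ^ (n2 + 1) * t ^ k" by (simp add: k flip: power_mult power_add)
    have e2: "t ^ n2 * v * t ^ n1 = t ^ (n2 + 1) * (v * t ^ k1)" by (simp add: k12)
    have e3: "(t ^ n2 * v)\<^sup>2 = t ^ (n2 + 1) * (t ^ k2 * v\<^sup>2)"
      by (simp add: k12 power2_eq_square algebra_simps)
    show ?thesis unfolding Den_def eq e1 e2 e3 Num_def by (simp add: algebra_simps)
  qed
  have polyfuns: "polyfun2 Num" "polyfun2 Den"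
  proof -
    have "polyfun2 (\<lambda>t v. bipoly R (t ^ n1) (t ^ n2 * v))"
      by (rule polyfun2_compose[of "bipoly R" "\<lambda>t v. t ^ n1" "\<lambda>t v. t ^ n2 * v"])
         (intro polyfun2_intros)+
    then show "polyfun2 Num" unfolding Num_def by (intro polyfun2_intros)
    show "polyfun2 Den" unfolding Den_def
      by (rule polyfun2_compose[of "bipoly B" "\<lambda>t v. t ^ n1" "\<lambda>t v. poly Q (t ^ n1) + t ^ n2 * v"])
         (intro polyfun2_intros)+
  qed
  have "Den 0 1 \<noteq> 0" using B s n Q(1) by (simp add: Den_def poly_poly_eq_bipoly zero_power)
  then obtain \<rho> v where v: "\<rho> > 0" "v holomorphic_on ball 0 \<rho>" "v 0 = 1"
    "\<And>t. t \<in> ball 0 \<rho> \<Longrightarrow> Den t (v t) \<noteq> 0"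
    "\<And>t. t \<in> ball 0 \<rho> \<Longrightarrow> DERIV v t :> Num t (v t) / Den t (v t)"
    using rational_ode_solution[OF polyfuns] by blast
  have "\<exists>y'. DERIV (\<lambda>t. poly Q (t ^ n1) + t ^ n2 * v t) t :> y' \<and>
          t * y' * Den t (v t) = bipoly A (t ^ n1) (poly Q (t ^ n1) + t ^ n2 * v t)"
    if t: "t \<in> ball 0 \<rho>" for t
  proof -
    define y' where "y' = of_nat n1 * t ^ k1 * poly (pderiv Q) (t ^ n1) +
       (of_nat n2 * t ^ k2 * v t + t ^ n2 * (Num t (v t) / Den t (v t)))"
    have "DERIV (\<lambda>t. poly Q (t ^ n1) + t ^ n2 * v t) t :> y'"
      unfolding y'_def
      by (rule derivative_eq_intros v(5)[OF t] poly_DERIV DERIV_chain2[of "poly Q"] refl)+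
         (simp add: k12 algebra_simps)
    moreover have "t * y' * Den t (v t) =
      (of_nat n1 * t ^ n1 * poly (pderiv Q) (t ^ n1) + of_nat n2 * (t ^ n2 * v t)) * Den t (v t)
        + t ^ (n2 + 1) * Num t (v t)"
      using v(4)[OF t] unfolding y'_def by (simp add: k12 field_simps)
    moreover have "bipoly A (t ^ n1) (poly Q (t ^ n1) + t ^ n2 * v t) =
      (of_nat n1 * t ^ n1 * poly (pderiv Q) (t ^ n1) + of_nat n2 * (t ^ n2 * v t)) * Den t (v t)
        + t ^ (n2 + 1) * Num t (v t)"
      using num[of t "v t"] by (simp only: diff_eq_eq add.commute)
    ultimately show ?thesis by metis
  qed
  then show ?thesis using v(1-4) unfolding Let_def Den_def
    by (intro exI[of _ \<rho>] conjI exI[of _ v] ballI) auto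
qed

lemma root_of_unity_near_1:
  assumes "n > 0"
  shows "\<exists>\<eta>>0. \<forall>z::complex. z ^ n = 1 \<longrightarrow> norm (z - 1) < \<eta> \<longrightarrow> z = 1"
proof -
  define S where "S = {z::complex. z ^ n = 1} - {1}"
  have "finite S" unfolding S_def using finite_roots_unity[of n] assms by simp
  then obtain \<eta> where "\<eta> > 0" "\<forall>z\<in>S. z \<noteq> 1 \<longrightarrow> \<eta> \<le> dist 1 z"
    using finite_set_avoid[of S 1] by blast
  then show ?thesis unfolding S_def
    by (intro exI[of _ \<eta>]) (force simp: dist_norm norm_minus_commute)
qed

lemma coprime_power_eq_1:
  fixes z :: complex
  assumes "z ^ a = 1" "z ^ b = 1" "coprime a b" "a > 0"
  shows "z = 1"
proof -
  obtain x y where "x * a = y * b + 1"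
    using bezout_nat[of a b] assms(3,4) by (auto simp: algebra_simps)
  then have "z ^ (x * a) = z ^ (y * b + 1)" by simp
  then have "(z ^ a) ^ x = (z ^ b) ^ y * z" by (simp add: mult.commute flip: power_mult)
  then show ?thesis using assms by simp
qed

text \<open>Two parameters with the same \<open>t ^ n1\<close> differ by an \<open>n1\<close>-th root of unity, which the
  term \<open>t ^ n2\<close> detects because \<open>n1\<close> and \<open>n2\<close> are coprime.\<close>

lemma monomial_curve_injective:
  assumes v: "v holomorphic_on ball 0 \<rho>" "v 0 = 1" and \<rho>: "\<rho> > 0"
    and n: "n1 > 0" "n2 > 0" "coprime n1 n2"
  shows "\<exists>\<rho>'>0. \<rho>' \<le> \<rho> \<and> inj_on (\<lambda>t. (t ^ n1, poly Q (t ^ n1) + t ^ n2 * v t)) (ball 0 \<rho>')"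
proof -
  obtain \<eta> where \<eta>: "\<eta> > 0" "\<And>z::complex. z ^ n1 = 1 \<Longrightarrow> norm (z - 1) < \<eta> \<Longrightarrow> z = 1"
    using root_of_unity_near_1[OF n(1)] by blast
  define \<mu> where "\<mu> = min (1/2) (\<eta> / 4)"
  have \<mu>: "\<mu> > 0" "\<mu> \<le> 1/2" "4 * \<mu> \<le> \<eta>" using \<eta>(1) by (auto simp: \<mu>_def)
  have "continuous (at 0) v"
    using v(1) \<rho> holomorphic_on_imp_continuous_on continuous_on_interior by force
  then obtain d where d: "d > 0" "\<And>t. dist t 0 < d \<Longrightarrow> dist (v t) (v 0) < \<mu>"
    using \<mu>(1) unfolding continuous_at_eps_delta by blast
  have vt: "norm (v t - 1) < \<mu>" if "t \<in> ball 0 (min d \<rho>)" for t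
    using d(2)[of t] that v(2) by (simp add: dist_norm)
  have "inj_on (\<lambda>t. (t ^ n1, poly Q (t ^ n1) + t ^ n2 * v t)) (ball 0 (min d \<rho>))"
  proof (rule inj_onI)
    fix t t' assume t: "t \<in> ball 0 (min d \<rho>)" "t' \<in> ball 0 (min d \<rho>)"
      and eq: "(t ^ n1, poly Q (t ^ n1) + t ^ n2 * v t) = (t' ^ n1, poly Q (t' ^ n1) + t' ^ n2 * v t')"
    from eq have eq1: "t ^ n1 = t' ^ n1" and eq2: "t ^ n2 * v t = t' ^ n2 * v t'" by auto
    show "t = t'"
    proof (cases "t' = 0")
      case True
      then show ?thesis using eq1 n(1) by (simp add: zero_power)
    next
      case False
      define \<omega> where "\<omega> = t / t'"
      have w1: "\<omega> ^ n1 = 1" using eq1 False by (simp add: \<omega>_def power_divide)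
      have v': "norm (v t' - 1) < \<mu>" "norm (v t - 1) < \<mu>" using vt t by auto
      have vt': "norm (v t) > 1 / 2"
        using norm_triangle_ineq3[of "v t" 1] v'(2) \<mu>(2) by simp
      then have nz: "v t \<noteq> 0" by auto
      have w2: "\<omega> ^ n2 = v t' / v t"
        using eq2 False nz by (simp add: \<omega>_def power_divide field_simps)
      have "norm (\<omega> ^ n2 - 1) = norm ((v t' - 1) - (v t - 1)) / norm (v t)"
        using nz by (simp add: w2 diff_divide_distrib flip: norm_divide)
      also have "\<dots> < (\<mu> + \<mu>) / (1 / 2)"
      proof (rule frac_less)
        show "norm ((v t' - 1) - (v t - 1)) < \<mu> + \<mu>"
          using norm_triangle_ineq4[of "v t' - 1" "v t - 1"] v' by linarith
      qed (use vt' in auto)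
      also have "\<dots> \<le> \<eta>" using \<mu>(3) by simp
      finally have "norm (\<omega> ^ n2 - 1) < \<eta>" .
      moreover have "(\<omega> ^ n2) ^ n1 = 1" using w1 by (metis mult.commute power_mult power_one)
      ultimately have "\<omega> ^ n2 = 1" using \<eta>(2) by blast
      then have "\<omega> = 1" using coprime_power_eq_1[OF w1 _ n(3,1)] by blast
      then show ?thesis using False by (simp add: \<omega>_def)
    qed
  qed
  then show ?thesis using d(1) \<rho> by (intro exI[of _ "min d \<rho>"]) auto
qed

section \<open>The time-normalizing parameter\<close>

text \<open>The primitive of \<open>t^(w-1) q\<close> that vanishes at \<open>0\<close> has a zero of order exactly \<open>w\<close>, because its
  derivative has one of order \<open>w - 1\<close>. The cofactor has no zero, hence a holomorphic \<open>w\<close>-th root on a small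
  disk, and the primitive is the \<open>w\<close>-th power of a local coordinate.\<close>

lemma time_root:
  assumes q: "q holomorphic_on ball 0 \<rho>" "q 0 \<noteq> 0" and \<rho>: "\<rho> > 0" and w: "w > 0"
  shows "\<exists>\<rho>'>0. \<exists>g. \<rho>' \<le> \<rho> \<and> g holomorphic_on ball 0 \<rho>' \<and> (\<forall>t\<in>ball 0 \<rho>'. g t \<noteq> 0) \<and>
     (\<forall>t\<in>ball 0 \<rho>'. DERIV (\<lambda>t. (t * g t) ^ w) t :> t ^ (w - 1) * q t)"
proof -
  have "(\<lambda>t. t ^ (w - 1) * q t) holomorphic_on ball 0 \<rho>" using q by (intro holomorphic_intros)
  then obtain T where T: "T 0 = 0"
    "\<And>t. t \<in> ball 0 \<rho> \<Longrightarrow> DERIV T t :> t ^ (w - 1) * q t" and T_hol: "T holomorphic_on ball 0 \<rho>"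
    using holomorphic_primitive[OF _ open_ball convex_ball, of _ 0 \<rho> 0 0] by blast
  have q_cont: "continuous (at 0) q"
    using q(1) \<rho> holomorphic_on_imp_continuous_on continuous_on_interior by force
  have nonconst: "\<not> T constant_on ball 0 \<rho>"
  proof
    assume "T constant_on ball 0 \<rho>"
    then obtain a where a: "\<And>t. t \<in> ball 0 \<rho> \<Longrightarrow> T t = a" unfolding constant_on_def by blast
    have zero: "t ^ (w - 1) * q t = 0" if t: "t \<in> ball 0 \<rho>" for t
    proof -
      have "DERIV (\<lambda>_. a) t :> t ^ (w - 1) * q t"
        by (rule has_field_derivative_transform_within_open[OF T(2)[OF t] open_ball t a])
      then show ?thesis using DERIV_unique[OF _ DERIV_const[of a]] by blast
    qed
    have "\<forall>\<^sub>F t in at 0. q t \<noteq> 0" using q_cont q(2) by (simp add: continuous_at tendsto_imp_eventually_ne)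
    moreover have "\<forall>\<^sub>F t in at (0::complex). t \<in> ball 0 \<rho> \<and> t \<noteq> 0"
      using \<rho> by (auto simp: eventually_at intro!: exI[of _ \<rho>])
    ultimately have "\<forall>\<^sub>F t in at (0::complex). False"
      by eventually_elim (use zero in auto)
    then show False by simp
  qed
  have zb: "0 \<in> ball (0::complex) \<rho>" using \<rho> by simp
  have "\<exists>h r n. 0 < n \<and> 0 < r \<and> ball (0::complex) r \<subseteq> ball 0 \<rho> \<and> h holomorphic_on ball 0 r \<and>
      (\<forall>t\<in>ball 0 r. T t = t ^ n * h t \<and> h t \<noteq> 0)"
  proof (rule holomorphic_factor_zero_nonconstant[OF T_hol open_ball connected_ball zb T(1) nonconst])
    fix h r n
    assume "0 < (n::nat)" "0 < r" "ball (0::complex) r \<subseteq> ball 0 \<rho>" "h holomorphic_on ball 0 r"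
      and "\<And>t. t \<in> ball 0 r \<Longrightarrow> T t = (t - 0) ^ n * h t" "\<And>t. t \<in> ball 0 r \<Longrightarrow> h t \<noteq> 0"
    then show ?thesis by (intro exI[of _ h] exI[of _ r] exI[of _ n]) simp
  qed
  then obtain h r n where h: "0 < n" "0 < r" "ball (0::complex) r \<subseteq> ball 0 \<rho>"
      "h holomorphic_on ball 0 r"
      "\<And>t. t \<in> ball 0 r \<Longrightarrow> T t = t ^ n * h t" "\<And>t. t \<in> ball 0 r \<Longrightarrow> h t \<noteq> 0"
    by blast
  have "n = w"
  proof -
    define F where "F t = t ^ (w - 1) * q t" for t
    have "zorder F 0 = int (w - 1)"
      by (rule zorder_eqI[of "ball 0 \<rho>" _ q]) (use q \<rho> in \<open>auto simp: F_def\<close>)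
    moreover have "zorder F 0 = int (n - 1)"
    proof (rule zorder_eqI[of "ball 0 r" _ "\<lambda>t. of_nat n * h t + t * deriv h t"])
      show "(\<lambda>t. of_nat n * h t + t * deriv h t) holomorphic_on ball 0 r"
        using h(4) by (intro holomorphic_intros) auto
      fix t :: complex assume t: "t \<in> ball 0 r" "t \<noteq> 0"
      have "DERIV (\<lambda>t. t ^ n * h t) t :> of_nat n * t ^ (n - 1) * h t + t ^ n * deriv h t"
        using holomorphic_derivI[OF h(4) open_ball t(1)]
        by (auto intro!: derivative_eq_intros)
      then have "DERIV T t :> of_nat n * t ^ (n - 1) * h t + t ^ n * deriv h t"
        by (rule has_field_derivative_transform_within_open[OF _ open_ball t(1)]) (use h(5) in simp)
      then have "F t = of_nat n * t ^ (n - 1) * h t + t ^ n * deriv h t"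
        using T(2) h(3) t(1) DERIV_unique unfolding F_def by blast
      also have "t ^ n = t * t ^ (n - 1)" using h(1) by (simp add: power_eq_if)
      finally show "F t = (of_nat n * h t + t * deriv h t) * (t - 0) powi int (n - 1)"
        by (simp add: algebra_simps)
    qed (use h in auto)
    ultimately show ?thesis using w h(1) by simp
  qed
  obtain L where L: "L holomorphic_on ball 0 r" "\<And>t. t \<in> ball 0 r \<Longrightarrow> h t = exp (L t)"
    using contractible_imp_holomorphic_log[OF h(4) convex_imp_contractible[OF convex_ball] h(6)] by blast
  define g where "g t = exp (L t / of_nat w)" for t
  have gw: "g t ^ w = h t" if "t \<in> ball 0 r" for t
    using L(2)[OF that] w by (simp add: g_def flip: exp_of_nat_mult)
  have "DERIV (\<lambda>t. (t * g t) ^ w) t :> t ^ (w - 1) * q t" if t: "t \<in> ball 0 r" for t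
    by (rule has_field_derivative_transform_within_open[OF T(2) open_ball t])
       (use t h(3,5) gw in \<open>auto simp: power_mult_distrib \<open>n = w\<close>\<close>)
  moreover have "g holomorphic_on ball 0 r" unfolding g_def using L(1) w by (intro holomorphic_intros) auto
  moreover have "r \<le> \<rho>" using h(2,3) by (simp add: ball_subset_ball_iff)
  ultimately show ?thesis using h(2)
    by (intro exI[of _ r] conjI exI[of _ g] ballI) (simp_all add: g_def)
qed

text \<open>The map \<open>t g(t)\<close> is a local coordinate at \<open>0\<close>. The factor \<open>k\<close> records that its inverse has a
  simple zero.\<close>

lemma local_inverse_at_0:
  assumes g: "g holomorphic_on ball 0 \<rho>" "\<forall>t\<in>ball 0 \<rho>. g t \<noteq> 0" and \<rho>: "\<rho> > 0"
  shows "\<exists>d>0. \<exists>\<eta> k. \<eta> holomorphic_on ball 0 d \<and> k holomorphic_on ball 0 d \<and> inj_on \<eta> (ball 0 d) \<and>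
     \<eta> ` ball 0 d \<subseteq> ball 0 \<rho> \<and>
     (\<forall>s\<in>ball 0 d. \<eta> s * g (\<eta> s) = s \<and> \<eta> s = s * k s \<and> k s \<noteq> 0)"
proof -
  define ch where "ch t = t * g t" for t
  have ch: "ch holomorphic_on ball 0 \<rho>" unfolding ch_def using g(1) by (intro holomorphic_intros)
  have zb: "0 \<in> ball (0::complex) \<rho>" using \<rho> by simp
  have "DERIV ch 0 :> g 0"
    unfolding ch_def using holomorphic_derivI[OF g(1) open_ball, of 0] \<rho>
    by (auto intro!: derivative_eq_intros)
  then have dnz: "deriv ch 0 \<noteq> 0" using g(2) \<rho> DERIV_imp_deriv by fastforce
  obtain r where r: "r > 0" "ball (0::complex) r \<subseteq> ball 0 \<rho>" "open (ch ` ball 0 r)" "inj_on ch (ball 0 r)"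
    by (rule has_complex_derivative_locally_invertible[OF ch zb open_ball dnz]) (rule that)
  obtain \<eta> where \<eta>: "\<eta> holomorphic_on ch ` ball 0 r" "\<And>t. t \<in> ball 0 r \<Longrightarrow> \<eta> (ch t) = t"
    using holomorphic_has_inverse[OF holomorphic_on_subset[OF ch r(2)] open_ball r(4)] by metis
  have "0 \<in> ch ` ball 0 r" using r(1) by (intro image_eqI[of _ _ 0]) (auto simp: ch_def)
  then obtain d where d: "d > 0" "ball 0 d \<subseteq> ch ` ball 0 r" using r(3) openE by blast
  have inv: "\<eta> s \<in> ball 0 r \<and> ch (\<eta> s) = s" if "s \<in> ball 0 d" for s
    using d(2) \<eta>(2) that by (smt (verit) image_iff subsetD)
  have eta_hol: "\<eta> holomorphic_on ball 0 d" using \<eta>(1) d(2) holomorphic_on_subset by blast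
  have img: "\<eta> ` ball 0 d \<subseteq> ball 0 \<rho>" using inv r(2) by blast
  show ?thesis
  proof (rule exI[of _ d], intro conjI d(1), rule exI[of _ \<eta>],
      rule exI[of _ "\<lambda>s. 1 / g (\<eta> s)"], intro conjI eta_hol ballI)
    have "(\<lambda>s. g (\<eta> s)) holomorphic_on ball 0 d"
      using holomorphic_on_compose_gen[OF eta_hol g(1)] img by (simp add: o_def)
    moreover have "g (\<eta> s) \<noteq> 0" if "s \<in> ball 0 d" for s using img g(2) that by blast
    ultimately show "(\<lambda>s. 1 / g (\<eta> s)) holomorphic_on ball 0 d"
      by (intro holomorphic_on_divide holomorphic_on_const)
    show "inj_on \<eta> (ball 0 d)" using inv by (metis inj_onI)
    show "\<eta> ` ball 0 d \<subseteq> ball 0 \<rho>" by (fact img)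
    fix s :: complex assume s: "s \<in> ball 0 d"
    have nz: "g (\<eta> s) \<noteq> 0" using inv[OF s] r(2) g(2) by blast
    show *: "\<eta> s * g (\<eta> s) = s" using inv[OF s] by (simp add: ch_def)
    show "1 / g (\<eta> s) \<noteq> 0" using nz by simp
    show "\<eta> s = s * (1 / g (\<eta> s))" using nz * by (simp add: field_simps)
  qed
qed

section \<open>The blow-up equation at the node\<close>

lemma polyfun2_radial: "polyfun2 (radial c m f g)"
proof (cases c)
  case X
  then have "radial c m f g = (\<lambda>u z. blowup_x m f u z)" by (intro ext) simp
  then show ?thesis unfolding blowup_x_def by (auto intro!: polyfun2_intros)
next
  case Y
  then have "radial c m f g = (\<lambda>u z. blowup_y m g u z)" by (intro ext) simp
  then show ?thesis unfolding blowup_y_def by (auto intro!: polyfun2_intros)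
qed

lemma polyfun2_angular: "polyfun2 (angular c m f g)"
proof (cases c)
  case X
  then have "angular c m f g = (\<lambda>u z. blowup_x m g u z)" by (intro ext) simp
  then show ?thesis unfolding blowup_x_def by (auto intro!: polyfun2_intros)
next
  case Y
  then have "angular c m f g = (\<lambda>u z. blowup_y m f u z)" by (intro ext) simp
  then show ?thesis unfolding blowup_y_def by (auto intro!: polyfun2_intros)
qed

lemma bipoly_has_field_derivative_snd:
  "DERIV (bipoly p x) y :> bipoly (pderiv p) x y"
proof (induction p)
  case 0
  have "bipoly 0 x = (\<lambda>_. 0)" by (rule ext) simp
  then show ?case by simp
next
  case (pCons a p)
  have "bipoly (pCons a p) x = (\<lambda>y. poly a x + y * bipoly p x y)"
    by (rule ext) (simp add: bipoly_pCons)
  moreover have "bipoly (pderiv (pCons a p)) x y = bipoly p x y + y * bipoly (pderiv p) x y"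
    by (simp add: pderiv_pCons bipoly_def)
  ultimately show ?case using pCons.IH by (auto intro!: derivative_eq_intros)
qed

lemma bipoly_snd_0: "bipoly p x 0 = poly (poly p 0) x"
  by (simp add: poly_poly_eq_bipoly)

lemma polyfun2_differentiable:
  assumes "polyfun2 h"
  shows "(\<lambda>p. h (fst p) (snd p)) differentiable (at P)"
proof -
  obtain p where p: "\<forall>x y. h x y = bipoly p x y" using assms(1) unfolding polyfun2_def by blast
  have fst: "(\<lambda>p :: c2. fst p) differentiable (at P)" and snd: "(\<lambda>p :: c2. snd p) differentiable (at P)"
    using bounded_linear_fst bounded_linear_snd bounded_linear_imp_differentiable by blast+
  have poly: "(\<lambda>p :: c2. poly a (fst p)) differentiable (at P)" for a
    by (induction a) (auto intro!: differentiable_add differentiable_mult fst)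
  have "(\<lambda>q. bipoly p (fst q) (snd q)) differentiable (at P)"
    by (induction p) (auto simp: bipoly_pCons intro!: differentiable_add differentiable_mult poly snd)
  then show ?thesis using p by simp
qed

lemma blowup_field_differentiable: "blowup_field c m f g differentiable (at P)"
proof -
  have "polyfun2 (\<lambda>u z. - u * radial c m f g u z)"
       "polyfun2 (\<lambda>u z. - z * radial c m f g u z + angular c m f g u z)"
    by (intro polyfun2_intros polyfun2_radial polyfun2_angular)+
  then have "(\<lambda>p. (- fst p * radial c m f g (fst p) (snd p),
      - snd p * radial c m f g (fst p) (snd p) + angular c m f g (fst p) (snd p))) differentiable (at P)"
    by (intro differentiable_Pair polyfun2_differentiable)
  moreover have "blowup_field c m f g = (\<lambda>p. (- fst p * radial c m f g (fst p) (snd p),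
      - snd p * radial c m f g (fst p) (snd p) + angular c m f g (fst p) (snd p)))"
    by (auto simp: blowup_field_def)
  ultimately show ?thesis by simp
qed

text \<open>With equal eigenvalues the linearization is lower triangular with equal diagonal entries, so
  that semisimplicity forces the off-diagonal entry to vanish. That entry is the resonant
  coefficient which would produce a logarithm.\<close>

lemma semisimple_no_coupling:
  assumes A: "\<And>x y. bipoly A x y = - (e + y) * radial c m f g x (e + y) + angular c m f g x (e + y)"
    and B: "\<And>x y. bipoly B x y = - radial c m f g x (e + y)"
    and B0: "bipoly B 0 0 = s" and A1: "bipoly (pderiv A) 0 0 = s"
    and semi: "semisimple_eigenvalue (frechet_derivative (blowup_field c m f g) (at (0, e))) s"
  shows "poly (pderiv (poly A 0)) 0 = 0"
proof -
  define F where "F = blowup_field c m f g"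
  define D where "D = frechet_derivative F (at (0, e))"
  define \<alpha> where "\<alpha> = poly (pderiv (poly A 0)) 0"
  have D: "(F has_derivative D) (at (0, e))"
    using blowup_field_differentiable unfolding D_def F_def frechet_derivative_works by blast
  have F: "F (x, e + y) = (x * bipoly B x y, bipoly A x y)" for x y
    by (simp add: F_def blowup_field_def A B algebra_simps)
  have vertical: "((\<lambda>t. F (0, e + t)) has_derivative (\<lambda>t. D (0, t))) (at 0)"
  proof -
    have "((\<lambda>t. (0::complex, e + t)) has_derivative (\<lambda>t. (0, t))) (at 0)"
      by (auto intro!: derivative_eq_intros)
    then show ?thesis using has_derivative_compose[of "\<lambda>t. (0, e + t)" _ 0 UNIV F D] D by simp
  qed
  have horizontal: "((\<lambda>t. F (t, e + 0)) has_derivative (\<lambda>t. D (t, 0))) (at 0)"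
  proof -
    have "((\<lambda>t. (t::complex, e)) has_derivative (\<lambda>t. (t, 0))) (at 0)"
      by (auto intro!: derivative_eq_intros)
    then show ?thesis using has_derivative_compose[of "\<lambda>t. (t, e)" _ 0 UNIV F D] D by simp
  qed
  have v: "D (0, t) = (0, s * t)" for t
  proof (rule prod_eqI)
    have "((\<lambda>t. fst (F (0, e + t))) has_derivative (\<lambda>t. fst (D (0, t)))) (at 0)"
      by (rule has_derivative_fst[OF vertical])
    then have "((\<lambda>t::complex. 0::complex) has_derivative (\<lambda>t. fst (D (0, t)))) (at 0)" by (simp add: F)
    then have "(\<lambda>t. fst (D (0, t))) = (\<lambda>t. 0)" using has_derivative_unique has_derivative_const by blast
    then show "fst (D (0, t)) = fst (0::complex, s * t)" by (metis fst_conv)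
    have "((\<lambda>t. snd (F (0, e + t))) has_derivative (\<lambda>t. snd (D (0, t)))) (at 0)"
      by (rule has_derivative_snd[OF vertical])
    moreover have "((\<lambda>t. snd (F (0, e + t))) has_derivative (*) s) (at 0)"
      using bipoly_has_field_derivative_snd[of A 0 0] by (simp add: F A1 has_field_derivative_def)
    ultimately have "(\<lambda>t. snd (D (0, t))) = (*) s" using has_derivative_unique by blast
    then show "snd (D (0, t)) = snd (0::complex, s * t)" by (metis snd_conv)
  qed
  have h: "D (t, 0) = (s * t, \<alpha> * t)" for t
  proof (rule prod_eqI)
    have "DERIV (\<lambda>t. t * poly (poly B 0) t) 0 :> s"
      using B0 by (auto intro!: derivative_eq_intros simp: bipoly_snd_0)
    then have "((\<lambda>t. fst (F (t, e + 0))) has_derivative (*) s) (at 0)"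
      by (simp only: F fst_conv bipoly_snd_0 has_field_derivative_def)
    moreover have "((\<lambda>t. fst (F (t, e + 0))) has_derivative (\<lambda>t. fst (D (t, 0)))) (at 0)"
      by (rule has_derivative_fst[OF horizontal])
    ultimately have "(\<lambda>t. fst (D (t, 0))) = (*) s" using has_derivative_unique by blast
    then show "fst (D (t, 0)) = fst (s * t, \<alpha> * t)" by (metis fst_conv)
    have "((\<lambda>t. snd (F (t, e + 0))) has_derivative (\<lambda>t. snd (D (t, 0)))) (at 0)"
      by (rule has_derivative_snd[OF horizontal])
    moreover have "((\<lambda>t. snd (F (t, e + 0))) has_derivative (*) \<alpha>) (at 0)"
      using poly_DERIV[of "poly A 0" 0]
      by (simp only: F snd_conv bipoly_snd_0 has_field_derivative_def \<alpha>_def)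
    ultimately have "(\<lambda>t. snd (D (t, 0))) = (*) \<alpha>" using has_derivative_unique by blast
    then show "snd (D (t, 0)) = snd (s * t, \<alpha> * t)" by (metis snd_conv)
  qed
  have "\<forall>v. D (D v - (s * fst v, s * snd v)) -
         (s * fst (D v - (s * fst v, s * snd v)), s * snd (D v - (s * fst v, s * snd v))) = 0 \<longrightarrow>
         D v - (s * fst v, s * snd v) = 0"
    using semi unfolding semisimple_eigenvalue_def Let_def D_def F_def by blast
  from this[rule_format, of "(1, 0)"] show ?thesis
    using h[of 1] v[of \<alpha>] by (simp add: \<alpha>_def zero_prod_def)
qed

text \<open>Resonance \<open>n1 j = n2\<close> would mean that \<open>n2 / n1\<close> is an integer. The hypotheses leave only
  \<open>n1 = n2 = 1\<close>, where semisimplicity makes the zero polynomial already accurate to second order.\<close>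

lemma node_curve:
  assumes equilibrium: "blowup_field c m f g (0, e) = (0, 0)"
    and n: "n1 > 0" "n2 > 0" "coprime n1 n2" and s: "s \<noteq> 0"
    and eigenvalue1: "- radial c m f g 0 e = s * of_nat n1"
    and eigenvalue2: "deriv (\<lambda>z. - z * radial c m f g 0 z + angular c m f g 0 z) e = s * of_nat n2"
    and nonresonant: "real n2 / real n1 \<in> (\<rat> - \<int>) \<union> {1}"
    and semisimple: "real n1 / real n2 = 1 \<Longrightarrow>
      semisimple_eigenvalue (frechet_derivative (blowup_field c m f g) (at (0, e))) s"
  shows "\<exists>\<rho>>0. \<exists>y. y holomorphic_on ball 0 \<rho> \<and> y 0 = e \<and> inj_on (\<lambda>t. (t ^ n1, y t)) (ball 0 \<rho>) \<and>
     (\<forall>t\<in>ball 0 \<rho>. radial c m f g (t ^ n1) (y t) \<noteq> 0 \<and>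
        (\<exists>y'. DERIV y t :> y' \<and> t * y' * (- radial c m f g (t ^ n1) (y t)) =
          of_nat n1 * snd (blowup_field c m f g (t ^ n1, y t))))"
proof -
  define G where "G x y = - y * radial c m f g x y + angular c m f g x y" for x y
  have "polyfun2 G" unfolding G_def
    by (intro polyfun2_intros polyfun2_radial polyfun2_angular)
  then have "polyfun2 (\<lambda>x y. G x (e + y))"
    by (rule polyfun2_compose) (intro polyfun2_intros)+
  then obtain A0 where A0: "\<And>x y. bipoly A0 x y = G x (e + y)"
    unfolding polyfun2_def by metis
  have "polyfun2 (\<lambda>x y. radial c m f g x (e + y))"
    by (rule polyfun2_compose[OF polyfun2_radial]) (intro polyfun2_intros)+
  then have "polyfun2 (\<lambda>x y. - radial c m f g x (e + y))" by (rule polyfun2_uminus)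
  then obtain B where B: "\<And>x y. bipoly B x y = - radial c m f g x (e + y)"
    unfolding polyfun2_def by metis
  define A where "A = smult [:of_nat n1:] A0"
  have A: "bipoly A x y = of_nat n1 * G x (e + y)" for x y
    unfolding A_def using A0[of x y] by (simp add: bipoly_def)
  have B00: "poly (poly B 0) 0 = s * of_nat n1"
    using eigenvalue1 by (simp add: poly_poly_eq_bipoly B)
  have A00: "poly (poly A 0) 0 = 0"
    using equilibrium by (simp add: poly_poly_eq_bipoly A G_def blowup_field_def)
  have A0y: "bipoly (pderiv A0) 0 0 = s * of_nat n2"
  proof -
    have "DERIV (bipoly A0 0) (e - e) :> bipoly (pderiv A0) 0 0"
      using bipoly_has_field_derivative_snd[of A0 0 0] by simp
    moreover have "DERIV (\<lambda>z. z - e) e :> 1"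
      by (auto intro!: derivative_eq_intros)
    ultimately have "DERIV (\<lambda>z. bipoly A0 0 (z - e)) e :> bipoly (pderiv A0) 0 0 * 1"
      by (rule DERIV_chain2)
    then have "DERIV (G 0) e :> bipoly (pderiv A0) 0 0" by (simp add: A0)
    then show ?thesis using eigenvalue2 DERIV_imp_deriv unfolding G_def by metis
  qed
  have A0y': "poly (poly (pderiv A) 0) 0 = s * of_nat n1 * of_nat n2"
    using A0y unfolding A_def by (simp add: pderiv_smult poly_poly_eq_bipoly)
  have "\<exists>Q J. poly Q 0 = 0 \<and> monom 1 J dvd defect n1 A B Q \<and> n2 < n1 * J"
  proof (cases "n1 dvd n2")
    case False
    \<comment> \<open>The defect becomes divisible by \<open>x^J\<close> with the least \<open>J\<close> for which \<open>n1 J > n2\<close>.\<close>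
    have "n1 * j \<noteq> n2" for j using False by auto
    then obtain Q where "poly Q 0 = 0" "monom 1 (Suc (n2 div n1)) dvd defect n1 A B Q"
      using exists_small_defect[OF A0y' A00 B00 s n(1)] by metis
    moreover have "n2 < n1 * Suc (n2 div n1)" 
      using dividend_less_div_times[OF n(1), of n2] by (simp add: mult.commute)
    ultimately show ?thesis by blast
  next
    case True
    then obtain k where k: "n2 = n1 * k" by (rule dvdE)
    then have "real n2 / real n1 = of_int (int k)" using n(1) by simp
    then have "real n2 / real n1 \<in> \<int>" by (metis Ints_of_int)
    then have "n1 = n2" using nonresonant n(1) by simp
    then have n1: "n1 = 1" "n2 = 1" using n(3) by simp_all
    have "poly (pderiv (poly A0 0)) 0 = 0"
      by (rule semisimple_no_coupling[where B = B and s = s])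
         (use A0 B B00 A0y semisimple n1 in \<open>auto simp: G_def poly_poly_eq_bipoly\<close>)
    then have "coeff (poly A0 0) 1 = 0" by (simp add: poly_0_coeff_0 coeff_pderiv)
    then have "coeff (defect n1 A B 0) 1 = 0" by (simp add: defect_def A_def n1)
    moreover have "coeff (defect n1 A B 0) 0 = 0" using A00 by (simp add: defect_def poly_0_coeff_0)
    ultimately have "monom 1 2 dvd defect n1 A B 0"
      by (simp add: monom_1_dvd_iff' less_2_cases_iff)
    then show ?thesis using n1 by (intro exI[of _ 0] exI[of _ 2]) simp
  qed
  then obtain Q J where Q: "poly Q 0 = 0" "monom 1 J dvd defect n1 A B Q" "n2 < n1 * J" by blast
  obtain \<rho> v where v: "\<rho> > 0" "v holomorphic_on ball 0 \<rho>" "v 0 = 1"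
    "\<And>t. t \<in> ball 0 \<rho> \<Longrightarrow> bipoly B (t ^ n1) (poly Q (t ^ n1) + t ^ n2 * v t) \<noteq> 0"
    "\<And>t. t \<in> ball 0 \<rho> \<Longrightarrow> \<exists>y'. DERIV (\<lambda>t. poly Q (t ^ n1) + t ^ n2 * v t) t :> y' \<and>
          t * y' * bipoly B (t ^ n1) (poly Q (t ^ n1) + t ^ n2 * v t) =
          bipoly A (t ^ n1) (poly Q (t ^ n1) + t ^ n2 * v t)"
    using briot_bouquet_solution[OF A0y' B00 s n(1,2) Q] unfolding Let_def by blast
  obtain \<rho>' where \<rho>': "\<rho>' > 0" "\<rho>' \<le> \<rho>"
    "inj_on (\<lambda>t. (t ^ n1, poly Q (t ^ n1) + t ^ n2 * v t)) (ball 0 \<rho>')"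
    using monomial_curve_injective[OF v(2,3,1) n, of Q] by blast
  define y where "y t = e + (poly Q (t ^ n1) + t ^ n2 * v t)" for t
  have "v holomorphic_on ball 0 \<rho>'" using v(2) \<rho>'(2) holomorphic_on_subset by force
  then have "y holomorphic_on ball 0 \<rho>'" unfolding y_def
    by (intro holomorphic_intros holomorphic_on_compose[of _ _ "poly Q", unfolded o_def]) 
  moreover have "y 0 = e" using Q(1) n by (simp add: y_def zero_power)
  moreover have "inj_on (\<lambda>t. (t ^ n1, y t)) (ball 0 \<rho>')"
    using \<rho>'(3) by (simp add: inj_on_def y_def)
  moreover have "radial c m f g (t ^ n1) (y t) \<noteq> 0 \<and>
        (\<exists>y'. DERIV y t :> y' \<and> t * y' * (- radial c m f g (t ^ n1) (y t)) =
          of_nat n1 * snd (blowup_field c m f g (t ^ n1, y t)))" if t: "t \<in> ball 0 \<rho>'" for t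
  proof -
    have t': "t \<in> ball 0 \<rho>" using t \<rho>'(2) by simp
    obtain y' where y': "DERIV (\<lambda>t. poly Q (t ^ n1) + t ^ n2 * v t) t :> y'"
       "t * y' * bipoly B (t ^ n1) (poly Q (t ^ n1) + t ^ n2 * v t) =
          bipoly A (t ^ n1) (poly Q (t ^ n1) + t ^ n2 * v t)"
      using v(5)[OF t'] by blast
    have "DERIV y t :> y'"
      unfolding y_def using DERIV_add[OF DERIV_const y'(1)] by simp
    then show ?thesis using v(4)[OF t'] y'(2) unfolding A B G_def y_def[symmetric]
      by (intro conjI exI[of _ y']) (simp_all add: blowup_field_def)
  qed
  ultimately show ?thesis using \<rho>'(1) by blast
qed

text \<open>The factor \<open>3\<close> is the radius of the disk on which the curve will be defined. It exceeds the radius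
  \<open>2\<close> of the disk that parametrizes the leaf, so that the boundary of the latter has a compact image.\<close>

lemma small_scale:
  fixes eps :: real
  assumes "d > 0" "eps > 0"
  shows "\<exists>\<delta>>0. 3 * \<delta> < d \<and> (\<forall>w>0. (3 * \<delta>) ^ w < eps)"
proof -
  define \<delta> where "\<delta> = min d (min 1 eps) / 6"
  have \<delta>: "\<delta> > 0" "3 * \<delta> < d" "3 * \<delta> < eps" "3 * \<delta> \<le> 1"
    using assms by (auto simp: \<delta>_def min_def)
  have "(3 * \<delta>) ^ w < eps" if "w > 0" for w
  proof -
    have "(3 * \<delta>) ^ w \<le> (3 * \<delta>) ^ 1" using that \<delta> by (intro power_decreasing) auto
    then show ?thesis using \<delta>(3) by simp
  qed
  then show ?thesis using \<delta> by blast
qed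

text \<open>The data of a curve \<open>(u, z)\<close> in the coordinate \<open>\<theta>\<close> in which original time is
  \<open>(\<delta> \<theta>)^((m-1) n1)\<close>; the last two assumptions say that the curve solves the equation in original
  time. All assertions about the leaf, its loops and its real times follow from
  these properties alone.\<close>

locale leaf_disk =
  fixes c :: chart and m :: nat and f g :: "complex poly poly" and n1 :: nat and e :: complex
    and \<delta> \<epsilon> :: real and u z q :: "complex \<Rightarrow> complex"
  assumes degree: "m = max (total_degree f) (total_degree g)" "m \<ge> 2"
    and n1: "n1 > 0" and \<delta>: "\<delta> > 0" and \<epsilon>: "\<epsilon> > 0" and small: "(3 * \<delta>) ^ ((m - 1) * n1) < \<epsilon>"
    and hol: "u holomorphic_on ball 0 3" "z holomorphic_on ball 0 3" "q holomorphic_on ball 0 3"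
    and z0: "z 0 = e" and inj: "inj_on (\<lambda>\<theta>. (u \<theta>, z \<theta>)) (ball 0 3)"
    and u_eq: "\<And>\<theta>. \<theta> \<in> ball 0 3 \<Longrightarrow> u \<theta> = \<theta> ^ n1 * q \<theta>"
    and q_nz: "\<And>\<theta>. \<theta> \<in> ball 0 3 \<Longrightarrow> q \<theta> \<noteq> 0"
    and near: "\<And>\<theta>. \<theta> \<in> ball 0 3 \<Longrightarrow> (u \<theta>, z \<theta>) \<in> ball (0, e) \<epsilon>"
    and radial_nz: "\<And>\<theta>. \<theta> \<in> ball 0 3 \<Longrightarrow> radial c m f g (u \<theta>) (z \<theta>) \<noteq> 0"
    and equilibrium: "blowup_field c m f g (0, e) = (0, 0)"
    and deriv_u: "\<And>\<theta>. \<theta> \<in> ball 0 3 - {0} \<Longrightarrow> DERIV u \<theta> :> of_nat ((m - 1) * n1) * of_real \<delta> ^ ((m - 1) * n1) * \<theta> ^ ((m - 1) * n1 - 1) * fst (original_time_field c m f g (u \<theta>, z \<theta>))"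
    and deriv_z: "\<And>\<theta>. \<theta> \<in> ball 0 3 - {0} \<Longrightarrow> DERIV z \<theta> :> of_nat ((m - 1) * n1) * of_real \<delta> ^ ((m - 1) * n1) * \<theta> ^ ((m - 1) * n1 - 1) * snd (original_time_field c m f g (u \<theta>, z \<theta>))"

text \<open>From \<open>du = - u f1 dt_1\<close> and \<open>dt = u^(m-1) dt_1\<close>, time along the curve \<open>u = t^n1\<close> has the derivative
  \<open>n1 t^(w-1) / (- f1)\<close> with \<open>w = (m-1) n1\<close>, so that it is the \<open>w\<close>-th power of a coordinate. A small
  multiple \<open>\<theta>\<close> of this coordinate is the parameter of the disk.\<close>

lemma time_normalized_curve:
  assumes deg: "m = max (total_degree f) (total_degree g)" "m \<ge> 2" and n1: "n1 > 0"
    and eq: "blowup_field c m f g (0, e) = (0, 0)" and eps: "\<epsilon> > 0" and \<rho>: "\<rho> > 0"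
    and y: "y holomorphic_on ball 0 \<rho>" "y 0 = e" and inj: "inj_on (\<lambda>t. (t ^ n1, y t)) (ball 0 \<rho>)"
    and rad: "\<And>t. t \<in> ball 0 \<rho> \<Longrightarrow> radial c m f g (t ^ n1) (y t) \<noteq> 0"
    and ode: "\<And>t. t \<in> ball 0 \<rho> \<Longrightarrow> \<exists>y'. DERIV y t :> y' \<and>
        t * y' * (- radial c m f g (t ^ n1) (y t)) = of_nat n1 * snd (blowup_field c m f g (t ^ n1, y t))"
  shows "\<exists>\<delta> u z q. leaf_disk c m f g n1 e \<delta> \<epsilon> u z q"
proof -
  define w where "w = (m - 1) * n1"
  have w: "w > 0" using deg(2) n1 by (simp add: w_def)
  define b where "b t = - radial c m f g (t ^ n1) (y t)" for t
  define q0 where "q0 t = of_nat n1 / b t" for t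
  have b: "b t \<noteq> 0" if "t \<in> ball 0 \<rho>" for t using rad[OF that] by (simp add: b_def)
  have "(\<lambda>t. radial c m f g (t ^ n1) (y t)) holomorphic_on ball 0 \<rho>"
    by (rule polyfun2_holomorphic[OF polyfun2_radial _ y(1)]) (intro holomorphic_intros)
  then have "b holomorphic_on ball 0 \<rho>" unfolding b_def by (intro holomorphic_intros)
  then have "q0 holomorphic_on ball 0 \<rho>" unfolding q0_def using b by (intro holomorphic_intros)
  moreover have "q0 0 \<noteq> 0" using b[of 0] \<rho> n1 by (simp add: q0_def)
  ultimately obtain \<rho>1 h where \<rho>1: "\<rho>1 > 0" "\<rho>1 \<le> \<rho>" and h: "h holomorphic_on ball 0 \<rho>1"
      "\<forall>t\<in>ball 0 \<rho>1. h t \<noteq> 0"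
      "\<And>t. t \<in> ball 0 \<rho>1 \<Longrightarrow> DERIV (\<lambda>t. (t * h t) ^ w) t :> t ^ (w - 1) * q0 t"
    using time_root[of q0 \<rho> w] \<rho> w by blast
  obtain d0 \<eta> k where d0: "d0 > 0" and \<eta>: "\<eta> holomorphic_on ball 0 d0" "k holomorphic_on ball 0 d0"
      "inj_on \<eta> (ball 0 d0)" "\<eta> ` ball 0 d0 \<subseteq> ball 0 \<rho>1"
      "\<And>s. s \<in> ball 0 d0 \<Longrightarrow> \<eta> s * h (\<eta> s) = s \<and> \<eta> s = s * k s \<and> k s \<noteq> 0"
    using local_inverse_at_0[OF h(1,2) \<rho>1(1)] by blast
  have \<eta>_mem: "\<eta> s \<in> ball 0 \<rho>" "\<eta> s \<in> ball 0 \<rho>1" if "s \<in> ball 0 d0" for s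
    using \<eta>(4) \<rho>1(2) that by (force simp: image_subset_iff)+
  have y\<eta>: "(\<lambda>s. y (\<eta> s)) holomorphic_on ball 0 d0"
    using holomorphic_on_compose_gen[OF \<eta>(1) y(1)] \<eta>_mem by (auto simp: o_def image_subset_iff)
  have "continuous_on (ball 0 d0) (\<lambda>s. (\<eta> s ^ n1, y (\<eta> s)))"
    using holomorphic_on_imp_continuous_on[OF y\<eta>] holomorphic_on_imp_continuous_on[OF \<eta>(1)]
    by (intro continuous_intros)
  then have "continuous (at 0) (\<lambda>s. (\<eta> s ^ n1, y (\<eta> s)))"
    using d0 by (simp add: continuous_on_eq_continuous_at)
  then obtain d1 where d1: "d1 > 0"
      "\<And>s. dist s 0 < d1 \<Longrightarrow> dist (\<eta> s ^ n1, y (\<eta> s)) (\<eta> 0 ^ n1, y (\<eta> 0)) < \<epsilon>"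
    using eps unfolding continuous_at_eps_delta by blast
  have \<eta>0: "\<eta> 0 = 0" using \<eta>(5)[of 0] d0 by simp
  obtain \<delta> where \<delta>: "\<delta> > 0" "3 * \<delta> < min d0 d1" "(3 * \<delta>) ^ w < \<epsilon>"
    using small_scale[of "min d0 d1" \<epsilon>] d0 d1(1) eps w by auto
  define u where "u \<theta> = \<eta> (of_real \<delta> * \<theta>) ^ n1" for \<theta>
  define z where "z \<theta> = y (\<eta> (of_real \<delta> * \<theta>))" for \<theta>
  define q where "q \<theta> = (of_real \<delta> * k (of_real \<delta> * \<theta>)) ^ n1" for \<theta>
  have scale: "of_real \<delta> * \<theta> \<in> ball 0 d0" "norm (of_real \<delta> * \<theta>) < d1" if "\<theta> \<in> ball 0 3" for \<theta> :: complex
  proof -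
    have "norm (of_real \<delta> * \<theta>) \<le> \<delta> * 3" using that \<delta>(1) by (simp add: norm_mult)
    then show "of_real \<delta> * \<theta> \<in> ball 0 d0" "norm (of_real \<delta> * \<theta>) < d1" using \<delta>(2) by auto
  qed
  have comp: "(\<lambda>\<theta>. p (of_real \<delta> * \<theta>)) holomorphic_on ball 0 3" if "p holomorphic_on ball 0 d0" for p
  proof -
    have "(\<lambda>\<theta>::complex. of_real \<delta> * \<theta>) ` ball 0 3 \<subseteq> ball 0 d0" using scale(1) by blast
    then show ?thesis
      using holomorphic_on_compose_gen[OF _ that, of "\<lambda>\<theta>. of_real \<delta> * \<theta>" "ball 0 3"]
      by (simp add: o_def holomorphic_intros)
  qed
  have hol: "u holomorphic_on ball 0 3" "z holomorphic_on ball 0 3" "q holomorphic_on ball 0 3"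
    unfolding u_def z_def q_def
    using comp[OF \<eta>(1)] comp[OF y\<eta>] comp[OF \<eta>(2)] by (auto intro!: holomorphic_intros)
  have inj3: "inj_on (\<lambda>\<theta>. (u \<theta>, z \<theta>)) (ball 0 3)"
  proof (rule inj_onI)
    fix \<theta> \<theta>' :: complex assume t: "\<theta> \<in> ball 0 3" "\<theta>' \<in> ball 0 3" and eq: "(u \<theta>, z \<theta>) = (u \<theta>', z \<theta>')"
    have "\<eta> (of_real \<delta> * \<theta>) = \<eta> (of_real \<delta> * \<theta>')"
      by (rule inj_onD[OF inj]) (use eq \<eta>_mem(1)[OF scale(1)] t in \<open>simp_all add: u_def z_def\<close>)
    then have "of_real \<delta> * \<theta> = of_real \<delta> * \<theta>'"
      by (rule inj_onD[OF \<eta>(3)]) (use scale t in blast)+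
    then show "\<theta> = \<theta>'" using \<delta>(1) by simp
  qed
  have derivs: "DERIV u \<theta> :> of_nat w * of_real \<delta> ^ w * \<theta> ^ (w - 1) * fst (original_time_field c m f g (u \<theta>, z \<theta>)) \<and>
        DERIV z \<theta> :> of_nat w * of_real \<delta> ^ w * \<theta> ^ (w - 1) * snd (original_time_field c m f g (u \<theta>, z \<theta>))"
    if "\<theta> \<in> ball 0 3 - {0}" for \<theta>
  proof -
    have \<theta>: "\<theta> \<in> ball 0 3" "\<theta> \<noteq> 0" using that by auto
    define s where "s = of_real \<delta> * \<theta>"
    define t where "t = \<eta> s"
    define \<eta>' where "\<eta>' = deriv \<eta> s"
    have s: "s \<in> ball 0 d0" "s \<noteq> 0" using scale(1) \<theta> \<delta>(1) by (auto simp: s_def)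
    have t: "t \<in> ball 0 \<rho>" "t \<in> ball 0 \<rho>1" "t \<noteq> 0" "t * h t = s"
      using \<eta>_mem[OF s(1)] \<eta>(5)[OF s(1)] s(2) by (auto simp: t_def)
    have d\<eta>: "DERIV \<eta> s :> \<eta>'"
      unfolding \<eta>'_def by (rule holomorphic_derivI[OF \<eta>(1) open_ball s(1)])
    have dscale: "DERIV (\<lambda>\<theta>. of_real \<delta> * \<theta>) \<theta> :> of_real \<delta>"
      by (auto intro!: derivative_eq_intros)
    have d\<eta>': "DERIV (\<lambda>\<theta>. \<eta> (of_real \<delta> * \<theta>)) \<theta> :> \<eta>' * of_real \<delta>"
      using d\<eta> dscale unfolding s_def by (rule DERIV_chain2)
    have key: "of_nat w * s ^ (w - 1) = t ^ (w - 1) * q0 t * \<eta>'"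
    proof -
      have "DERIV (\<lambda>s. (\<eta> s * h (\<eta> s)) ^ w) s :> t ^ (w - 1) * q0 t * \<eta>'"
        using h(3)[OF t(2)] d\<eta> unfolding t_def by (rule DERIV_chain2)
      then have "DERIV (\<lambda>s. s ^ w) s :> t ^ (w - 1) * q0 t * \<eta>'"
        by (rule has_field_derivative_transform_within_open[OF _ open_ball s(1)]) (use \<eta>(5) in metis)
      moreover have "DERIV (\<lambda>s. s ^ w) s :> of_nat w * s ^ (w - 1)"
        by (auto intro!: derivative_eq_intros)
      ultimately show ?thesis by (rule DERIV_unique[symmetric])
    qed
    have pw: "of_nat w * of_real \<delta> ^ w * \<theta> ^ (w - 1) = of_real \<delta> * (t ^ (w - 1) * q0 t * \<eta>')"
    proof -
      have "of_real \<delta> ^ w = of_real \<delta> * (of_real \<delta> :: complex) ^ (w - 1)"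
        using w by (cases w) simp_all
      then show ?thesis unfolding key[symmetric] s_def by (simp add: power_mult_distrib)
    qed
    have uz: "u \<theta> = t ^ n1" "z \<theta> = y t" by (simp_all add: u_def z_def t_def s_def)
    have upow: "(t ^ n1) ^ (m - 1) = t * t ^ (w - 1)"
    proof -
      have "(t ^ n1) ^ (m - 1) = t ^ w" by (simp add: w_def mult.commute flip: power_mult)
      then show ?thesis using w by (cases w) simp_all
    qed
    have bt: "b t \<noteq> 0" by (rule b[OF t(1)])
    obtain y' where y': "DERIV y t :> y'"
      "t * y' * b t = of_nat n1 * snd (blowup_field c m f g (t ^ n1, y t))"
      using ode[OF t(1)] unfolding b_def by blast
    have "DERIV u \<theta> :> of_nat n1 * t ^ (n1 - 1) * (\<eta>' * of_real \<delta>)"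
      unfolding u_def t_def s_def by (auto intro!: derivative_eq_intros d\<eta>')
    moreover have "of_nat n1 * t ^ (n1 - 1) * (\<eta>' * of_real \<delta>) =
        of_nat w * of_real \<delta> ^ w * \<theta> ^ (w - 1) * fst (original_time_field c m f g (u \<theta>, z \<theta>))"
    proof -
      have "fst (original_time_field c m f g (u \<theta>, z \<theta>)) = t ^ n1 * b t / (t * t ^ (w - 1))"
        unfolding original_time_field_def blowup_field_def uz upow[symmetric] b_def by simp
      moreover have "t ^ n1 = t * t ^ (n1 - 1)" using n1 by (cases n1) simp_all
      ultimately show ?thesis unfolding pw q0_def using bt t(3) by (simp add: field_simps)
    qed
    moreover have "DERIV z \<theta> :> y' * (\<eta>' * of_real \<delta>)"
      using y'(1) d\<eta>' unfolding z_def t_def s_def by (rule DERIV_chain2)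
    moreover have "y' * (\<eta>' * of_real \<delta>) =
        of_nat w * of_real \<delta> ^ w * \<theta> ^ (w - 1) * snd (original_time_field c m f g (u \<theta>, z \<theta>))"
    proof -
      have "snd (blowup_field c m f g (t ^ n1, y t)) = t * y' * b t / of_nat n1"
        using y'(2) n1 by (simp add: field_simps)
      then have "snd (original_time_field c m f g (u \<theta>, z \<theta>)) = t * y' * b t / of_nat n1 / (t * t ^ (w - 1))"
        unfolding original_time_field_def uz upow[symmetric] by simp
      then show ?thesis unfolding pw q0_def using bt t(3) n1 by (simp add: field_simps)
    qed
    ultimately show ?thesis by simp
  qed
  have pts: "u \<theta> = \<theta> ^ n1 * q \<theta> \<and> q \<theta> \<noteq> 0 \<and> (u \<theta>, z \<theta>) \<in> ball (0, e) \<epsilon> \<and>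
        radial c m f g (u \<theta>) (z \<theta>) \<noteq> 0" if \<theta>: "\<theta> \<in> ball 0 3" for \<theta>
  proof (intro conjI)
    have "\<eta> (of_real \<delta> * \<theta>) = of_real \<delta> * \<theta> * k (of_real \<delta> * \<theta>)" "k (of_real \<delta> * \<theta>) \<noteq> 0"
      using \<eta>(5)[OF scale(1)[OF \<theta>]] by auto
    then show "u \<theta> = \<theta> ^ n1 * q \<theta>" "q \<theta> \<noteq> 0"
      using \<delta>(1) by (simp_all add: u_def q_def power_mult_distrib)
    show "(u \<theta>, z \<theta>) \<in> ball (0, e) \<epsilon>"
      using d1(2)[of "of_real \<delta> * \<theta>"] scale(2)[OF \<theta>] n1 y(2)
      by (simp add: \<eta>0 zero_power u_def z_def dist_commute)
    show "radial c m f g (u \<theta>) (z \<theta>) \<noteq> 0"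
      using rad[OF \<eta>_mem(1)[OF scale(1)[OF \<theta>]]] by (simp add: u_def z_def)
  qed
  have z0: "z 0 = e" by (simp add: z_def \<eta>0 y(2))
  have "leaf_disk c m f g n1 e \<delta> \<epsilon> u z q"
    using pts derivs unfolding w_def
    by (intro leaf_disk.intro deg n1 \<delta>(1) eps \<delta>(3)[unfolded w_def] hol z0 inj3 eq) blast+
  then show ?thesis by blast
qed

section \<open>Complex-time solutions\<close>

lemma eventually_mem_ball:
  assumes "isCont \<psi> t" "r > 0"
  shows "\<forall>\<^sub>F s in nhds t. \<psi> s \<in> ball (\<psi> t) r"
proof -
  have "\<forall>\<^sub>F s in at t. \<psi> s \<in> ball (\<psi> t) r"
    using tendstoD[OF assms(1)[unfolded isCont_def] assms(2)] by (simp add: dist_commute)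
  then show ?thesis using assms(2) by (simp add: eventually_nhds_conv_at)
qed

lemma holomorphic_local_inverse:
  assumes "M holomorphic_on H" "open H" "x \<in> H" and nz: "\<And>h. h \<in> H \<Longrightarrow> deriv M h \<noteq> 0"
  shows "\<exists>r>0. \<exists>N. ball x r \<subseteq> H \<and> open (M ` ball x r) \<and>
     (\<forall>h\<in>ball x r. N (M h) = h \<and> DERIV N (M h) :> inverse (deriv M h))"
proof -
  obtain r where r: "r > 0" "ball x r \<subseteq> H" "open (M ` ball x r)" "inj_on M (ball x r)"
    by (rule has_complex_derivative_locally_invertible[OF assms(1,3,2) nz[OF assms(3)]]) (rule that)
  have hol: "M holomorphic_on ball x r" by (rule holomorphic_on_subset[OF assms(1) r(2)])
  obtain N where N: "N holomorphic_on M ` ball x r"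
      "\<And>h. h \<in> ball x r \<Longrightarrow> deriv M h * deriv N (M h) = 1" "\<And>h. h \<in> ball x r \<Longrightarrow> N (M h) = h"
    using holomorphic_has_inverse[OF hol open_ball r(4)] by metis
  have "DERIV N (M h) :> inverse (deriv M h)" if h: "h \<in> ball x r" for h
  proof -
    have "DERIV N (M h) :> deriv N (M h)"
      by (rule holomorphic_derivI[OF N(1) r(3)]) (use h in blast)
    moreover have "deriv N (M h) = inverse (deriv M h)"
      using N(2)[OF h] by (metis inverse_unique)
    ultimately show ?thesis by simp
  qed
  then show ?thesis using r N(3) by blast
qed

text \<open>Locally the lift is the composition of a holomorphic inverse with the given differentiable map;
  continuity keeps it in the domain of this inverse.\<close>

lemma lift_has_derivative:
  fixes \<psi> :: "'a :: real_normed_vector \<Rightarrow> complex"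
  assumes M: "M holomorphic_on H" "open H" "\<psi> t \<in> H" "\<And>h. h \<in> H \<Longrightarrow> deriv M h \<noteq> 0"
    and cont: "isCont \<psi> t" and lift: "((\<lambda>s. M (\<psi> s)) has_derivative a) (at t)"
  shows "(\<psi> has_derivative (\<lambda>h. a h / deriv M (\<psi> t))) (at t)"
proof -
  obtain r N where r: "r > 0" and N: "\<And>h. h \<in> ball (\<psi> t) r \<Longrightarrow> N (M h) = h"
    "\<And>h. h \<in> ball (\<psi> t) r \<Longrightarrow> DERIV N (M h) :> inverse (deriv M h)"
    using holomorphic_local_inverse[OF M] by blast
  have "(N has_derivative (*) (inverse (deriv M (\<psi> t)))) (at (M (\<psi> t)))"
    using N(2)[of "\<psi> t"] r by (simp add: has_field_derivative_def)
  from has_derivative_compose[OF lift this]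
  have "((\<lambda>s. N (M (\<psi> s))) has_derivative (\<lambda>h. a h / deriv M (\<psi> t))) (at t)"
    by (simp add: divide_inverse mult.commute)
  moreover obtain S where "open S" "t \<in> S" "\<And>s. s \<in> S \<Longrightarrow> \<psi> s \<in> ball (\<psi> t) r"
    using eventually_mem_ball[OF cont r] unfolding eventually_nhds by blast
  ultimately show ?thesis
    using has_derivative_transform_within_open[of _ _ t UNIV S \<psi>] N(1) by blast
qed

text \<open>A curve that is tangent to the field becomes a solution after inverting its time function \<open>M\<close>.\<close>

lemma local_solution_from_time:
  assumes M: "M holomorphic_on H" "open H" "\<And>h. h \<in> H \<Longrightarrow> deriv M h \<noteq> 0" and h0: "h0 \<in> H"
    and d1: "\<And>h. h \<in> H \<Longrightarrow> DERIV (\<lambda>h. fst (\<Psi> h)) h :> deriv M h * fst (F (\<Psi> h))"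
    and d2: "\<And>h. h \<in> H \<Longrightarrow> DERIV (\<lambda>h. snd (\<Psi> h)) h :> deriv M h * snd (F (\<Psi> h))"
  shows "\<exists>r>0. \<exists>\<phi>. ball h0 r \<subseteq> H \<and> open (M ` ball h0 r) \<and> solves F (M ` ball h0 r) \<phi> \<and>
     (\<forall>h\<in>ball h0 r. \<phi> (M h) = \<Psi> h)"
proof -
  obtain r N where r: "r > 0" "ball h0 r \<subseteq> H" "open (M ` ball h0 r)"
    and N: "\<And>h. h \<in> ball h0 r \<Longrightarrow> N (M h) = h"
    "\<And>h. h \<in> ball h0 r \<Longrightarrow> DERIV N (M h) :> inverse (deriv M h)"
    using holomorphic_local_inverse[OF M(1,2) h0 M(3)] by blast
  have "solves F (M ` ball h0 r) (\<lambda>t. \<Psi> (N t))"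
    unfolding solves_def
  proof
    fix t assume "t \<in> M ` ball h0 r"
    then obtain h where h: "h \<in> ball h0 r" "t = M h" by blast
    have hH: "h \<in> H" using h(1) r(2) by blast
    have dN: "DERIV N t :> inverse (deriv M h)" using N(2)[OF h(1)] h(2) by simp
    have Nt: "N t = h" using N(1) h by simp
    have "DERIV (\<lambda>s. fst (\<Psi> (N s))) t :> (deriv M h * fst (F (\<Psi> h))) * inverse (deriv M h)"
      by (rule DERIV_chain2[OF _ dN]) (use d1[OF hH] Nt in simp)
    moreover have "DERIV (\<lambda>s. snd (\<Psi> (N s))) t :> (deriv M h * snd (F (\<Psi> h))) * inverse (deriv M h)"
      by (rule DERIV_chain2[OF _ dN]) (use d2[OF hH] Nt in simp)
    moreover have "deriv M h * x * inverse (deriv M h) = x" for x using M(3)[OF hH] by simp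
    ultimately show "DERIV (\<lambda>s. fst (\<Psi> (N s))) t :> fst (F (\<Psi> (N t))) \<and>
          DERIV (\<lambda>s. snd (\<Psi> (N s))) t :> snd (F (\<Psi> (N t)))"
      using Nt by simp
  qed
  then show ?thesis using r N(1) by (intro exI[of _ r] conjI exI[of _ "\<lambda>t. \<Psi> (N t)"]) auto
qed

lemma continued_along_from_time:
  assumes M: "M holomorphic_on H" "open H" "\<And>h. h \<in> H \<Longrightarrow> deriv M h \<noteq> 0"
    and d1: "\<And>h. h \<in> H \<Longrightarrow> DERIV (\<lambda>h. fst (\<Psi> h)) h :> deriv M h * fst (F (\<Psi> h))"
    and d2: "\<And>h. h \<in> H \<Longrightarrow> DERIV (\<lambda>h. snd (\<Psi> h)) h :> deriv M h * snd (F (\<Psi> h))"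
    and l: "path l" "path_image l \<subseteq> H"
  shows "continued_along F (M \<circ> l) (\<Psi> \<circ> l)"
  unfolding continued_along_def
proof (intro conjI ballI)
  show "path (M \<circ> l)"
    using l holomorphic_on_imp_continuous_on[OF M(1)]
    by (intro path_continuous_image) (auto intro: continuous_on_subset)
  have "continuous_on H (\<lambda>h. (fst (\<Psi> h), snd (\<Psi> h)))"
    by (intro continuous_on_Pair continuous_at_imp_continuous_on ballI)
       (use d1 d2 DERIV_isCont in blast)+
  then have "continuous_on H \<Psi>" by simp
  then show "path (\<Psi> \<circ> l)"
    using l by (intro path_continuous_image) (auto intro: continuous_on_subset)
  fix s :: real assume s: "s \<in> {0..1}"
  have "l s \<in> H" using s l(2) by (auto simp: path_image_def)
  then obtain r \<phi> where r: "r > 0" "open (M ` ball (l s) r)" "solves F (M ` ball (l s) r) \<phi>"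
    "\<And>h. h \<in> ball (l s) r \<Longrightarrow> \<phi> (M h) = \<Psi> h"
    using local_solution_from_time[where F = F and \<Psi> = \<Psi>, OF M _ d1 d2] by blast
  have "continuous_on {0..1} l" using l(1) by (simp add: path_def)
  then obtain \<eta> where \<eta>: "\<eta> > 0" "\<And>s'. s' \<in> {0..1} \<Longrightarrow> dist s' s < \<eta> \<Longrightarrow> dist (l s') (l s) < r"
    using s r(1) unfolding continuous_on_iff by blast
  then have "l s' \<in> ball (l s) r" if "s' \<in> {0..1}" "\<bar>s' - s\<bar> < \<eta>" for s'
    using that by (simp add: dist_real_def dist_commute)
  then show "\<exists>D \<phi> \<eta>. open D \<and> solves F D \<phi> \<and> \<eta> > 0 \<and>
        (\<forall>s'\<in>{0..1}. \<bar>s' - s\<bar> < \<eta> \<longrightarrow> (M \<circ> l) s' \<in> D \<and> (\<Psi> \<circ> l) s' = \<phi> ((M \<circ> l) s'))"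
    using r \<eta>(1) by (intro exI[of _ "M ` ball (l s) r"] exI[of _ \<phi>] exI[of _ \<eta>]) auto
qed

lemma solvesD:
  assumes "solves F D \<phi>" "t \<in> D"
  shows "DERIV (\<lambda>s. fst (\<phi> s)) t :> fst (F (\<phi> t))"
    "DERIV (\<lambda>s. snd (\<phi> s)) t :> snd (F (\<phi> t))"
  using assms unfolding solves_def by blast+

lemma solves_isCont:
  assumes "solves F D \<phi>" "t \<in> D"
  shows "isCont (\<lambda>s. fst (\<phi> s)) t" "isCont (\<lambda>s. snd (\<phi> s)) t" "isCont \<phi> t"
proof -
  show 1: "isCont (\<lambda>s. fst (\<phi> s)) t" and 2: "isCont (\<lambda>s. snd (\<phi> s)) t"
    using solvesD[OF assms] DERIV_isCont by blast+
  show "isCont \<phi> t" using isCont_Pair[OF 1 2] by simp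
qed

lemma solves_subset: "solves F D \<phi> \<Longrightarrow> D' \<subseteq> D \<Longrightarrow> solves F D' \<phi>"
  unfolding solves_def by blast

text \<open>On a disk of radius smaller than the inverse Lipschitz constant, the mean value inequality
  bounds the distance of two solutions by a fraction of itself.\<close>

lemma polynomial_ode_unique:
  assumes h: "polyfun2 h1" "polyfun2 h2" and F: "\<And>x y. F (x, y) = (h1 x y, h2 x y)"
    and sol: "solves F D \<phi>" "solves F D \<psi>" and D: "open D" "t0 \<in> D" and eq: "\<phi> t0 = \<psi> t0"
  shows "\<exists>r>0. ball t0 r \<subseteq> D \<and> (\<forall>t\<in>ball t0 r. \<phi> t = \<psi> t)"
proof -
  obtain r0 where r0: "r0 > 0" "cball t0 r0 \<subseteq> D" using D open_contains_cball by blast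
  have cont: "continuous_on (cball t0 r0) (\<lambda>s. fst (\<phi> s))" "continuous_on (cball t0 r0) (\<lambda>s. snd (\<phi> s))"
    "continuous_on (cball t0 r0) (\<lambda>s. fst (\<psi> s))" "continuous_on (cball t0 r0) (\<lambda>s. snd (\<psi> s))"
    using solves_isCont[OF sol(1)] solves_isCont[OF sol(2)] r0(2)
    by (intro continuous_at_imp_continuous_on ballI; blast)+
  have "bounded ((\<lambda>s. fst (\<phi> s)) ` cball t0 r0 \<union> (\<lambda>s. snd (\<phi> s)) ` cball t0 r0 \<union>
     (\<lambda>s. fst (\<psi> s)) ` cball t0 r0 \<union> (\<lambda>s. snd (\<psi> s)) ` cball t0 r0)"
    using cont by (intro bounded_Un[THEN iffD2] conjI compact_imp_bounded compact_continuous_image compact_cball)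
  then obtain M where bd: "\<forall>x\<in>(\<lambda>s. fst (\<phi> s)) ` cball t0 r0 \<union> (\<lambda>s. snd (\<phi> s)) ` cball t0 r0 \<union>
     (\<lambda>s. fst (\<psi> s)) ` cball t0 r0 \<union> (\<lambda>s. snd (\<psi> s)) ` cball t0 r0. norm x \<le> M"
    unfolding bounded_iff ..
  have M: "norm (fst (\<phi> s)) \<le> M \<and> norm (snd (\<phi> s)) \<le> M \<and>
      norm (fst (\<psi> s)) \<le> M \<and> norm (snd (\<psi> s)) \<le> M" if "s \<in> cball t0 r0" for s
    using bd that by (simp only: ball_Un image_iff ball_simps)
  obtain K1 where K1: "K1 \<ge> 0" "\<And>x y x' y'. norm x \<le> M \<Longrightarrow> norm y \<le> M \<Longrightarrow> norm x' \<le> M \<Longrightarrow> norm y' \<le> M \<Longrightarrow>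
      norm (h1 x y - h1 x' y') \<le> K1 * (norm (x - x') + norm (y - y'))"
    using polyfun2_locally_lipschitz[OF h(1), of M] by blast
  obtain K2 where K2: "K2 \<ge> 0" "\<And>x y x' y'. norm x \<le> M \<Longrightarrow> norm y \<le> M \<Longrightarrow> norm x' \<le> M \<Longrightarrow> norm y' \<le> M \<Longrightarrow>
      norm (h2 x y - h2 x' y') \<le> K2 * (norm (x - x') + norm (y - y'))"
    using polyfun2_locally_lipschitz[OF h(2), of M] by blast
  define K where "K = K1 + K2 + 1"
  define r where "r = min r0 (1 / (2 * K))"
  have K: "K > 0" using K1 K2 by (simp add: K_def)
  have r: "r > 0" "r \<le> r0" "K * r \<le> 1 / 2"
  proof -
    show "r > 0" "r \<le> r0" using r0(1) K by (auto simp: r_def)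
    have "K * r \<le> K * (1 / (2 * K))" using K by (intro mult_left_mono) (auto simp: r_def)
    then show "K * r \<le> 1 / 2" using K by simp
  qed
  have sub: "cball t0 r \<subseteq> cball t0 r0" using r(2) by (simp add: cball_subset_cball_iff)
  define n where "n t = norm (fst (\<phi> t) - fst (\<psi> t)) + norm (snd (\<phi> t) - snd (\<psi> t))" for t
  have cn: "continuous_on (cball t0 r) n" unfolding n_def
    by (intro continuous_on_add continuous_on_norm continuous_on_diff; rule continuous_on_subset[OF _ sub])
       (fact cont)+
  have "cball t0 r \<noteq> {}" using r(1) by simp
  then obtain tm where tm: "tm \<in> cball t0 r" "\<And>t. t \<in> cball t0 r \<Longrightarrow> n t \<le> n tm"
    using continuous_attains_sup[OF compact_cball _ cn] by blast
  have F1: "fst (F p) = h1 (fst p) (snd p)" and F2: "snd (F p) = h2 (fst p) (snd p)" for p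
    by (cases p; simp only: F fst_conv snd_conv)+
  have tD: "t \<in> D" if "t \<in> cball t0 r" for t using that sub r0(2) by blast
  have t00: "t0 \<in> cball t0 r" using r(1) by simp
  have est: "norm ((p (\<phi> tm) - p (\<psi> tm)) - (p (\<phi> t0) - p (\<psi> t0))) \<le> (C * n tm) * norm (tm - t0)"
    if p: "\<And>\<sigma> t. solves F D \<sigma> \<Longrightarrow> t \<in> D \<Longrightarrow> DERIV (\<lambda>s. p (\<sigma> s)) t :> p (F (\<sigma> t))"
      and C: "C \<ge> 0" "\<And>t. t \<in> cball t0 r \<Longrightarrow> norm (p (F (\<phi> t)) - p (F (\<psi> t))) \<le> C * n t"
    for p :: "c2 \<Rightarrow> complex" and C
  proof (rule field_differentiable_bound[of "cball t0 r" "\<lambda>t. p (\<phi> t) - p (\<psi> t)"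
        "\<lambda>t. p (F (\<phi> t)) - p (F (\<psi> t))" "C * n tm" tm t0])
    fix t assume t: "t \<in> cball t0 r"
    show "((\<lambda>t. p (\<phi> t) - p (\<psi> t)) has_field_derivative p (F (\<phi> t)) - p (F (\<psi> t))) (at t within cball t0 r)"
      by (rule has_field_derivative_at_within) (intro DERIV_diff p sol tD t)
    have "C * n t \<le> C * n tm" using C(1) tm(2)[OF t] by (intro mult_left_mono)
    then show "norm (p (F (\<phi> t)) - p (F (\<psi> t))) \<le> C * n tm" using C(2)[OF t] by linarith
  qed (use tm(1) t00 in auto)
  have "norm ((fst (\<phi> tm) - fst (\<psi> tm)) - (fst (\<phi> t0) - fst (\<psi> t0))) \<le> (K1 * n tm) * norm (tm - t0)"
    by (rule est[OF solvesD(1) K1(1)]) (use M sub in \<open>auto simp: F1 n_def intro!: K1(2)\<close>)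
  moreover have "norm ((snd (\<phi> tm) - snd (\<psi> tm)) - (snd (\<phi> t0) - snd (\<psi> t0))) \<le> (K2 * n tm) * norm (tm - t0)"
    by (rule est[OF solvesD(2) K2(1)]) (use M sub in \<open>auto simp: F2 n_def intro!: K2(2)\<close>)
  ultimately have "n tm \<le> (K1 * n tm) * norm (tm - t0) + (K2 * n tm) * norm (tm - t0)"
    using eq by (simp add: n_def)
  also have "\<dots> = (K1 + K2) * norm (tm - t0) * n tm" by (simp add: algebra_simps)
  also have "\<dots> \<le> K * r * n tm"
    using tm(1) K1(1) K2(1) K
    by (intro mult_right_mono mult_mono) (auto simp: K_def n_def dist_norm norm_minus_commute)
  also have "\<dots> \<le> 1 / 2 * n tm" using r(3) by (intro mult_right_mono) (auto simp: n_def)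
  finally have "n tm \<le> 0" by simp
  then have "\<phi> t = \<psi> t" if "t \<in> cball t0 r" for t
    using tm(2)[OF that] unfolding n_def
    by (intro prod_eqI) (smt (verit) norm_ge_zero norm_le_zero_iff right_minus_eq)+
  then show ?thesis using r(1) tD by (intro exI[of _ r]) auto
qed

section \<open>The leaf through a time-normalized curve\<close>

lemma blowup_field_unique:
  assumes "solves (blowup_field c m f g) D \<phi>" "solves (blowup_field c m f g) D \<psi>" "open D" "t0 \<in> D"
    and "\<phi> t0 = \<psi> t0"
  shows "\<exists>r>0. ball t0 r \<subseteq> D \<and> (\<forall>t\<in>ball t0 r. \<phi> t = \<psi> t)"
proof (rule polynomial_ode_unique[OF _ _ _ assms])
  show "polyfun2 (\<lambda>u z. - u * radial c m f g u z)"
       "polyfun2 (\<lambda>u z. - z * radial c m f g u z + angular c m f g u z)"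
    by (intro polyfun2_intros polyfun2_radial polyfun2_angular)+
qed (simp add: blowup_field_def)

lemma eventually_path_in_open:
  assumes "path \<gamma>" "s \<in> {0..1}" "open S" "\<gamma> s \<in> S"
  shows "\<forall>\<^sub>F s' in at s within {0..1}. s' \<in> {0..1} \<and> \<gamma> s' \<in> S"
proof -
  have "(\<gamma> \<longlongrightarrow> \<gamma> s) (at s within {0..1})"
    using assms(1,2) unfolding path_def continuous_on_def by blast
  from topological_tendstoD[OF this assms(3,4)]
  have "\<forall>\<^sub>F s' in at s within {0..1}. \<gamma> s' \<in> S" .
  moreover have "\<forall>\<^sub>F s' in at s within {0..1}. s' \<in> {0..1}"
    by (simp add: eventually_at_filter)
  ultimately show ?thesis by eventually_elim simp
qed

text \<open>Local properties of solutions transfer to nearby points of a continuation.\<close>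

lemma eventually_continued_along:
  assumes "continued_along F \<gamma>t \<gamma>p" "s \<in> {0..1}"
    and "\<And>D \<phi>. open D \<Longrightarrow> solves F D \<phi> \<Longrightarrow> \<gamma>t s \<in> D \<Longrightarrow> \<gamma>p s = \<phi> (\<gamma>t s) \<Longrightarrow>
       \<exists>r>0. \<forall>t\<in>ball (\<gamma>t s) r. Q t (\<phi> t)"
  shows "\<forall>\<^sub>F s' in at s within {0..1}. Q (\<gamma>t s') (\<gamma>p s')"
proof -
  obtain D \<phi> \<eta> where D: "open D" "solves F D \<phi>" "\<eta> > 0"
    "\<And>s'. s' \<in> {0..1} \<Longrightarrow> \<bar>s' - s\<bar> < \<eta> \<Longrightarrow> \<gamma>t s' \<in> D \<and> \<gamma>p s' = \<phi> (\<gamma>t s')"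
    using assms(1,2) unfolding continued_along_def by meson
  obtain r where r: "r > 0" "\<And>t. t \<in> ball (\<gamma>t s) r \<Longrightarrow> Q t (\<phi> t)"
    using assms(3)[OF D(1,2)] D(3,4) assms(2) by (metis abs_0 diff_self)
  have "path \<gamma>t" using assms(1) unfolding continued_along_def by blast
  from eventually_path_in_open[OF this assms(2) open_ball, of "\<gamma>t s" r]
  have "\<forall>\<^sub>F s' in at s within {0..1}. s' \<in> {0..1} \<and> \<gamma>t s' \<in> ball (\<gamma>t s) r" using r(1) by simp
  moreover have "\<forall>\<^sub>F s' in at s within {0..1}. \<bar>s' - s\<bar> < \<eta>"
    using D(3) by (auto simp: eventually_at dist_real_def intro!: exI[of _ \<eta>])
  ultimately show ?thesis
    by eventually_elim (use r(2) D(4) in metis)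
qed

context leaf_disk
begin

abbreviation "F \<equiv> blowup_field c m f g"
abbreviation "F0 \<equiv> original_time_field c m f g"
abbreviation "w \<equiv> (m - 1) * n1"
abbreviation "P \<equiv> (0 :: complex, e)"

definition \<Theta> :: "complex \<Rightarrow> c2" where "\<Theta> \<theta> = (u \<theta>, z \<theta>)"
definition T :: "complex \<Rightarrow> complex" where "T \<theta> = (of_real \<delta> * \<theta>) ^ w"
definition \<kappa> :: "c2 \<Rightarrow> complex" where "\<kappa> = the_inv_into (ball 0 3) \<Theta>"
definition \<tau> :: "c2 \<Rightarrow> complex" where "\<tau> p = T (\<kappa> p)"
definition L :: "c2 set" where "L = \<Theta> ` (ball 0 2 - {0})"
definition R :: "c2 set" where "R = \<Theta> ` ball 0 2"
text \<open>The neighborhood is a ball without the boundary curve of the leaf. A solution that starts on the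
  leaf can leave it neither through this curve, which is missing, nor through the equilibrium, which
  no solution reaches.\<close>

definition U :: "c2 set" where "U = ball P \<epsilon> - \<Theta> ` sphere 0 2"
text \<open>The disk is a global coordinate, and therefore one chart suffices.\<close>

definition A :: "(c2 set \<times> (c2 \<Rightarrow> complex)) set" where "A = {(R, \<kappa>)}"

abbreviation "D2 \<equiv> ball (0 :: complex) 2 - {0}"
abbreviation "D3 \<equiv> ball (0 :: complex) 3 - {0}"

lemma D23: "D2 \<subseteq> D3" "ball (0::complex) 2 \<subseteq> ball 0 3" "cball (0::complex) 2 \<subseteq> ball 0 3"
  by auto

lemma open_D: "open D2" "open D3"
  by (simp_all add: open_delete)

lemma w_pos: "w > 0"
  using degree(2) n1 by simp

lemma T_0: "T 0 = 0"
  using w_pos by (simp add: T_def zero_power)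

lemma DERIV_T: "DERIV T \<theta> :> of_nat w * of_real \<delta> ^ w * \<theta> ^ (w - 1)"
proof -
  have "DERIV T \<theta> :> of_nat w * (of_real \<delta> * \<theta>) ^ (w - 1) * of_real \<delta>"
    unfolding T_def by (auto intro!: derivative_eq_intros)
  moreover have "of_real \<delta> ^ w = of_real \<delta> * (of_real \<delta> :: complex) ^ (w - 1)"
    using w_pos by (cases w) simp_all
  ultimately show ?thesis by (simp add: power_mult_distrib mult_ac)
qed

lemma deriv_T: "deriv T \<theta> = of_nat w * of_real \<delta> ^ w * \<theta> ^ (w - 1)"
  using DERIV_T by (rule DERIV_imp_deriv)

lemma deriv_T_nz: "\<theta> \<noteq> 0 \<Longrightarrow> deriv T \<theta> \<noteq> 0"
  using w_pos \<delta> by (simp add: deriv_T)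

lemma holomorphic_T: "T holomorphic_on S"
  unfolding T_def by (intro holomorphic_intros)

lemma u_nz: "\<theta> \<in> D3 \<Longrightarrow> u \<theta> \<noteq> 0"
  using u_eq q_nz by simp

lemma \<Theta>_0: "\<Theta> 0 = P"
  using u_eq[of 0] z0 n1 by (simp add: \<Theta>_def zero_power)

lemma DERIV_u: "\<theta> \<in> D3 \<Longrightarrow> DERIV u \<theta> :> deriv T \<theta> * fst (F0 (\<Theta> \<theta>))"
  using deriv_u unfolding deriv_T \<Theta>_def by blast

lemma DERIV_z: "\<theta> \<in> D3 \<Longrightarrow> DERIV z \<theta> :> deriv T \<theta> * snd (F0 (\<Theta> \<theta>))"
  using deriv_z unfolding deriv_T \<Theta>_def by blast

lemma fst_F_nz: "\<theta> \<in> D3 \<Longrightarrow> fst (F (\<Theta> \<theta>)) \<noteq> 0"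
  using u_nz radial_nz by (auto simp: \<Theta>_def blowup_field_def)

lemma deriv_u_eq: "\<theta> \<in> D3 \<Longrightarrow> deriv u \<theta> = deriv T \<theta> * fst (F0 (\<Theta> \<theta>))"
  using DERIV_u by (rule DERIV_imp_deriv)

lemma deriv_u_nz: "\<theta> \<in> D3 \<Longrightarrow> deriv u \<theta> \<noteq> 0"
  using deriv_u_eq[of \<theta>] deriv_T_nz[of \<theta>] fst_F_nz[of \<theta>] u_nz[of \<theta>]
  by (simp add: original_time_field_def \<Theta>_def)

lemma holomorphic_u: "u holomorphic_on D3"
  using hol(1) by (rule holomorphic_on_subset) auto

lemma inj_\<Theta>: "inj_on \<Theta> (ball 0 3)"
  using inj by (simp add: \<Theta>_def[abs_def])

lemma continuous_\<Theta>: "continuous_on (ball 0 3) \<Theta>"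
  unfolding \<Theta>_def using hol(1,2)
  by (intro continuous_on_Pair holomorphic_on_imp_continuous_on)

lemma \<kappa>_\<Theta>: "\<theta> \<in> ball 0 3 \<Longrightarrow> \<kappa> (\<Theta> \<theta>) = \<theta>"
  unfolding \<kappa>_def by (rule the_inv_into_f_f[OF inj_\<Theta>])

lemma \<tau>_\<Theta>: "\<theta> \<in> ball 0 3 \<Longrightarrow> \<tau> (\<Theta> \<theta>) = T \<theta>"
  by (simp add: \<tau>_def \<kappa>_\<Theta>)

lemma continuous_\<kappa>: "continuous_on (\<Theta> ` cball 0 2) \<kappa>"
  using continuous_on_subset[OF continuous_\<Theta> D23(3)] D23(3)
  by (intro continuous_on_inv) (auto simp: \<kappa>_\<Theta>)

lemma continuous_\<kappa>_R: "continuous_on R \<kappa>"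
  unfolding R_def by (rule continuous_on_subset[OF continuous_\<kappa>]) auto

lemma L_subset_R: "L \<subseteq> R" and R_eq: "R = L \<union> {P}"
  unfolding L_def R_def by (auto simp flip: \<Theta>_0)

lemma \<kappa>_L:
  assumes "p \<in> L"
  shows "\<kappa> p \<in> D2" "\<Theta> (\<kappa> p) = p" "\<kappa> p \<in> D3"
proof -
  obtain \<theta> where "\<theta> \<in> D2" "p = \<Theta> \<theta>" using assms unfolding L_def by blast
  then show "\<kappa> p \<in> D2" "\<Theta> (\<kappa> p) = p" "\<kappa> p \<in> D3" using \<kappa>_\<Theta>[of \<theta>] by auto
qed

lemma \<kappa>_R: "p \<in> R \<Longrightarrow> \<kappa> p \<in> ball 0 2" "p \<in> R \<Longrightarrow> \<Theta> (\<kappa> p) = p"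
  using \<kappa>_\<Theta> D23(2) by (auto simp: R_def)

lemma u_\<kappa>: "p \<in> L \<Longrightarrow> u (\<kappa> p) = fst p"
  using \<kappa>_L(2)[of p] by (metis \<Theta>_def fst_conv)

lemma \<kappa>_P: "\<kappa> P = 0"
  using \<kappa>_\<Theta>[of 0] by (simp add: \<Theta>_0)

lemma fst_L: "p \<in> L \<Longrightarrow> fst p \<noteq> 0"
  using u_nz \<kappa>_L(3) u_\<kappa> by metis

lemma isCont_\<kappa>:
  assumes "open D" "\<And>s. s \<in> D \<Longrightarrow> isCont \<phi> s" "\<phi> ` D \<subseteq> L" "t \<in> D"
  shows "isCont (\<lambda>s. \<kappa> (\<phi> s)) t"
proof -
  have "continuous_on D \<phi>" using assms(2) by (intro continuous_at_imp_continuous_on) blast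
  moreover have "\<phi> ` D \<subseteq> R" using assms(3) L_subset_R by blast
  ultimately have "continuous_on D (\<lambda>s. \<kappa> (\<phi> s))"
    using continuous_on_compose2[OF continuous_\<kappa>_R] by blast
  then show ?thesis using assms(1,4) by (simp add: continuous_on_eq_continuous_at)
qed

text \<open>Because \<open>u\<close> is locally biholomorphic off the centre, the coordinate \<open>\<kappa>\<close> of a moving
  point of the leaf inherits its regularity from the first component.\<close>

lemma has_derivative_\<kappa>:
  fixes \<phi> :: "'a :: real_normed_vector \<Rightarrow> c2"
  assumes D: "open D" "\<And>s. s \<in> D \<Longrightarrow> isCont \<phi> s" "\<phi> ` D \<subseteq> L" "t \<in> D"
    and a: "((\<lambda>s. fst (\<phi> s)) has_derivative a) (at t)"
  shows "((\<lambda>s. \<kappa> (\<phi> s)) has_derivative (\<lambda>h. a h / deriv u (\<kappa> (\<phi> t)))) (at t)"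
proof (rule lift_has_derivative[OF holomorphic_u open_D(2) _ deriv_u_nz])
  show "\<kappa> (\<phi> t) \<in> D3" using \<kappa>_L(3) D(3,4) by blast
  show "isCont (\<lambda>s. \<kappa> (\<phi> s)) t" by (rule isCont_\<kappa>[OF D])
  show "((\<lambda>s. u (\<kappa> (\<phi> s))) has_derivative a) (at t)"
    by (rule has_derivative_transform_within_open[OF a D(1,4)])
       (use u_\<kappa> D(3) in \<open>metis image_subset_iff\<close>)
qed

lemma DERIV_\<kappa>:
  assumes "open D" "\<And>s. s \<in> D \<Longrightarrow> isCont \<phi> s" "\<phi> ` D \<subseteq> L" "t \<in> D"
    and "DERIV (\<lambda>s. fst (\<phi> s)) t :> a"
  shows "DERIV (\<lambda>s. \<kappa> (\<phi> s)) t :> a / deriv u (\<kappa> (\<phi> t))"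
proof -
  have "(\<lambda>h. a * h / deriv u (\<kappa> (\<phi> t))) = (*) (a / deriv u (\<kappa> (\<phi> t)))" by (rule ext) simp
  then show ?thesis
    using has_derivative_\<kappa>[OF assms(1-4) assms(5)[unfolded has_field_derivative_def]]
    by (simp only: has_field_derivative_def)
qed

lemma has_vector_derivative_\<kappa>:
  fixes \<phi> :: "real \<Rightarrow> c2"
  assumes "open D" "\<And>s. s \<in> D \<Longrightarrow> isCont \<phi> s" "\<phi> ` D \<subseteq> L" "t \<in> D"
    and "((\<lambda>s. fst (\<phi> s)) has_vector_derivative a) (at t)"
  shows "((\<lambda>s. \<kappa> (\<phi> s)) has_vector_derivative a / deriv u (\<kappa> (\<phi> t))) (at t)"
  using has_derivative_\<kappa>[OF assms(1-4) assms(5)[unfolded has_vector_derivative_def]]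
  by (simp add: has_vector_derivative_def scaleR_conv_of_real)

text \<open>The chain rule for \<open>T \<circ> \<kappa>\<close> along solutions: in rescaled time it advances at the rate \<open>u^(m-1)\<close>, and
  in original time at unit rate.\<close>

lemma rate_F:
  assumes "p \<in> L"
  shows "deriv T (\<kappa> p) * (fst (F p) / deriv u (\<kappa> p)) = fst p ^ (m - 1)"
    and "deriv T (\<kappa> p) * (fst (F0 p) / deriv u (\<kappa> p)) = 1"
    and "fst (F p) / deriv u (\<kappa> p) \<noteq> 0"
proof -
  have k: "\<kappa> p \<in> D3" "\<Theta> (\<kappa> p) = p" using \<kappa>_L assms by blast+
  have nz: "fst (F p) \<noteq> 0" "fst p \<noteq> 0" "deriv T (\<kappa> p) \<noteq> 0" "deriv u (\<kappa> p) \<noteq> 0"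
    using fst_F_nz[OF k(1)] k(2) fst_L[OF assms] deriv_T_nz[of "\<kappa> p"] k(1) deriv_u_nz[OF k(1)] by auto
  have "deriv u (\<kappa> p) = deriv T (\<kappa> p) * (fst (F p) / fst p ^ (m - 1))"
    using deriv_u_eq[OF k(1)] k(2) by (simp add: original_time_field_def)
  then show "deriv T (\<kappa> p) * (fst (F p) / deriv u (\<kappa> p)) = fst p ^ (m - 1)"
    "deriv T (\<kappa> p) * (fst (F0 p) / deriv u (\<kappa> p)) = 1"
    using nz by (simp_all add: original_time_field_def field_simps)
  show "fst (F p) / deriv u (\<kappa> p) \<noteq> 0" using nz by simp
qed

lemma leaf_time: "leaf_time c m f g L \<tau>"
  unfolding leaf_time_def
proof (intro allI impI ballI; elim conjE)
  fix D \<phi> t1 assume D: "open D" and sol: "solves F D \<phi>" and sub: "\<phi> ` D \<subseteq> L" and t1: "t1 \<in> D"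
  have p: "\<phi> t1 \<in> L" using sub t1 by blast
  have "DERIV (\<lambda>s. \<kappa> (\<phi> s)) t1 :> fst (F (\<phi> t1)) / deriv u (\<kappa> (\<phi> t1))"
    by (rule DERIV_\<kappa>[OF D solves_isCont(3)[OF sol] sub t1 solvesD(1)[OF sol t1]])
  moreover have "DERIV T (\<kappa> (\<phi> t1)) :> deriv T (\<kappa> (\<phi> t1))"
    using DERIV_T by (simp add: deriv_T)
  ultimately show "DERIV (\<lambda>s. \<tau> (\<phi> s)) t1 :> fst (\<phi> t1) ^ (m - 1)"
    unfolding \<tau>_def using rate_F(1)[OF p] DERIV_chain2 by metis
qed

lemma \<Theta>_time:
  assumes "\<theta> \<in> D3"
  shows "DERIV (\<lambda>h. fst (\<Theta> h)) \<theta> :> deriv T \<theta> * fst (F0 (\<Theta> \<theta>))"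
    and "DERIV (\<lambda>h. snd (\<Theta> h)) \<theta> :> deriv T \<theta> * snd (F0 (\<Theta> \<theta>))"
  using DERIV_u[OF assms] DERIV_z[OF assms] by (simp_all add: \<Theta>_def)

text \<open>The rate \<open>dt_1 / d\<theta>\<close> of rescaled time along the curve.\<close>

definition \<mu> :: "complex \<Rightarrow> complex" where "\<mu> \<theta> = deriv T \<theta> / u \<theta> ^ (m - 1)"

lemma \<mu>_nz: "\<theta> \<in> D3 \<Longrightarrow> \<mu> \<theta> \<noteq> 0"
  using deriv_T_nz u_nz by (simp add: \<mu>_def)

lemma holomorphic_\<mu>: "\<mu> holomorphic_on D3"
  unfolding \<mu>_def deriv_T using u_nz holomorphic_u by (intro holomorphic_intros) auto

lemma \<Theta>_rescaled_time:
  assumes "\<theta> \<in> D3"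
  shows "DERIV (\<lambda>h. fst (\<Theta> h)) \<theta> :> \<mu> \<theta> * fst (F (\<Theta> \<theta>))"
    and "DERIV (\<lambda>h. snd (\<Theta> h)) \<theta> :> \<mu> \<theta> * snd (F (\<Theta> \<theta>))"
proof -
  have "deriv T \<theta> * fst (F0 (\<Theta> \<theta>)) = \<mu> \<theta> * fst (F (\<Theta> \<theta>))"
       "deriv T \<theta> * snd (F0 (\<Theta> \<theta>)) = \<mu> \<theta> * snd (F (\<Theta> \<theta>))"
    by (simp_all add: \<mu>_def original_time_field_def \<Theta>_def)
  with \<Theta>_time[OF assms]
  show "DERIV (\<lambda>h. fst (\<Theta> h)) \<theta> :> \<mu> \<theta> * fst (F (\<Theta> \<theta>))"
       "DERIV (\<lambda>h. snd (\<Theta> h)) \<theta> :> \<mu> \<theta> * snd (F (\<Theta> \<theta>))" by simp_all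
qed

text \<open>Near each of its points the leaf is itself the image of a solution, namely of \<open>\<Theta>\<close> in the time
  with differential \<open>\<mu> d\<theta>\<close>. Uniqueness then keeps every other solution through this point on the leaf.\<close>

lemma solution_stays_in_leaf:
  assumes D: "open D" "solves F D \<phi>" "t0 \<in> D" "\<phi> t0 \<in> L"
  shows "\<exists>r>0. ball t0 r \<subseteq> D \<and> \<phi> ` ball t0 r \<subseteq> L"
proof -
  define \<theta>0 where "\<theta>0 = \<kappa> (\<phi> t0)"
  have \<theta>0: "\<theta>0 \<in> D2" "\<Theta> \<theta>0 = \<phi> t0" using \<kappa>_L[OF D(4)] by (simp_all add: \<theta>0_def)
  obtain r1 where r1: "r1 > 0" "ball \<theta>0 r1 \<subseteq> D2" using open_D(1) \<theta>0(1) openE by blast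
  have sub: "ball \<theta>0 r1 \<subseteq> D3" using r1(2) D23(1) by blast
  have "\<mu> holomorphic_on ball \<theta>0 r1" by (rule holomorphic_on_subset[OF holomorphic_\<mu> sub])
  then obtain M where M: "M holomorphic_on ball \<theta>0 r1" "\<And>h. h \<in> ball \<theta>0 r1 \<Longrightarrow> deriv M h = \<mu> h" "M \<theta>0 = t0"
    using holomorphic_primitive[OF _ open_ball convex_ball] by blast
  have "\<exists>r>0. \<exists>\<psi>. ball \<theta>0 r \<subseteq> ball \<theta>0 r1 \<and> open (M ` ball \<theta>0 r) \<and> solves F (M ` ball \<theta>0 r) \<psi> \<and>
     (\<forall>h\<in>ball \<theta>0 r. \<psi> (M h) = \<Theta> h)"
  proof (rule local_solution_from_time[OF M(1) open_ball])
    fix h assume h: "h \<in> ball \<theta>0 r1"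
    have "h \<in> D3" using h sub by blast
    then show "deriv M h \<noteq> 0"
      "DERIV (\<lambda>h. fst (\<Theta> h)) h :> deriv M h * fst (F (\<Theta> h))"
      "DERIV (\<lambda>h. snd (\<Theta> h)) h :> deriv M h * snd (F (\<Theta> h))"
      using \<mu>_nz \<Theta>_rescaled_time M(2)[OF h] by simp_all
  qed (use r1 in simp)
  then obtain r \<psi> where r: "r > 0" "ball \<theta>0 r \<subseteq> ball \<theta>0 r1" "open (M ` ball \<theta>0 r)"
    "solves F (M ` ball \<theta>0 r) \<psi>" "\<And>h. h \<in> ball \<theta>0 r \<Longrightarrow> \<psi> (M h) = \<Theta> h" by blast
  define E where "E = D \<inter> M ` ball \<theta>0 r"
  have "t0 \<in> M ` ball \<theta>0 r" using M(3) r(1) by (intro image_eqI[of _ _ \<theta>0]) auto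
  then have E: "open E" "t0 \<in> E" using D r(3) by (auto simp: E_def)
  have "\<phi> t0 = \<psi> t0" using r(1) r(5)[of \<theta>0] M(3) \<theta>0(2) by simp
  then obtain r' where r': "r' > 0" "ball t0 r' \<subseteq> E" "\<And>t. t \<in> ball t0 r' \<Longrightarrow> \<phi> t = \<psi> t"
    using blowup_field_unique[OF _ _ E, of c m f g \<phi> \<psi>] solves_subset[OF D(2), of E] solves_subset[OF r(4), of E]
    unfolding E_def by blast
  have "\<phi> t \<in> L" if t: "t \<in> ball t0 r'" for t
  proof -
    obtain h where h: "h \<in> ball \<theta>0 r" "t = M h" using t r'(2) by (auto simp: E_def)
    then have "\<phi> t = \<Theta> h" using r'(3)[OF t] r(5) by simp
    moreover have "h \<in> D2" using h(1) r(2) r1(2) by blast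
    ultimately show ?thesis by (simp add: L_def)
  qed
  then show ?thesis using r' by (intro exI[of _ r']) (auto simp: E_def)
qed

lemma solution_stays_at_equilibrium:
  assumes D: "open D" "solves F D \<phi>" "t0 \<in> D" "\<phi> t0 = P"
  shows "\<exists>r>0. \<forall>t\<in>ball t0 r. \<phi> t = P"
proof -
  have "solves F D (\<lambda>_. P)" unfolding solves_def by (simp add: equilibrium)
  then show ?thesis using blowup_field_unique[OF D(2) _ D(1,3), of "\<lambda>_. P"] D(4) by auto
qed

text \<open>The same invariance in original time, by passing to rescaled time along the solution.\<close>

lemma original_solution_stays_in_leaf:
  assumes D: "open D" "solves F0 D \<phi>" "t0 \<in> D" "\<phi> t0 \<in> L"
  shows "\<exists>r>0. ball t0 r \<subseteq> D \<and> \<phi> ` ball t0 r \<subseteq> L"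
proof -
  have "\<forall>\<^sub>F t in nhds t0. fst (\<phi> t) \<noteq> 0"
    using tendsto_imp_eventually_ne[OF solves_isCont(1)[OF D(2,3), unfolded isCont_def] fst_L[OF D(4)]]
      fst_L[OF D(4)] by (simp add: eventually_nhds_conv_at)
  then obtain S where S: "open S" "t0 \<in> S" "\<And>t. t \<in> S \<Longrightarrow> fst (\<phi> t) \<noteq> 0" unfolding eventually_nhds by blast
  obtain r1 where r1: "r1 > 0" "ball t0 r1 \<subseteq> D \<inter> S" using S(1,2) D(1,3) openE[of "D \<inter> S" t0] by blast
  have sol: "solves F0 (ball t0 r1) \<phi>" using solves_subset[OF D(2)] r1(2) by blast
  have nz: "fst (\<phi> t) \<noteq> 0" if "t \<in> ball t0 r1" for t using S(3) r1(2) that by blast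
  have "(\<lambda>t. fst (\<phi> t)) holomorphic_on ball t0 r1"
    using solvesD(1)[OF sol] holomorphic_on_open[OF open_ball] by blast
  then have "(\<lambda>t. 1 / fst (\<phi> t) ^ (m - 1)) holomorphic_on ball t0 r1"
    using nz by (intro holomorphic_intros) auto
  then obtain M where M: "M holomorphic_on ball t0 r1" "\<And>t. t \<in> ball t0 r1 \<Longrightarrow> deriv M t = 1 / fst (\<phi> t) ^ (m - 1)"
    and dM: "\<And>t. t \<in> ball t0 r1 \<Longrightarrow> DERIV M t :> 1 / fst (\<phi> t) ^ (m - 1)"
    using holomorphic_primitive[OF _ open_ball convex_ball] by blast
  have "\<exists>r>0. \<exists>\<psi>. ball t0 r \<subseteq> ball t0 r1 \<and> open (M ` ball t0 r) \<and> solves F (M ` ball t0 r) \<psi> \<and>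
     (\<forall>t\<in>ball t0 r. \<psi> (M t) = \<phi> t)"
  proof (rule local_solution_from_time[OF M(1) open_ball])
    fix t assume t: "t \<in> ball t0 r1"
    show "deriv M t \<noteq> 0"
      "DERIV (\<lambda>t. fst (\<phi> t)) t :> deriv M t * fst (F (\<phi> t))"
      "DERIV (\<lambda>t. snd (\<phi> t)) t :> deriv M t * snd (F (\<phi> t))"
      using nz[OF t] solvesD[OF sol t] M(2)[OF t] by (simp_all add: original_time_field_def)
  qed (use r1 in simp)
  then obtain r \<psi> where r: "r > 0" "ball t0 r \<subseteq> ball t0 r1" "open (M ` ball t0 r)"
    "solves F (M ` ball t0 r) \<psi>" "\<And>t. t \<in> ball t0 r \<Longrightarrow> \<psi> (M t) = \<phi> t" by blast
  have t0: "t0 \<in> ball t0 r" "t0 \<in> ball t0 r1" using r(1) r1(1) by simp_all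
  obtain r2 where r2: "r2 > 0" "\<psi> ` ball (M t0) r2 \<subseteq> L"
    using solution_stays_in_leaf[OF r(3,4), of "M t0"] t0(1) r(5)[OF t0(1)] D(4) by auto
  have "\<forall>\<^sub>F t in nhds t0. M t \<in> ball (M t0) r2"
    by (rule eventually_mem_ball[OF DERIV_isCont[OF dM[OF t0(2)]] r2(1)])
  then obtain r3 where r3: "r3 > 0" "\<And>t. dist t t0 < r3 \<Longrightarrow> M t \<in> ball (M t0) r2"
    unfolding eventually_nhds_metric by blast
  have "\<phi> t \<in> L" if "t \<in> ball t0 (min r r3)" for t
  proof -
    have "M t \<in> ball (M t0) r2" using that r3(2)[of t] by (simp add: dist_commute)
    then have "\<psi> (M t) \<in> L" using r2(2) by blast
    then show ?thesis using r(5)[of t] that by simp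
  qed
  moreover have "ball t0 (min r r3) \<subseteq> D" using r(2) r1(2) by (auto simp: subset_iff)
  ultimately show ?thesis using r(1) r3(1) by (intro exI[of _ "min r r3"]) auto
qed

section \<open>The leaf is a local leaf\<close>

lemma L_subset_U: "L \<subseteq> U" and P_in_U: "P \<in> U" and open_U: "open U"
proof -
  have *: "\<Theta> \<theta> \<in> U" if "\<theta> \<in> ball 0 2" for \<theta>
  proof -
    have t: "\<theta> \<in> ball 0 3" using that by auto
    have "\<Theta> \<theta> \<noteq> \<Theta> \<theta>'" if "\<theta>' \<in> sphere 0 2" for \<theta>'
    proof
      assume "\<Theta> \<theta> = \<Theta> \<theta>'"
      then have "\<theta> = \<theta>'" using inj_onD[OF inj_\<Theta> _ t] that by simp
      then show False using that \<open>\<theta> \<in> ball 0 2\<close> by simp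
    qed
    then show ?thesis using near[OF t] unfolding U_def \<Theta>_def by blast
  qed
  show "L \<subseteq> U" using * by (auto simp: L_def)
  show "P \<in> U" using *[of 0] by (simp add: \<Theta>_0)
  have "compact (\<Theta> ` sphere 0 2)"
    by (intro compact_continuous_image compact_sphere continuous_on_subset[OF continuous_\<Theta>]) auto
  then show "open U" unfolding U_def by (intro open_Diff open_ball compact_imp_closed)
qed

text \<open>Being on the leaf is a locally constant property along the path. This is uniqueness of solutions at
  points of the leaf and at the equilibrium; all other points of the closed disk are excluded from
  \<open>U\<close>, and the complement of the closed disk is open.\<close>

lemma orbit_stays_in_leaf:
  assumes cont: "continued_along F \<gamma>t \<gamma>p" and sub: "path_image \<gamma>p \<subseteq> U" and start: "pathstart \<gamma>p \<in> L"
    and s: "s \<in> {0..1}"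
  shows "\<gamma>p s \<in> L"
proof -
  have path: "path \<gamma>p" using cont unfolding continued_along_def by blast
  have "(\<gamma>p 0 \<in> L) = (\<gamma>p s \<in> L)"
  proof (rule connected_local_const[of "{0..1::real}" 0 s "\<lambda>s. \<gamma>p s \<in> L"])
    show "\<forall>a\<in>{0..1}. \<forall>\<^sub>F b in at a within {0..1}. (\<gamma>p a \<in> L) = (\<gamma>p b \<in> L)"
    proof
      fix a :: real assume a: "a \<in> {0..1}"
      have aU: "\<gamma>p a \<in> U" using sub a by (auto simp: path_image_def)
      consider "\<gamma>p a \<in> L" | "\<gamma>p a = P" | "\<gamma>p a \<notin> \<Theta> ` cball 0 2"
      proof -
        have "\<gamma>p a \<notin> \<Theta> ` sphere 0 2" using aU by (simp add: U_def)
        moreover have "cball 0 2 = ball 0 2 \<union> sphere (0::complex) 2" by auto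
        moreover have "\<Theta> ` ball 0 2 = L \<union> {P}" using R_eq by (simp add: R_def)
        ultimately show ?thesis using that by (metis UnE image_Un singletonD)
      qed
      then show "\<forall>\<^sub>F b in at a within {0..1}. (\<gamma>p a \<in> L) = (\<gamma>p b \<in> L)"
      proof cases
        case 1
        have "\<forall>\<^sub>F b in at a within {0..1}. \<gamma>p b \<in> L"
        proof (rule eventually_continued_along[OF cont a])
          fix D \<phi> assume "open D" "solves F D \<phi>" "\<gamma>t a \<in> D" "\<gamma>p a = \<phi> (\<gamma>t a)"
          then show "\<exists>r>0. \<forall>t\<in>ball (\<gamma>t a) r. \<phi> t \<in> L"
            using solution_stays_in_leaf[of D \<phi> "\<gamma>t a"] 1 by (auto simp: image_subset_iff)
        qed
        then show ?thesis by (rule eventually_mono) (simp add: 1)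
      next
        case 2
        have "\<forall>\<^sub>F b in at a within {0..1}. \<gamma>p b = P"
        proof (rule eventually_continued_along[OF cont a])
          fix D \<phi> assume "open D" "solves F D \<phi>" "\<gamma>t a \<in> D" "\<gamma>p a = \<phi> (\<gamma>t a)"
          then show "\<exists>r>0. \<forall>t\<in>ball (\<gamma>t a) r. \<phi> t = P"
            using solution_stays_at_equilibrium[of D \<phi> "\<gamma>t a"] 2 by simp
        qed
        then show ?thesis by (rule eventually_mono) (simp add: 2)
      next
        case 3
        have "compact (\<Theta> ` cball 0 2)"
          by (intro compact_continuous_image compact_cball continuous_on_subset[OF continuous_\<Theta> D23(3)])
        then have "open (- \<Theta> ` cball 0 2)" using compact_imp_closed by blast
        from eventually_path_in_open[OF path a this] 3
        have "\<forall>\<^sub>F b in at a within {0..1}. b \<in> {0..1} \<and> \<gamma>p b \<in> - \<Theta> ` cball 0 2" by blast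
        moreover have "L \<subseteq> \<Theta> ` cball 0 2" by (auto simp: L_def)
        ultimately show ?thesis using 3 by (auto elim!: eventually_mono)
      qed
    qed
  qed (use s in auto)
  then show ?thesis using start by (simp add: pathstart_def)
qed

text \<open>In the logarithmic coordinate the punctured disk becomes a half-plane. This is convex, so that
  rescaled time is a well-defined function there, and segments are admissible paths.\<close>

lemma leaf_reachable:
  assumes "p \<in> L"
  shows "\<exists>\<gamma>t \<gamma>p. continued_along F \<gamma>t \<gamma>p \<and> path_image \<gamma>p \<subseteq> L \<and> pathstart \<gamma>p = \<Theta> 1 \<and> pathfinish \<gamma>p = p"
proof -
  define \<theta> where "\<theta> = \<kappa> p"
  have \<theta>: "\<theta> \<in> D2" "\<Theta> \<theta> = p" using \<kappa>_L[OF assms] by (simp_all add: \<theta>_def)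
  define H where "H = {l::complex. Re l < ln 2}"
  have H: "open H" "convex H" unfolding H_def
    by (simp_all add: open_halfspace_Re_lt convex_halfspace_Re_lt)
  have expH: "exp l \<in> D2" if "l \<in> H" for l
  proof -
    have "exp (Re l) < exp (ln 2)" using that by (simp only: exp_less_cancel_iff H_def mem_Collect_eq)
    then show ?thesis by simp
  qed
  have expH3: "exp l \<in> D3" if "l \<in> H" for l using expH[OF that] D23(1) by blast
  have "(\<lambda>l. exp l * \<mu> (exp l)) holomorphic_on H"
    using holomorphic_on_compose_gen[OF holomorphic_on_exp holomorphic_\<mu>, of H] expH3
    by (intro holomorphic_intros) (auto simp: o_def image_subset_iff)
  then obtain M where M: "M holomorphic_on H" "\<And>l. l \<in> H \<Longrightarrow> deriv M l = exp l * \<mu> (exp l)"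
    using holomorphic_primitive[OF _ H] by blast
  define \<gamma> where "\<gamma> = linepath 0 (Ln \<theta>)"
  have "Ln \<theta> \<in> H"
  proof -
    have "ln (norm \<theta>) < ln 2" using \<theta>(1) by (subst ln_less_cancel_iff) auto
    then show ?thesis using \<theta>(1) by (simp add: H_def)
  qed
  moreover have "0 \<in> H" by (simp add: H_def)
  ultimately have \<gamma>: "path \<gamma>" "path_image \<gamma> \<subseteq> H"
    using H(2) by (simp_all add: \<gamma>_def closed_segment_subset)
  have "continued_along F (M \<circ> \<gamma>) ((\<lambda>l. \<Theta> (exp l)) \<circ> \<gamma>)"
  proof (rule continued_along_from_time[OF M(1) H(1) _ _ _ \<gamma>])
    fix l assume l: "l \<in> H"
    show "deriv M l \<noteq> 0" using M(2)[OF l] \<mu>_nz[OF expH3[OF l]] by simp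
    have "DERIV exp l :> exp l" by (rule DERIV_exp)
    from DERIV_chain2[OF \<Theta>_rescaled_time(1)[OF expH3[OF l]] this] DERIV_chain2[OF \<Theta>_rescaled_time(2)[OF expH3[OF l]] this]
    show "DERIV (\<lambda>l. fst (\<Theta> (exp l))) l :> deriv M l * fst (F (\<Theta> (exp l)))"
      "DERIV (\<lambda>l. snd (\<Theta> (exp l))) l :> deriv M l * snd (F (\<Theta> (exp l)))"
      unfolding M(2)[OF l] by (simp_all add: mult_ac)
  qed
  moreover have "path_image ((\<lambda>l. \<Theta> (exp l)) \<circ> \<gamma>) \<subseteq> L"
    using \<gamma>(2) expH by (auto simp: path_image_compose L_def)
  moreover have "pathstart ((\<lambda>l. \<Theta> (exp l)) \<circ> \<gamma>) = \<Theta> 1" "pathfinish ((\<lambda>l. \<Theta> (exp l)) \<circ> \<gamma>) = p"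
    using \<theta> by (simp_all add: \<gamma>_def pathstart_compose pathfinish_compose)
  ultimately show ?thesis by blast
qed

lemma \<Theta>_1_in_L: "\<Theta> 1 \<in> L"
  by (auto simp: L_def)

lemma local_leaf: "local_leaf F U L"
proof -
  have "L = complex_orbit F U (\<Theta> 1)"
  proof (intro subset_antisym subsetI)
    fix p assume "p \<in> L"
    then show "p \<in> complex_orbit F U (\<Theta> 1)"
      using leaf_reachable[of p] L_subset_U unfolding complex_orbit_def by blast
  next
    fix p assume "p \<in> complex_orbit F U (\<Theta> 1)"
    then obtain \<gamma>t \<gamma>p where "continued_along F \<gamma>t \<gamma>p" "path_image \<gamma>p \<subseteq> U" "pathstart \<gamma>p = \<Theta> 1"
        "pathfinish \<gamma>p = p" unfolding complex_orbit_def by blast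
    then show "p \<in> L" using orbit_stays_in_leaf[of \<gamma>t \<gamma>p 1] \<Theta>_1_in_L by (simp add: pathfinish_def)
  qed
  moreover have "F (\<Theta> 1) \<noteq> 0" using fst_F_nz[of 1] by auto
  ultimately show ?thesis unfolding local_leaf_def using \<Theta>_1_in_L L_subset_U by blast
qed

end

section \<open>Real time in the original coordinates\<close>

lemma has_vector_derivative_reciprocal:
  fixes h :: "real \<Rightarrow> complex"
  assumes "(h has_vector_derivative h') (at t)" "h t \<noteq> 0"
  shows "((\<lambda>s. 1 / h s) has_vector_derivative - h' / (h t)\<^sup>2) (at t)"
proof -
  have "DERIV (\<lambda>x. 1 / x) (h t) :> - 1 / (h t)\<^sup>2"
    using assms(2) by (auto intro!: derivative_eq_intros simp: power2_eq_square)
  from field_vector_diff_chain_at[OF assms(1) this] show ?thesis by (simp add: o_def)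
qed

lemma has_vector_derivative_prod_iff:
  fixes h :: "real \<Rightarrow> c2"
  shows "(h has_vector_derivative h') (at t) \<longleftrightarrow>
    ((\<lambda>s. fst (h s)) has_vector_derivative fst h') (at t) \<and>
    ((\<lambda>s. snd (h s)) has_vector_derivative snd h') (at t)"
proof
  assume "(h has_vector_derivative h') (at t)"
  then show "((\<lambda>s. fst (h s)) has_vector_derivative fst h') (at t) \<and>
    ((\<lambda>s. snd (h s)) has_vector_derivative snd h') (at t)"
    using bounded_linear.has_vector_derivative[OF bounded_linear_fst]
      bounded_linear.has_vector_derivative[OF bounded_linear_snd] by blast
next
  assume "((\<lambda>s. fst (h s)) has_vector_derivative fst h') (at t) \<and>
    ((\<lambda>s. snd (h s)) has_vector_derivative snd h') (at t)"
  then have "((\<lambda>s. (fst (h s), snd (h s))) has_vector_derivative (fst h', snd h')) (at t)"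
    using has_vector_derivative_Pair by blast
  then show "(h has_vector_derivative h') (at t)" by simp
qed

lemma poly_field_to_xy:
  assumes "total_degree f \<le> m" "total_degree g \<le> m" "fst p \<noteq> 0"
  shows "poly_field f g (to_xy c p) =
    (case c of X \<Rightarrow> (radial c m f g (fst p) (snd p) / fst p ^ m, angular c m f g (fst p) (snd p) / fst p ^ m)
     | Y \<Rightarrow> (angular c m f g (fst p) (snd p) / fst p ^ m, radial c m f g (fst p) (snd p) / fst p ^ m))"
  using assms
  by (cases p; cases c) (simp_all add: poly_field_def blowup_x_eq blowup_y_eq)

text \<open>Away from the line at infinity, the original system and the blow-up equation in original time
  are the same system in different coordinates.\<close>

lemma real_solution_iff:
  fixes \<beta> :: "real \<Rightarrow> c2"
  assumes deg: "total_degree f \<le> m" "total_degree g \<le> m" "m \<ge> 1"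
    and S: "open S" "t \<in> S" "\<And>s. s \<in> S \<Longrightarrow> fst (\<beta> s) \<noteq> 0"
  shows "((\<lambda>s. to_xy c (\<beta> s)) has_vector_derivative poly_field f g (to_xy c (\<beta> t))) (at t) \<longleftrightarrow>
    ((\<lambda>s. fst (\<beta> s)) has_vector_derivative fst (original_time_field c m f g (\<beta> t))) (at t) \<and>
    ((\<lambda>s. snd (\<beta> s)) has_vector_derivative snd (original_time_field c m f g (\<beta> t))) (at t)"
    (is "?xy \<longleftrightarrow> ?u \<and> ?z")
proof -
  define u where "u = fst (\<beta> t)"
  define z where "z = snd (\<beta> t)"
  define a where "a = radial c m f g u z / u ^ m"
  define b where "b = angular c m f g u z / u ^ m"
  have u: "u \<noteq> 0" using S(2,3) by (simp add: u_def)
  obtain k where k: "m = Suc k" using deg(3) by (cases m) auto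
  have F: "fst (original_time_field c m f g (\<beta> t)) = - a * u\<^sup>2"
    "snd (original_time_field c m f g (\<beta> t)) = b * u - z * a * u"
    using u by (simp_all add: original_time_field_def blowup_field_def u_def[symmetric] z_def[symmetric]
        case_prod_unfold a_def b_def k field_simps power2_eq_square)
  have "?xy \<longleftrightarrow> ((\<lambda>s. 1 / fst (\<beta> s)) has_vector_derivative a) (at t) \<and>
      ((\<lambda>s. snd (\<beta> s) / fst (\<beta> s)) has_vector_derivative b) (at t)"
  proof (cases c)
    case X
    have "to_xy X p = (1 / fst p, snd p / fst p)" for p by (cases p) simp
    then show ?thesis
      using poly_field_to_xy[OF deg(1,2), of "\<beta> t" c] u X
      by (simp add: has_vector_derivative_prod_iff a_def b_def u_def z_def)
  next
    case Y
    have "to_xy Y p = (snd p / fst p, 1 / fst p)" for p by (cases p) simp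
    then show ?thesis
      using poly_field_to_xy[OF deg(1,2), of "\<beta> t" c] u Y
      by (auto simp add: has_vector_derivative_prod_iff a_def b_def u_def z_def)
  qed
  also have "\<dots> \<longleftrightarrow> ?u \<and> ?z"
  proof (intro iffI; elim conjE)
    assume d: "((\<lambda>s. 1 / fst (\<beta> s)) has_vector_derivative a) (at t)"
      "((\<lambda>s. snd (\<beta> s) / fst (\<beta> s)) has_vector_derivative b) (at t)"
    have "((\<lambda>s. 1 / (1 / fst (\<beta> s))) has_vector_derivative - a / (1 / fst (\<beta> t))\<^sup>2) (at t)"
      by (rule has_vector_derivative_reciprocal[OF d(1)]) (use u in \<open>simp add: u_def\<close>)
    then have du: "((\<lambda>s. fst (\<beta> s)) has_vector_derivative - a * u\<^sup>2) (at t)"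
      by (simp add: u_def[symmetric] power_divide)
    have "((\<lambda>s. (snd (\<beta> s) / fst (\<beta> s)) * fst (\<beta> s)) has_vector_derivative
        (snd (\<beta> t) / fst (\<beta> t)) * (- a * u\<^sup>2) + b * fst (\<beta> t)) (at t)"
      by (rule has_vector_derivative_mult[OF d(2) du])
    then have "((\<lambda>s. snd (\<beta> s)) has_vector_derivative
        (snd (\<beta> t) / fst (\<beta> t)) * (- a * u\<^sup>2) + b * fst (\<beta> t)) (at t)"
      by (rule has_vector_derivative_transform_within_open[OF _ S(1,2)]) (use S(3) in simp)
    moreover have "(snd (\<beta> t) / fst (\<beta> t)) * (- a * u\<^sup>2) + b * fst (\<beta> t) = b * u - z * a * u"
      using u by (simp add: u_def[symmetric] z_def[symmetric] power2_eq_square)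
    ultimately show "?u \<and> ?z" using du F by simp
  next
    assume d: ?u ?z
    have u': "fst (\<beta> t) \<noteq> 0" using u by (simp add: u_def)
    note r = has_vector_derivative_reciprocal[OF d(1) u']
    have "- fst (original_time_field c m f g (\<beta> t)) / (fst (\<beta> t))\<^sup>2 = a"
      using u by (simp add: F u_def[symmetric])
    with r have r': "((\<lambda>s. 1 / fst (\<beta> s)) has_vector_derivative a) (at t)" by simp
    have "((\<lambda>s. snd (\<beta> s) * (1 / fst (\<beta> s))) has_vector_derivative
       snd (\<beta> t) * a + snd (original_time_field c m f g (\<beta> t)) * (1 / fst (\<beta> t))) (at t)"
      by (rule has_vector_derivative_mult[OF d(2) r'])
    moreover have "snd (\<beta> t) * a + snd (original_time_field c m f g (\<beta> t)) * (1 / fst (\<beta> t)) = b"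
      using u by (simp add: F u_def[symmetric] z_def[symmetric] field_simps)
    ultimately show "((\<lambda>s. 1 / fst (\<beta> s)) has_vector_derivative a) (at t) \<and>
      ((\<lambda>s. snd (\<beta> s) / fst (\<beta> s)) has_vector_derivative b) (at t)" using r' by simp
  qed
  finally show ?thesis .
qed

lemma mem_time_interval:
  "t \<in> time_interval d 0 \<delta>' \<longleftrightarrow> 0 < dir_sign d * t \<and> dir_sign d * t < \<delta>'"
  by (cases d) auto

lemma time_interval_topology:
  "open (time_interval d 0 \<delta>')" "convex (time_interval d 0 \<delta>')" "connected (time_interval d 0 \<delta>')"
  by (cases d; simp)+

lemma time_interval_abs: "t \<in> time_interval d 0 \<delta>' \<Longrightarrow> t = dir_sign d * \<bar>t\<bar> \<and> 0 < \<bar>t\<bar> \<and> \<bar>t\<bar> < \<delta>'"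
  by (cases d) auto

lemma time_interval_limit: "\<delta>' > 0 \<Longrightarrow> at 0 within time_interval d 0 \<delta>' \<noteq> bot"
  by (cases d) (auto simp: trivial_limit_within islimpt_greaterThanLessThan1 islimpt_greaterThanLessThan2)

section \<open>Rays of real time\<close>

text \<open>The \<open>2 w\<close>-th roots of unity, numbered so that \<open>ray w k ^ w\<close> is the sign of the direction
  \<open>ray_dir k\<close>.\<close>

definition ray :: "nat \<Rightarrow> nat \<Rightarrow> complex" where
  "ray w k = cis (pi * real (k + 1) / real w)"

lemma ray_eq_exp:
  "ray w k = exp (2 * of_real pi * \<i> * of_nat (k + 1) / of_nat (2 * w))"
proof -
  have "\<i> * of_real (pi * real (k + 1) / real w) = 2 * of_real pi * \<i> * of_nat (k + 1) / of_nat (2 * w)"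
    by (cases "w = 0") (simp_all add: field_simps)
  then show ?thesis by (simp only: ray_def cis_conv_exp)
qed

lemma norm_ray [simp]: "norm (ray w k) = 1" and ray_nz [simp]: "ray w k \<noteq> 0"
  by (simp_all add: ray_def)

lemma ray_power: "w > 0 \<Longrightarrow> ray w k ^ w = of_real (dir_sign (ray_dir k))"
proof -
  assume w: "w > 0"
  have "ray w k ^ w = cis (real (k + 1) * pi)"
  proof -
    have "real w * (pi * real (k + 1) / real w) = real (k + 1) * pi" using w by simp
    then show ?thesis unfolding ray_def using Complex.DeMoivre[of "pi * real (k + 1) / real w" w] by metis
  qed
  also have "\<dots> = cis pi ^ (k + 1)" by (rule Complex.DeMoivre[symmetric])
  finally show ?thesis by (auto simp: ray_dir_def)
qed

lemma ray_inject:
  assumes "w > 0" "k < 2 * w" "l < 2 * w" "ray w k = ray w l"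
  shows "k = l"
proof -
  have "(k + 1) mod (2 * w) = (l + 1) mod (2 * w)"
    using assms(1,4) complex_root_unity_eq[of "2 * w" "k + 1" "l + 1"]
    by (simp only: ray_eq_exp)
  then show ?thesis using assms(2,3) by (simp add: mod_Suc split: if_splits)
qed

lemma dir_sign_inject: "dir_sign d = dir_sign d' \<Longrightarrow> d = d'"
  by (cases d; cases d') auto

lemma dir_sign_square [simp]: "dir_sign d * dir_sign d = 1" "\<bar>dir_sign d\<bar> = 1"
  by (cases d; simp)+

lemma ray_exists:
  assumes w: "w > 0" and y: "y ^ w = of_real (dir_sign d)"
  shows "\<exists>k<2*w. ray_dir k = d \<and> y = ray w k"
proof -
  have "y ^ (2 * w) = 1" using y by (simp add: power_mult power2_eq_square mult.commute[of 2] flip: of_real_mult)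
  then obtain j where j: "j < 2 * w" "y = exp (2 * of_real pi * \<i> * of_nat j / of_nat (2 * w))"
    using complex_roots_unity[of "2 * w"] w by fastforce
  define k where "k = (if j = 0 then 2 * w - 1 else j - 1)"
  have k: "k < 2 * w" "(k + 1) mod (2 * w) = j mod (2 * w)" using j(1) w by (auto simp: k_def)
  have "ray w k = y"
    unfolding ray_eq_exp j(2) using k(2) w by (subst complex_root_unity_eq) auto
  moreover from this have "dir_sign (ray_dir k) = dir_sign d" using ray_power[OF w, of k] y by simp
  ultimately show ?thesis using k(1) dir_sign_inject by blast
qed

context leaf_disk
begin

definition \<xi> :: "nat \<Rightarrow> complex \<Rightarrow> complex" where "\<xi> k \<theta> = \<theta> * (ray w k / of_real \<delta>)"

lemma norm_\<xi>: "norm (\<xi> k \<theta>) = norm \<theta> / \<delta>"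
  using \<delta> by (simp add: \<xi>_def norm_mult norm_divide)

lemma \<xi>_0_iff: "\<xi> k \<theta> = 0 \<longleftrightarrow> \<theta> = 0"
  using \<delta> by (simp add: \<xi>_def)

lemma \<xi>_mem: "0 \<le> s \<Longrightarrow> s < 2 * \<delta> \<Longrightarrow> \<xi> k (of_real s) \<in> ball 0 2"
  "0 < s \<Longrightarrow> s < 2 * \<delta> \<Longrightarrow> \<xi> k (of_real s) \<in> D2"
  "0 < s \<Longrightarrow> s < 2 * \<delta> \<Longrightarrow> \<xi> k (of_real s) \<in> D3"
  using \<delta> by (auto simp: norm_\<xi> \<xi>_0_iff pos_divide_less_eq)

lemma root_radius: "root w ((2 * \<delta>) ^ w) = 2 * \<delta>"
  by (rule real_root_power_cancel) (use w_pos \<delta> in auto)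

lemma T_\<xi>: "T (\<xi> k (of_real s)) = of_real (dir_sign (ray_dir k) * s ^ w)"
proof -
  have "T (\<xi> k (of_real s)) = (of_real s * ray w k) ^ w" using \<delta> by (simp add: T_def \<xi>_def)
  then show ?thesis using ray_power[OF w_pos] by (simp add: power_mult_distrib)
qed

text \<open>Real time \<open>(\<delta> \<theta>)^w = \<plusminus> x\<close> determines the modulus of \<open>\<theta>\<close>, and its argument up to a root of unity.\<close>

lemma T_real_imp_ray:
  assumes "T \<theta> = of_real (dir_sign d * x)" "x > 0"
  shows "\<exists>k<2*w. ray_dir k = d \<and> \<theta> = \<xi> k (of_real (root w x))"
proof -
  define s where "s = root w x"
  have s: "s > 0" "s ^ w = x" using assms(2) w_pos by (simp_all add: s_def)
  define y where "y = of_real \<delta> * \<theta> / of_real s"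
  have "y ^ w = T \<theta> / of_real x" by (simp add: y_def T_def power_divide flip: s(2))
  also have "\<dots> = of_real (dir_sign d)" using assms by simp
  finally obtain k where k: "k < 2 * w" "ray_dir k = d" "y = ray w k" using ray_exists[OF w_pos] by blast
  have "\<theta> = \<xi> k (of_real s)" 
    unfolding \<xi>_def k(3)[symmetric] y_def using s(1) \<delta> by simp
  then show ?thesis using k unfolding s_def by blast
qed

lemma \<xi>_inject:
  assumes "0 < s" "0 < s'" "k < 2 * w" "l < 2 * w" "\<xi> k (of_real s) = \<xi> l (of_real s')"
  shows "k = l"
proof -
  have "norm (\<xi> k (of_real s)) = norm (\<xi> l (of_real s'))" using assms(5) by simp
  then have "s = s'" using assms(1,2) \<delta> by (simp add: norm_\<xi>)
  then have "ray w k = ray w l" using assms(1,5) \<delta> by (simp add: \<xi>_def)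
  then show ?thesis using ray_inject[OF w_pos assms(3,4)] by blast
qed

lemma degrees: "total_degree f \<le> m" "total_degree g \<le> m" "m \<ge> 1"
  using degree by auto

text \<open>On the ray the time function is inverted by \<open>root w\<close>. Differentiating this inverse shows that the
  ray, run in real time, solves the original equation.\<close>

lemma real_branch_ray:
  "real_branch c f g L P 0 (ray_dir k) ((2 * \<delta>) ^ w) (\<lambda>t. \<Theta> (\<xi> k (of_real (root w \<bar>t\<bar>))))"
proof -
  define d where "d = ray_dir k"
  define I where "I = time_interval d 0 ((2 * \<delta>) ^ w)"
  define \<psi> where "\<psi> t = \<xi> k (of_real (root w \<bar>t\<bar>))" for t
  have I: "open I" unfolding I_def by (rule time_interval_topology)
  have root: "0 < root w \<bar>t\<bar>" "root w \<bar>t\<bar> < 2 * \<delta>" if "t \<in> I" for t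
  proof -
    have t: "0 < \<bar>t\<bar>" "\<bar>t\<bar> < (2 * \<delta>) ^ w" using time_interval_abs that unfolding I_def by blast+
    then show "0 < root w \<bar>t\<bar>" using w_pos by simp
    have "root w \<bar>t\<bar> < root w ((2 * \<delta>) ^ w)" using t(2) w_pos by (simp only: real_root_less_iff)
    then show "root w \<bar>t\<bar> < 2 * \<delta>" by (simp only: root_radius)
  qed
  have \<psi>_mem: "\<psi> t \<in> D2" "\<psi> t \<in> D3" if "t \<in> I" for t
    using \<xi>_mem(2,3) root[OF that] unfolding \<psi>_def by blast+
  have T\<psi>: "T (\<psi> t) = of_real t" if "t \<in> I" for t
  proof -
    have "T (\<psi> t) = of_real (dir_sign d * (root w \<bar>t\<bar>) ^ w)" by (simp add: \<psi>_def T_\<xi> d_def)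
    also have "(root w \<bar>t\<bar>) ^ w = \<bar>t\<bar>" using w_pos by simp
    also have "dir_sign d * \<bar>t\<bar> = t" using time_interval_abs that unfolding I_def by metis
    finally show ?thesis .
  qed
  have cont: "isCont \<psi> t" for t
    unfolding \<psi>_def \<xi>_def by (intro continuous_intros isCont_o2[OF _ isCont_real_root])
  have inL: "\<Theta> (\<psi> t) \<in> L" if "t \<in> I" for t using \<psi>_mem(1)[OF that] by (simp add: L_def)
  have fst_nz: "fst (\<Theta> (\<psi> t)) \<noteq> 0" if "t \<in> I" for t using fst_L[OF inL[OF that]] .
  have sol: "((\<lambda>s. to_xy c (\<Theta> (\<psi> s))) has_vector_derivative poly_field f g (to_xy c (\<Theta> (\<psi> t)))) (at t)"
    if t: "t \<in> I" for t
  proof -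
    have "((\<lambda>s. of_real s) has_vector_derivative (1::complex)) (at t)"
      using has_vector_derivative_of_real[OF DERIV_ident, of "at t"] by simp
    then have "((\<lambda>s. T (\<psi> s)) has_vector_derivative 1) (at t)"
      by (rule has_vector_derivative_transform_within_open[OF _ I t]) (simp add: T\<psi>)
    then have "((\<lambda>s. T (\<psi> s)) has_derivative (\<lambda>h. h *\<^sub>R 1)) (at t)" by (simp only: has_vector_derivative_def)
    then have "(\<psi> has_derivative (\<lambda>h. h *\<^sub>R 1 / deriv T (\<psi> t))) (at t)"
      by (intro lift_has_derivative[OF holomorphic_T open_D(2) \<psi>_mem(2)[OF t] _ cont])
         (use deriv_T_nz in auto)
    then have d\<psi>: "(\<psi> has_vector_derivative 1 / deriv T (\<psi> t)) (at t)" 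
      by (simp add: has_vector_derivative_def scaleR_conv_of_real)
    have nz: "deriv T (\<psi> t) \<noteq> 0" using deriv_T_nz \<psi>_mem(2)[OF t] by simp
    have "((\<lambda>s. fst (\<Theta> (\<psi> s))) has_vector_derivative fst (F0 (\<Theta> (\<psi> t)))) (at t)"
      using field_vector_diff_chain_at[OF d\<psi> \<Theta>_time(1)[OF \<psi>_mem(2)[OF t]]] nz by (simp add: o_def)
    moreover have "((\<lambda>s. snd (\<Theta> (\<psi> s))) has_vector_derivative snd (F0 (\<Theta> (\<psi> t)))) (at t)"
      using field_vector_diff_chain_at[OF d\<psi> \<Theta>_time(2)[OF \<psi>_mem(2)[OF t]]] nz by (simp add: o_def)
    ultimately show ?thesis
      using real_solution_iff[OF degrees I t, of "\<lambda>s. \<Theta> (\<psi> s)" c] fst_nz by blast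
  qed
  have "isCont (\<lambda>t. \<Theta> (\<psi> t)) 0"
  proof (rule isCont_o2[OF cont])
    have "isCont \<Theta> 0" using continuous_\<Theta> by (simp add: continuous_on_eq_continuous_at)
    then show "isCont \<Theta> (\<psi> 0)" by (simp add: \<psi>_def \<xi>_def)
  qed
  then have "((\<lambda>t. \<Theta> (\<psi> t)) \<longlongrightarrow> \<Theta> (\<psi> 0)) (at 0)" by (simp add: isCont_def)
  moreover have "\<Theta> (\<psi> 0) = P" by (simp add: \<psi>_def \<xi>_def \<Theta>_0)
  ultimately have "((\<lambda>t. \<Theta> (\<psi> t)) \<longlongrightarrow> P) (at 0 within I)"
    using tendsto_within_subset[of _ _ 0 UNIV I] by simp
  then show ?thesis
    unfolding real_branch_def \<psi>_def[symmetric] d_def[symmetric] I_def[symmetric]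
    using fst_nz inL sol \<delta> by simp
qed

text \<open>The time function of the leaf and real time have the same derivative along the branch, and their
  difference vanishes in the limit at the equilibrium.\<close>

lemma real_branch_time:
  assumes rb: "real_branch c f g L P 0 d \<delta>' \<beta>"
  shows "\<And>t. t \<in> time_interval d 0 \<delta>' \<Longrightarrow> T (\<kappa> (\<beta> t)) = of_real t"
    and "\<And>t. t \<in> time_interval d 0 \<delta>' \<Longrightarrow> isCont \<beta> t"
    and "\<And>t. t \<in> time_interval d 0 \<delta>' \<Longrightarrow> \<beta> t \<in> L"
proof -
  define I where "I = time_interval d 0 \<delta>'"
  have I: "open I" "convex I" unfolding I_def by (rule time_interval_topology)+
  have \<delta>': "\<delta>' > 0" and L: "\<And>t. t \<in> I \<Longrightarrow> \<beta> t \<in> L" and nz: "\<And>t. t \<in> I \<Longrightarrow> fst (\<beta> t) \<noteq> 0"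
    and lim: "(\<beta> \<longlongrightarrow> P) (at 0 within I)"
    and sol: "\<And>t. t \<in> I \<Longrightarrow> ((\<lambda>s. to_xy c (\<beta> s)) has_vector_derivative poly_field f g (to_xy c (\<beta> t))) (at t)"
    using rb unfolding real_branch_def I_def by auto
  have d: "((\<lambda>s. fst (\<beta> s)) has_vector_derivative fst (F0 (\<beta> t))) (at t)"
    "((\<lambda>s. snd (\<beta> s)) has_vector_derivative snd (F0 (\<beta> t))) (at t)" if "t \<in> I" for t
    using real_solution_iff[OF degrees I(1) that, of \<beta> c] nz sol[OF that] by blast+
  have cont: "isCont \<beta> t" if "t \<in> I" for t
    using isCont_Pair[OF has_vector_derivative_continuous[OF d(1)[OF that]] has_vector_derivative_continuous[OF d(2)[OF that]]]
    by simp
  show "isCont \<beta> t" "\<beta> t \<in> L" if "t \<in> time_interval d 0 \<delta>'" for t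
    using cont L that unfolding I_def by blast+
  have dT: "((\<lambda>s. T (\<kappa> (\<beta> s)) - of_real s) has_vector_derivative 0) (at t)" if t: "t \<in> I" for t
  proof -
    have img: "\<beta> ` I \<subseteq> L" using L by blast
    have d\<kappa>: "((\<lambda>s. \<kappa> (\<beta> s)) has_vector_derivative fst (F0 (\<beta> t)) / deriv u (\<kappa> (\<beta> t))) (at t)"
      by (rule has_vector_derivative_\<kappa>[OF I(1) cont img t d(1)[OF t]])
    have "DERIV T (\<kappa> (\<beta> t)) :> deriv T (\<kappa> (\<beta> t))"
      using DERIV_T by (simp add: deriv_T)
    from field_vector_diff_chain_at[OF d\<kappa> this] have "((\<lambda>s. T (\<kappa> (\<beta> s))) has_vector_derivative
        fst (F0 (\<beta> t)) / deriv u (\<kappa> (\<beta> t)) * deriv T (\<kappa> (\<beta> t))) (at t)"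
      by (simp only: o_def)
    moreover have "fst (F0 (\<beta> t)) / deriv u (\<kappa> (\<beta> t)) * deriv T (\<kappa> (\<beta> t)) = 1"
      using rate_F(2)[OF L[OF t]] by (simp add: mult.commute)
    moreover have "((\<lambda>s. of_real s) has_vector_derivative (1::complex)) (at t)"
      using has_vector_derivative_of_real[OF DERIV_ident, of "at t"] by simp
    ultimately show ?thesis using has_vector_derivative_diff by fastforce
  qed
  have "\<exists>C. \<forall>t\<in>I. T (\<kappa> (\<beta> t)) - of_real t = C"
  proof (rule has_derivative_zero_constant[OF I(2)])
    fix t assume "t \<in> I"
    then show "((\<lambda>s. T (\<kappa> (\<beta> s)) - of_real s) has_derivative (\<lambda>h. 0)) (at t within I)"
      using dT has_derivative_at_withinI by (fastforce simp: has_vector_derivative_def)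
  qed
  then obtain C where C: "\<And>t. t \<in> I \<Longrightarrow> T (\<kappa> (\<beta> t)) - of_real t = C" by blast
  have evI: "\<forall>\<^sub>F t in at 0 within I. t \<in> I" by (simp add: eventually_at_filter)
  have "((\<lambda>t. \<kappa> (\<beta> t)) \<longlongrightarrow> \<kappa> P) (at 0 within I)"
  proof (rule continuous_on_tendsto_compose[OF continuous_\<kappa>_R lim])
    show "P \<in> R" using R_eq by blast
    show "\<forall>\<^sub>F t in at 0 within I. \<beta> t \<in> R" using evI by eventually_elim (use L L_subset_R in blast)
  qed
  moreover have "isCont T (\<kappa> P)" using DERIV_T DERIV_isCont by blast
  ultimately have "((\<lambda>t. T (\<kappa> (\<beta> t))) \<longlongrightarrow> T (\<kappa> P)) (at 0 within I)" by (rule isCont_tendsto_compose[rotated])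
  then have lim0: "((\<lambda>t. T (\<kappa> (\<beta> t)) - of_real t) \<longlongrightarrow> 0 - of_real 0) (at 0 within I)"
    by (intro tendsto_intros) (simp add: \<kappa>_P T_0)
  have "((\<lambda>t. C) \<longlongrightarrow> 0) (at 0 within I)"
  proof (rule Lim_transform_eventually)
    show "((\<lambda>t. T (\<kappa> (\<beta> t)) - of_real t) \<longlongrightarrow> 0) (at 0 within I)" using lim0 by simp
    show "\<forall>\<^sub>F t in at 0 within I. T (\<kappa> (\<beta> t)) - of_real t = C"
      using evI by eventually_elim (rule C)
  qed
  then have "C = 0"
    using time_interval_limit[OF \<delta>'] tendsto_unique[OF _ tendsto_const] unfolding I_def by metis
  then show "T (\<kappa> (\<beta> t)) = of_real t" if "t \<in> time_interval d 0 \<delta>'" for t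
    using C[of t] that unfolding I_def by simp
qed

text \<open>By the previous lemma the branch lies on the rays at each time. The ray cannot change with time,
  since the unit complex number that singles it out varies continuously in a finite set.\<close>

lemma real_branch_is_ray:
  assumes rb: "real_branch c f g L P 0 d \<delta>' \<beta>"
  shows "\<exists>!k. k < 2 * w \<and> ray_dir k = d \<and> \<delta>' \<le> (2 * \<delta>) ^ w \<and>
    (\<forall>t\<in>time_interval d 0 \<delta>'. \<beta> t = \<Theta> (\<xi> k (of_real (root w \<bar>t\<bar>))))"
proof -
  define I where "I = time_interval d 0 \<delta>'"
  have \<delta>': "\<delta>' > 0" using rb unfolding real_branch_def by blast
  have time: "T (\<kappa> (\<beta> t)) = of_real t" "isCont \<beta> t" "\<beta> t \<in> L" if "t \<in> I" for t
    using real_branch_time[OF rb] that unfolding I_def by blast+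
  have abs_t: "t = dir_sign d * \<bar>t\<bar>" "0 < \<bar>t\<bar>" "\<bar>t\<bar> < \<delta>'" if "t \<in> I" for t
    using time_interval_abs that unfolding I_def by blast+
  have some_ray: "\<exists>k<2*w. ray_dir k = d \<and> \<kappa> (\<beta> t) = \<xi> k (of_real (root w \<bar>t\<bar>))" if "t \<in> I" for t
    using T_real_imp_ray[of "\<kappa> (\<beta> t)" d "\<bar>t\<bar>"] time(1)[OF that] abs_t[OF that] by metis
  define t1 where "t1 = dir_sign d * (\<delta>' / 2)"
  have t1: "t1 \<in> I" using \<delta>' unfolding I_def t1_def mem_time_interval by (cases d) auto
  obtain k where k: "k < 2 * w" "ray_dir k = d" "\<kappa> (\<beta> t1) = \<xi> k (of_real (root w \<bar>t1\<bar>))"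
    using some_ray[OF t1] by blast
  \<comment> \<open>The direction in which the point lies at time \<open>t\<close>, as a root of unity.\<close>
  define \<omega> where "\<omega> t = \<kappa> (\<beta> t) * of_real \<delta> / of_real (root w \<bar>t\<bar>)" for t
  have root_pos: "root w \<bar>t\<bar> > 0" if "t \<in> I" for t using abs_t(2)[OF that] w_pos by simp
  have \<omega>_ray: "\<omega> t = ray w l" if "t \<in> I" "\<kappa> (\<beta> t) = \<xi> l (of_real (root w \<bar>t\<bar>))" for t l
    using root_pos[OF that(1)] \<delta> that(2) by (simp add: \<omega>_def \<xi>_def)
  have "\<omega> constant_on I"
  proof (rule continuous_finite_range_constant)
    show "connected I" unfolding I_def by (rule time_interval_topology)
    have "\<beta> ` I \<subseteq> L" using time(3) by blast
    then have "isCont (\<lambda>t. \<kappa> (\<beta> t)) t" if "t \<in> I" for t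
      using isCont_\<kappa>[of I \<beta> t] time(2) that time_interval_topology(1) unfolding I_def by blast
    moreover have "isCont (\<lambda>t. complex_of_real (root w \<bar>t\<bar>)) t" for t
      by (intro continuous_intros isCont_o2[OF _ isCont_real_root])
    ultimately show "continuous_on I \<omega>"
      unfolding \<omega>_def using root_pos
      by (intro continuous_at_imp_continuous_on ballI continuous_divide continuous_mult continuous_const) force+
    have "\<omega> ` I \<subseteq> ray w ` {..<2*w}" using some_ray \<omega>_ray by (force simp: image_subset_iff)
    then show "finite (\<omega> ` I)" by (rule finite_subset) simp
  qed
  then have "\<omega> t = ray w k" if "t \<in> I" for t
    using \<omega>_ray[OF t1 k(3)] t1 that unfolding constant_on_def by metis
  then have \<kappa>_ray: "\<kappa> (\<beta> t) = \<xi> k (of_real (root w \<bar>t\<bar>))" if "t \<in> I" for t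
    using that root_pos[OF that] \<delta> unfolding \<omega>_def \<xi>_def by (fastforce simp: field_simps)
  have \<beta>_ray: "\<beta> t = \<Theta> (\<xi> k (of_real (root w \<bar>t\<bar>)))" if "t \<in> I" for t
    using \<kappa>_ray[OF that] \<kappa>_L(2)[OF time(3)[OF that]] by simp
  have bound: "root w \<bar>t\<bar> < 2 * \<delta>" if "t \<in> I" for t
  proof -
    have "norm (\<xi> k (of_real (root w \<bar>t\<bar>))) < 2" using \<kappa>_L(1)[OF time(3)[OF that]] \<kappa>_ray[OF that] by simp
    then show ?thesis using root_pos[OF that] \<delta> by (simp add: norm_\<xi> field_simps)
  qed
  have "\<delta>' \<le> (2 * \<delta>) ^ w"
  proof (rule ccontr)
    assume "\<not> \<delta>' \<le> (2 * \<delta>) ^ w"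
    then have "dir_sign d * (2 * \<delta>) ^ w \<in> I"
      unfolding I_def mem_time_interval using \<delta> by (cases d) auto
    from bound[OF this] have "root w ((2 * \<delta>) ^ w) < 2 * \<delta>" using \<delta> by (simp only: abs_mult dir_sign_square) simp
    then show False by (simp only: root_radius)
  qed
  then show ?thesis
  proof (intro ex1I[of _ k] conjI k(1,2))
    show "\<forall>t\<in>time_interval d 0 \<delta>'. \<beta> t = \<Theta> (\<xi> k (of_real (root w \<bar>t\<bar>)))"
      using \<beta>_ray unfolding I_def by blast
    fix l assume l: "l < 2 * w \<and> ray_dir l = d \<and> \<delta>' \<le> (2 * \<delta>) ^ w \<and>
      (\<forall>t\<in>time_interval d 0 \<delta>'. \<beta> t = \<Theta> (\<xi> l (of_real (root w \<bar>t\<bar>))))"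
    then have "\<Theta> (\<xi> l (of_real (root w \<bar>t1\<bar>))) = \<Theta> (\<xi> k (of_real (root w \<bar>t1\<bar>)))"
      using \<beta>_ray[OF t1] t1 unfolding I_def by simp
    then have "\<xi> l (of_real (root w \<bar>t1\<bar>)) = \<xi> k (of_real (root w \<bar>t1\<bar>))"
      using inj_onD[OF inj_\<Theta>] \<xi>_mem(3)[OF root_pos[OF t1] bound[OF t1]] by blast
    then show "l = k" using \<xi>_inject[OF root_pos[OF t1] root_pos[OF t1]] l k(1) by blast
  qed
qed

text \<open>All radii of the star coincide, because in this coordinate the real times in the disk are straight
  segments from the centre to the boundary.\<close>

lemma real_time_star: "real_time_star c f g L P 0 \<tau> \<Theta> 2 w \<xi> (\<lambda>_. 2 * \<delta>)"
  unfolding real_time_star_def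
proof (intro conjI allI impI ballI)
  show "2 * \<delta> > 0" using \<delta> by simp
  fix k :: nat
  show "\<xi> k analytic_on of_real ` {0..<2 * \<delta>}"
    unfolding \<xi>_def by (intro analytic_intros)
  show "\<xi> k 0 = 0" by (simp add: \<xi>_def)
  show "real_branch c f g L P 0 (ray_dir k) ((2 * \<delta>) ^ w) (\<lambda>t. \<Theta> (\<xi> k (of_real (root w \<bar>t - 0\<bar>))))"
    using real_branch_ray by simp
  fix s assume s: "s \<in> {0..<2 * \<delta>}"
  then show "\<xi> k (of_real s) \<in> ball 0 2" by (intro \<xi>_mem(1)) auto
  then have "\<xi> k (of_real s) \<in> ball 0 3" by auto
  then show "\<tau> (\<Theta> (\<xi> k (of_real s))) = of_real (0 + dir_sign (ray_dir k) * s ^ w)"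
    by (simp only: \<tau>_\<Theta> T_\<xi> add_0)
next
  show "\<exists>a. a \<noteq> 0 \<and> (\<forall>k<2 * w. deriv (\<xi> k) 0 = a * cis (pi * real k / real w))"
  proof (intro exI[of _ "cis (pi / real w) / of_real \<delta>"] conjI allI impI)
    show "cis (pi / real w) / of_real \<delta> \<noteq> 0" using \<delta> by simp
    fix k
    have "DERIV (\<xi> k) 0 :> ray w k / of_real \<delta>"
      unfolding \<xi>_def using \<delta> by (auto intro!: derivative_eq_intros)
    moreover have "ray w k = cis (pi / real w) * cis (pi * real k / real w)"
      by (simp add: ray_def cis_mult algebra_simps add_divide_distrib)
    ultimately show "deriv (\<xi> k) 0 = cis (pi / real w) / of_real \<delta> * cis (pi * real k / real w)"
      by (simp add: DERIV_imp_deriv)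
  qed
next
  fix k l assume kl: "k < 2 * w" "l < 2 * w" "k \<noteq> l"
  show "\<xi> k ` of_real ` {0<..<2 * \<delta>} \<inter> \<xi> l ` of_real ` {0<..<2 * \<delta>} = {}"
    using \<xi>_inject[OF _ _ kl(1,2)] kl(3) by fastforce
next
  fix d
  show "{\<theta> \<in> ball 0 2. \<tau> (\<Theta> \<theta>) \<in> \<real> \<and> 0 \<le> dir_sign d * (Re (\<tau> (\<Theta> \<theta>)) - 0)} =
    (\<Union>k\<in>{k. k < 2 * w \<and> ray_dir k = d}. \<xi> k ` of_real ` {0..<2 * \<delta>})"
  proof (intro subset_antisym subsetI)
    fix \<theta> assume "\<theta> \<in> {\<theta> \<in> ball 0 2. \<tau> (\<Theta> \<theta>) \<in> \<real> \<and> 0 \<le> dir_sign d * (Re (\<tau> (\<Theta> \<theta>)) - 0)}"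
    then have mem: "\<theta> \<in> ball 0 2" and re: "\<tau> (\<Theta> \<theta>) \<in> \<real>" "0 \<le> dir_sign d * (Re (\<tau> (\<Theta> \<theta>)) - 0)"
      by blast+
    have "\<tau> (\<Theta> \<theta>) = T \<theta>" using mem by (intro \<tau>_\<Theta>) simp
    with mem re have \<theta>: "\<theta> \<in> ball 0 2" "T \<theta> \<in> \<real>" "0 \<le> dir_sign d * Re (T \<theta>)" by simp_all
    show "\<theta> \<in> (\<Union>k\<in>{k. k < 2 * w \<and> ray_dir k = d}. \<xi> k ` of_real ` {0..<2 * \<delta>})"
    proof (cases "\<theta> = 0")
      case True
      define k where "k = (if d = Blow_up then 0 else 1 :: nat)"
      have "k \<le> 1" by (simp add: k_def)
      then have "k < 2 * w" using w_pos by linarith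
      moreover have "ray_dir k = d" by (cases d) (simp_all add: k_def ray_dir_def)
      moreover have "\<theta> = \<xi> k (of_real 0)" using True by (simp add: \<xi>_def)
      moreover have "0 \<in> {0..<2 * \<delta>}" using \<delta> by simp
      ultimately show ?thesis by blast
    next
      case False
      define x where "x = dir_sign d * Re (T \<theta>)"
      have Tx: "T \<theta> = of_real (dir_sign d * x)"
        using \<theta>(2) by (simp add: x_def mult.assoc[symmetric] del: of_real_mult)
      have "T \<theta> \<noteq> 0" using False \<delta> by (simp add: T_def)
      then have "x \<noteq> 0" using Tx by auto
      then have "x > 0" using \<theta>(3) unfolding x_def by linarith
      then obtain k where k: "k < 2 * w" "ray_dir k = d" "\<theta> = \<xi> k (of_real (root w x))"
        using T_real_imp_ray[OF Tx] by blast
      have "root w x > 0" using \<open>x > 0\<close> w_pos by simp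
      moreover have "root w x < 2 * \<delta>" 
        using \<theta>(1) \<open>root w x > 0\<close> \<delta> unfolding k(3) by (simp add: norm_\<xi> field_simps)
      ultimately have "root w x \<in> {0..<2 * \<delta>}" by simp
      then show ?thesis using k by blast
    qed
  next
    fix \<theta> assume "\<theta> \<in> (\<Union>k\<in>{k. k < 2 * w \<and> ray_dir k = d}. \<xi> k ` of_real ` {0..<2 * \<delta>})"
    then obtain k s where k: "ray_dir k = d" "0 \<le> s" "s < 2 * \<delta>" "\<theta> = \<xi> k (of_real s)" by auto
    have mem: "\<theta> \<in> ball 0 2" using \<xi>_mem(1) k by blast
    have "\<tau> (\<Theta> \<theta>) = T \<theta>" using mem by (intro \<tau>_\<Theta>) simp
    then have "\<tau> (\<Theta> \<theta>) = of_real (dir_sign d * s ^ w)" using T_\<xi>[of k s] k by metis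
    moreover have "dir_sign d * (dir_sign d * s ^ w) \<ge> 0" using k(2) by (simp flip: mult.assoc)
    ultimately show "\<theta> \<in> {\<theta> \<in> ball 0 2. \<tau> (\<Theta> \<theta>) \<in> \<real> \<and> 0 \<le> dir_sign d * (Re (\<tau> (\<Theta> \<theta>)) - 0)}"
      using mem by (simp del: of_real_mult)
  qed
next
  fix d \<delta>' \<beta> assume "real_branch c f g L P 0 d \<delta>' \<beta>"
  from real_branch_is_ray[OF this]
  show "\<exists>!k. k < 2 * w \<and> ray_dir k = d \<and> \<delta>' \<le> (2 * \<delta>) ^ w \<and>
    (\<forall>t\<in>time_interval d 0 \<delta>'. \<beta> t = \<Theta> (\<xi> k (of_real (root w \<bar>t - 0\<bar>))))" by simp
qed

end

section \<open>Winding numbers and minimality\<close>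

lemma winding_number_exp_path:
  assumes "path q" "\<And>s. s \<in> {0..1} \<Longrightarrow> \<gamma> s = exp (q s)"
  shows "winding_number \<gamma> 0 = (pathfinish q - pathstart q) / (2 * of_real pi * \<i>)"
proof -
  have "winding_number \<gamma> 0 = winding_number (exp \<circ> q) 0"
    by (rule winding_number_cong) (use assms(2) in simp)
  then show ?thesis using winding_number_compose_exp[OF assms(1)] by simp
qed

text \<open>A closed path is \<open>exp\<close> of a path; scaling and taking powers are affine operations there.\<close>

lemma winding_number_scaled_power:
  assumes \<psi>: "path \<psi>" "0 \<notin> path_image \<psi>" and a: "a \<noteq> 0"
    and \<gamma>: "\<And>s. s \<in> {0..1} \<Longrightarrow> \<gamma> s = (a * \<psi> s) ^ n"
  shows "winding_number \<gamma> 0 = of_nat n * winding_number \<psi> 0"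
proof -
  obtain q where q: "path q" "pathfinish q - pathstart q = 2 * of_real pi * \<i> * winding_number \<psi> 0"
      "\<And>t. t \<in> {0..1} \<Longrightarrow> \<psi> t = 0 + exp (q t)"
    by (rule winding_number_as_continuous_log[OF \<psi>]) (rule that)
  define q' where "q' s = of_nat n * (Ln a + q s)" for s
  have "path q'" using q(1) unfolding q'_def path_def by (intro continuous_intros)
  moreover have "\<gamma> s = exp (q' s)" if "s \<in> {0..1}" for s
    using \<gamma>[OF that] q(3)[OF that] a by (simp add: q'_def exp_of_nat_mult exp_add)
  ultimately have "winding_number \<gamma> 0 = (pathfinish q' - pathstart q') / (2 * of_real pi * \<i>)"
    by (rule winding_number_exp_path)
  also have "pathfinish q' - pathstart q' = of_nat n * (pathfinish q - pathstart q)"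
    by (simp add: q'_def pathfinish_def pathstart_def algebra_simps)
  finally have "winding_number \<gamma> 0 = of_nat n * (2 * of_real pi * \<i> * winding_number \<psi> 0) / (2 * of_real pi * \<i>)"
    unfolding q(2) .
  moreover have "of_nat n * (a * b) / a = of_nat n * b" if "a \<noteq> 0" for a b :: complex using that by simp
  moreover have "2 * of_real pi * \<i> \<noteq> (0 :: complex)" by simp
  ultimately show ?thesis by metis
qed

context leaf_disk
begin

lemma continued_along_lift:
  assumes "path l" "path_image l \<subseteq> D2"
  shows "continued_along F0 (T \<circ> l) (\<Theta> \<circ> l)" "path_image (\<Theta> \<circ> l) \<subseteq> L"
proof -
  show "continued_along F0 (T \<circ> l) (\<Theta> \<circ> l)"
    by (rule continued_along_from_time[OF holomorphic_T open_D(2) _ \<Theta>_time assms(1)])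
       (use deriv_T_nz assms(2) D23(1) in blast)+
  show "path_image (\<Theta> \<circ> l) \<subseteq> L" using assms(2) by (auto simp: path_image_compose L_def)
qed

text \<open>The time function of the leaf and the time of the path have the same derivative along each local
  solution, so that their difference is locally constant on the path.\<close>

lemma leaf_time_along:
  assumes cont: "continued_along F0 \<gamma>t \<gamma>p" and sub: "path_image \<gamma>p \<subseteq> L"
  shows "\<exists>C. \<forall>s\<in>{0..1}. T (\<kappa> (\<gamma>p s)) = \<gamma>t s + C"
proof -
  define h where "h s = T (\<kappa> (\<gamma>p s)) - \<gamma>t s" for s
  have "h 0 = h s" if s: "s \<in> {0..1}" for s
  proof (rule connected_local_const[of "{0..1::real}" 0 s h])
    show "\<forall>a\<in>{0..1}. \<forall>\<^sub>F b in at a within {0..1}. h a = h b"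
    proof
      fix a :: real assume a: "a \<in> {0..1}"
      have aL: "\<gamma>p a \<in> L" using sub a by (auto simp: path_image_def)
      have "\<forall>\<^sub>F b in at a within {0..1}. T (\<kappa> (\<gamma>p b)) - \<gamma>t b = h a"
      proof (rule eventually_continued_along[OF cont a])
        fix D \<phi> assume D: "open D" "solves F0 D \<phi>" "\<gamma>t a \<in> D" "\<gamma>p a = \<phi> (\<gamma>t a)"
        obtain r where r: "r > 0" "ball (\<gamma>t a) r \<subseteq> D" "\<phi> ` ball (\<gamma>t a) r \<subseteq> L"
          using original_solution_stays_in_leaf[OF D(1-3)] D(4) aL by auto
        have sol: "solves F0 (ball (\<gamma>t a) r) \<phi>" by (rule solves_subset[OF D(2) r(2)])
        have d0: "((\<lambda>t. T (\<kappa> (\<phi> t)) - t) has_field_derivative 0) (at t within ball (\<gamma>t a) r)"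
          if t: "t \<in> ball (\<gamma>t a) r" for t
        proof -
          have p: "\<phi> t \<in> L" using r(3) t by blast
          have "DERIV (\<lambda>s. \<kappa> (\<phi> s)) t :> fst (F0 (\<phi> t)) / deriv u (\<kappa> (\<phi> t))"
            by (rule DERIV_\<kappa>[OF open_ball solves_isCont(3)[OF sol] r(3) t solvesD(1)[OF sol t]])
          moreover have "DERIV T (\<kappa> (\<phi> t)) :> deriv T (\<kappa> (\<phi> t))"
            using DERIV_T by (simp add: deriv_T)
          ultimately have "DERIV (\<lambda>s. T (\<kappa> (\<phi> s))) t :> 1"
            using rate_F(2)[OF p] DERIV_chain2 by metis
          from DERIV_diff[OF this DERIV_ident] show ?thesis
            by (simp add: has_field_derivative_at_within)
        qed
        have "\<exists>C. \<forall>t\<in>ball (\<gamma>t a) r. T (\<kappa> (\<phi> t)) - t = C"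
          by (rule has_field_derivative_zero_constant[OF convex_ball d0])
        then obtain C where C: "\<And>t. t \<in> ball (\<gamma>t a) r \<Longrightarrow> T (\<kappa> (\<phi> t)) - t = C" by blast
        have "C = h a" using C[of "\<gamma>t a"] r(1) D(4) by (simp add: h_def)
        then show "\<exists>r>0. \<forall>t\<in>ball (\<gamma>t a) r. T (\<kappa> (\<phi> t)) - t = h a" using C r(1) by blast
      qed
      then show "\<forall>\<^sub>F b in at a within {0..1}. h a = h b"
        by (rule eventually_mono) (simp add: h_def)
    qed
  qed (use s in auto)
  then have "T (\<kappa> (\<gamma>p s)) = \<gamma>t s + h 0" if "s \<in> {0..1}" for s
    using that by (metis h_def add.commute diff_add_cancel)
  then show ?thesis by blast
qed

text \<open>A loop in the leaf has the time \<open>(\<delta> \<psi>) ^ w\<close>, where \<open>\<psi>\<close> is a closed path in the punctured disk;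
  its winding number is therefore a multiple of \<open>w\<close>.\<close>

lemma loop_winding_number:
  assumes loop: "blowup_loop c m f g L P 0 d \<gamma>t \<gamma>p"
  shows "real w \<le> Re (winding_number \<gamma>t 0)"
proof -
  have cont: "continued_along F0 \<gamma>t \<gamma>p" and sub: "path_image \<gamma>p \<subseteq> L"
    and closed: "pathfinish \<gamma>p = pathstart \<gamma>p" and pos: "Re (winding_number \<gamma>t 0) > 0"
    using loop unfolding blowup_loop_def by simp_all
  obtain \<delta>' \<beta> t0 \<sigma>t \<sigma>p where rb: "real_branch c f g L P 0 d \<delta>' \<beta>" "t0 \<in> time_interval d 0 \<delta>'"
    and \<sigma>: "continued_along F0 \<sigma>t \<sigma>p" "path_image \<sigma>p \<subseteq> L" "pathstart \<sigma>t = of_real t0" "pathstart \<sigma>p = \<beta> t0"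
      "pathfinish \<sigma>t = pathstart \<gamma>t" "pathfinish \<sigma>p = pathstart \<gamma>p"
    using loop unfolding blowup_loop_def by blast
  obtain C where C: "\<And>s. s \<in> {0..1} \<Longrightarrow> T (\<kappa> (\<gamma>p s)) = \<gamma>t s + C"
    using leaf_time_along[OF cont sub] by blast
  obtain C' where C': "\<And>s. s \<in> {0..1} \<Longrightarrow> T (\<kappa> (\<sigma>p s)) = \<sigma>t s + C'"
    using leaf_time_along[OF \<sigma>(1,2)] by blast
  have "C' = 0" using C'[of 0] \<sigma>(3,4) real_branch_time(1)[OF rb] by (simp add: pathstart_def)
  moreover have "C = C'" using C[of 0] C'[of 1] \<sigma>(5,6) by (simp add: pathstart_def pathfinish_def)
  ultimately have time: "T (\<kappa> (\<gamma>p s)) = \<gamma>t s" if "s \<in> {0..1}" for s using C[OF that] by simp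
  define \<psi> where "\<psi> = \<kappa> \<circ> \<gamma>p"
  have "path \<gamma>p" using cont unfolding continued_along_def by blast
  then have path: "path \<psi>" unfolding \<psi>_def
    by (rule path_continuous_image) (rule continuous_on_subset[OF continuous_\<kappa>_R], use sub L_subset_R in blast)
  have nz: "0 \<notin> path_image \<psi>"
    using \<kappa>_L(1) sub unfolding \<psi>_def path_image_compose by fastforce
  have "winding_number \<psi> 0 \<in> \<int>"
    using closed by (intro integer_winding_number path nz) (simp add: \<psi>_def pathfinish_compose pathstart_compose)
  then obtain i where i: "winding_number \<psi> 0 = of_int i" by (rule Ints_cases)
  have wn: "winding_number \<gamma>t 0 = of_nat w * winding_number \<psi> 0"
    by (rule winding_number_scaled_power[OF path nz, of "of_real \<delta>"])
       (use \<delta> time in \<open>auto simp: T_def \<psi>_def\<close>)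
  have re: "Re (of_nat k * of_int i) = real k * of_int i" for k by simp
  have "real w * of_int i > 0" using pos unfolding wn i re .
  moreover have "real w > 0" using w_pos by (simp only: of_nat_0_less_iff)
  ultimately have "real_of_int i > 0" using zero_less_mult_pos by blast
  then have "real w * 1 \<le> real w * of_int i" by (intro mult_left_mono) auto
  then show ?thesis unfolding wn i re by (simp only: mult_1_right)
qed

definition circle :: "real \<Rightarrow> complex" where "circle s = cis (2 * pi * s)"

lemma path_circle: "path circle" "path_image circle \<subseteq> D2" "0 \<notin> path_image circle"
proof -
  show "path circle" unfolding circle_def path_def by (intro continuous_intros)
  have "circle s \<in> D2" "circle s \<noteq> 0" for s by (simp_all add: circle_def)
  then show "path_image circle \<subseteq> D2" "0 \<notin> path_image circle" unfolding path_image_def by auto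
qed

lemma circle_eq_exp: "circle s = exp (2 * of_real pi * \<i> * of_real s)"
  by (simp add: circle_def cis_conv_exp algebra_simps)

lemma circle_closed: "circle 1 = circle 0"
  by (simp add: circle_def)

lemma path_linear: "path (\<lambda>s. a * complex_of_real s)"
  unfolding path_def by (intro continuous_intros)

lemma winding_number_circle: "winding_number circle 0 = 1"
  by (subst winding_number_exp_path[OF path_linear circle_eq_exp])
     (simp add: pathfinish_def pathstart_def)

lemma winding_number_T_circle: "winding_number (T \<circ> circle) 0 = of_nat w"
  using winding_number_scaled_power[OF path_circle(1,3), of "of_real \<delta>" "T \<circ> circle" w] \<delta>
  by (simp add: T_def winding_number_circle)

text \<open>The unit of \<open>u = \<theta> ^ n1 q\<close> has a logarithm and does not contribute to the winding.\<close>

lemma winding_number_u_circle: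
  "0 \<notin> path_image (u \<circ> circle)" "winding_number (u \<circ> circle) 0 = of_nat n1"
proof -
  have mem: "circle s \<in> ball 0 3" "circle s \<in> D3" for s by (simp_all add: circle_def)
  show "0 \<notin> path_image (u \<circ> circle)" using u_nz[OF mem(2)] unfolding path_image_def by force
  obtain Q where Q: "Q holomorphic_on ball 0 3" "\<And>\<theta>. \<theta> \<in> ball 0 3 \<Longrightarrow> q \<theta> = exp (Q \<theta>)"
    using contractible_imp_holomorphic_log[OF hol(3) convex_imp_contractible[OF convex_ball] q_nz] by blast
  define p where "p s = 2 * of_real pi * \<i> * of_nat n1 * of_real s + Q (circle s)" for s
  have "path (Q \<circ> circle)"
    by (rule path_continuous_image[OF path_circle(1)], rule continuous_on_subset[OF holomorphic_on_imp_continuous_on[OF Q(1)]])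
       (use mem(1) in \<open>auto simp: path_image_def\<close>)
  then have "path p" unfolding p_def path_def o_def by (intro continuous_intros)
  moreover have "(u \<circ> circle) s = exp (p s)" for s
  proof -
    have "circle s ^ n1 = exp (of_nat n1 * (2 * of_real pi * \<i> * of_real s))"
      unfolding exp_of_nat_mult circle_eq_exp ..
    then show ?thesis using u_eq[OF mem(1)] Q(2)[OF mem(1)] by (simp add: p_def exp_add mult_ac)
  qed
  ultimately have "winding_number (u \<circ> circle) 0 = (pathfinish p - pathstart p) / (2 * of_real pi * \<i>)"
    by (intro winding_number_exp_path)
  then show "winding_number (u \<circ> circle) 0 = of_nat n1"
    using circle_closed by (simp add: p_def pathfinish_def pathstart_def)
qed

text \<open>The unit circle attains the lower bound \<open>w\<close> for the winding number. An arc of the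
  same circle connects it to a real branch, as the definition of a loop demands.\<close>

lemma minimal_loop: "minimal_blowup_loop c m f g L P 0 d (T \<circ> circle) (\<Theta> \<circ> circle)"
proof -
  define k where "k = (if d = Blow_up then 0 else 1 :: nat)"
  have dir: "ray_dir k = d" by (cases d) (simp_all add: k_def ray_dir_def)
  define \<beta> where "\<beta> t = \<Theta> (\<xi> k (of_real (root w \<bar>t\<bar>)))" for t
  have rb: "real_branch c f g L P 0 d ((2 * \<delta>) ^ w) \<beta>"
    using real_branch_ray[of k] unfolding dir \<beta>_def .
  \<comment> \<open>The arc of the unit circle from the ray \<open>k\<close> to \<open>1\<close> connects the branch to the loop.\<close>
  define l where "l s = cis (pi * real (k + 1) / real w * (1 - s))" for s
  have l: "path l" "path_image l \<subseteq> D2"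
  proof -
    show "path l" unfolding l_def path_def by (intro continuous_intros)
    show "path_image l \<subseteq> D2" unfolding path_image_def by (rule image_subsetI) (simp add: l_def)
  qed
  define t0 where "t0 = dir_sign d * \<delta> ^ w"
  have "\<delta> ^ w < (2 * \<delta>) ^ w" using \<delta> w_pos by (intro power_strict_mono) auto
  then have t0: "t0 \<in> time_interval d 0 ((2 * \<delta>) ^ w)"
    using \<delta> by (simp only: mem_time_interval t0_def mult.assoc[symmetric] dir_sign_square) simp
  have root_t0: "root w \<bar>t0\<bar> = \<delta>"
  proof -
    have "\<bar>t0\<bar> = \<delta> ^ w" using \<delta> by (simp only: t0_def abs_mult dir_sign_square) simp
    then show ?thesis using real_root_power_cancel[OF w_pos, of \<delta>] \<delta> by simp
  qed
  have start: "l 0 = \<xi> k (of_real \<delta>)" using \<delta> by (simp add: l_def \<xi>_def ray_def)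
  have "pathstart (T \<circ> l) = of_real t0"
    using T_\<xi>[of k \<delta>] by (simp only: pathstart_def o_def start dir t0_def)
  moreover have "pathstart (\<Theta> \<circ> l) = \<beta> t0"
    by (simp only: pathstart_def o_def start \<beta>_def root_t0)
  moreover have "pathfinish (T \<circ> l) = pathstart (T \<circ> circle)" "pathfinish (\<Theta> \<circ> l) = pathstart (\<Theta> \<circ> circle)"
    by (simp_all add: pathstart_def pathfinish_def l_def circle_def)
  moreover have "of_real 0 \<notin> path_image (T \<circ> circle)"
    using \<delta> by (auto simp: path_image_def T_def circle_def)
  moreover have "pathfinish (T \<circ> circle) = pathstart (T \<circ> circle)" "pathfinish (\<Theta> \<circ> circle) = pathstart (\<Theta> \<circ> circle)"
    using circle_closed by (simp_all add: pathstart_def pathfinish_def)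
  moreover have "Re (winding_number (T \<circ> circle) (of_real 0)) > 0"
    using w_pos by (simp only: of_real_0 winding_number_T_circle) simp
  ultimately have "blowup_loop c m f g L P 0 d (T \<circ> circle) (\<Theta> \<circ> circle)"
    unfolding blowup_loop_def
    using continued_along_lift[OF path_circle(1,2)] continued_along_lift[OF l] rb t0 by blast
  then show ?thesis
    unfolding minimal_blowup_loop_def using loop_winding_number winding_number_T_circle by simp
qed

section \<open>The Riemann surface of the leaf\<close>

lemma \<kappa>_image_R: "\<kappa> ` R = ball 0 2" and inj_\<kappa>: "inj_on \<kappa> R"
proof -
  show "\<kappa> ` R = ball 0 2" using \<kappa>_\<Theta> D23(2) unfolding R_def by (force simp: image_image)
  show "inj_on \<kappa> R" using \<kappa>_R(2) by (metis inj_onI)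
qed

lemma inv_into_\<kappa>: "\<theta> \<in> ball 0 2 \<Longrightarrow> inv_into R \<kappa> \<theta> = \<Theta> \<theta>"
  using inv_into_f_f[OF inj_\<kappa>, of "\<Theta> \<theta>"] \<kappa>_\<Theta>[of \<theta>] by (simp add: R_def)

lemma riemann_surface: "riemann_surface (top_of_set R) A"
proof -
  have cont: "continuous_on (ball 0 2) \<Theta>" by (rule continuous_on_subset[OF continuous_\<Theta> D23(2)])
  have "homeomorphic_maps (top_of_set R) (top_of_set (ball 0 2)) \<kappa> \<Theta>"
    unfolding homeomorphic_maps_def
    using continuous_\<kappa>_R cont \<kappa>_R \<kappa>_\<Theta> by (auto simp: R_def)
  then have hom: "homeomorphic_map (top_of_set R) (top_of_set (ball 0 2)) \<kappa>"
    unfolding homeomorphic_map_maps by blast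
  have "(\<lambda>\<theta>. \<theta>) holomorphic_on \<kappa> ` (R \<inter> R)" by (intro holomorphic_intros)
  then have "(\<kappa> \<circ> inv_into R \<kappa>) holomorphic_on \<kappa> ` (R \<inter> R)"
    by (rule holomorphic_transform) (simp add: f_inv_into_f)
  then have "complex_atlas (top_of_set R) A"
    unfolding complex_atlas_def A_def using hom \<kappa>_image_R by (simp add: subtopology_subtopology)
  moreover have "connected R" unfolding R_def using cont by (intro connected_continuous_image) auto
  moreover have "R \<noteq> {}" using R_eq by blast
  ultimately show ?thesis
    unfolding riemann_surface_def
    by (simp add: connected_space_subtopology Hausdorff_space_subtopology)
qed

lemma extends_leaf: "extends_leaf F L A"
  unfolding extends_leaf_def
proof (intro allI impI; elim conjE)
  fix D \<phi> assume D: "open D" and sol: "solves F D \<phi>" and sub: "\<phi> ` D \<subseteq> L"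
  have dom: "D \<inter> \<phi> -` R = D" using sub L_subset_R by blast
  have d: "DERIV (\<kappa> \<circ> \<phi>) t :> fst (F (\<phi> t)) / deriv u (\<kappa> (\<phi> t))" if "t \<in> D" for t
    using DERIV_\<kappa>[OF D solves_isCont(3)[OF sol] sub that solvesD(1)[OF sol that]] by (simp add: o_def)
  then have "(\<kappa> \<circ> \<phi>) holomorphic_on D" using holomorphic_on_open[OF D] by blast
  moreover have "deriv (\<kappa> \<circ> \<phi>) t \<noteq> 0" if "t \<in> D" for t
    using DERIV_imp_deriv[OF d[OF that]] rate_F(3)[of "\<phi> t"] sub that by auto
  ultimately show "regular_into A D \<phi>" using D dom by (simp add: regular_into_def A_def)
qed

lemma regular_\<Theta>: "regular_into A (ball 0 2) \<Theta>"
proof -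
  have dom: "ball 0 2 \<inter> \<Theta> -` R = ball 0 2" by (auto simp: R_def)
  have d: "DERIV (\<kappa> \<circ> \<Theta>) \<theta> :> 1" if "\<theta> \<in> ball 0 2" for \<theta>
    by (rule has_field_derivative_transform_within_open[OF DERIV_ident open_ball that])
       (use \<kappa>_\<Theta> D23(2) in auto)
  then have "(\<kappa> \<circ> \<Theta>) holomorphic_on ball 0 2" using holomorphic_on_open[OF open_ball] by blast
  moreover have "deriv (\<kappa> \<circ> \<Theta>) \<theta> \<noteq> 0" if "\<theta> \<in> ball 0 2" for \<theta>
    using DERIV_imp_deriv[OF d[OF that]] by simp
  ultimately show ?thesis by (simp add: regular_into_def A_def dom)
qed

lemma \<tau>_chart: "\<theta> \<in> ball 0 2 \<Longrightarrow> \<tau> (inv_into R \<kappa> \<theta>) = T \<theta>"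
  using inv_into_\<kappa> \<tau>_\<Theta> D23(2) by auto

lemma ramification_\<tau>:
  assumes "p \<in> R" and g: "\<And>\<theta>. T \<theta> - T (\<kappa> p) = G \<theta> * (\<theta> - \<kappa> p) ^ k" "G holomorphic_on ball 0 2" "G (\<kappa> p) \<noteq> 0"
  shows "ramification A \<tau> p k"
proof -
  have \<kappa>: "\<kappa> p \<in> ball 0 2" by (rule \<kappa>_R(1)[OF assms(1)])
  have "T holomorphic_on ball 0 2" by (rule holomorphic_T)
  then have "(\<lambda>\<theta>. \<tau> (inv_into R \<kappa> \<theta>)) holomorphic_on ball 0 2"
    by (rule holomorphic_transform) (simp add: \<tau>_chart)
  then have an: "(\<lambda>\<theta>. \<tau> (inv_into R \<kappa> \<theta>)) analytic_on {\<kappa> p}"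
    using \<kappa> analytic_at open_ball by blast
  have "zorder (\<lambda>\<theta>. \<tau> (inv_into R \<kappa> \<theta>) - \<tau> p) (\<kappa> p) = int k"
  proof (rule zorder_eqI[OF open_ball \<kappa> g(2,3)])
    fix \<theta> :: complex assume "\<theta> \<in> ball 0 2"
    then show "\<tau> (inv_into R \<kappa> \<theta>) - \<tau> p = G \<theta> * (\<theta> - \<kappa> p) powi int k"
      using g(1)[of \<theta>] by (simp only: \<tau>_chart) (simp add: \<tau>_def)
  qed
  with an show ?thesis by (simp add: ramification_def A_def)
qed

lemma ramification_P: "ramification A \<tau> P w"
proof (rule ramification_\<tau>)
  show "T \<theta> - T (\<kappa> P) = of_real \<delta> ^ w * (\<theta> - \<kappa> P) ^ w" for \<theta>
    by (simp only: \<kappa>_P T_0) (simp add: T_def power_mult_distrib)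
qed (use R_eq \<delta> in auto)

lemma ramification_L:
  assumes "p \<in> L"
  shows "ramification A \<tau> p 1"
proof (rule ramification_\<tau>)
  define G where "G \<theta> = of_real \<delta> ^ w * (\<Sum>i<w. \<kappa> p ^ (w - Suc i) * \<theta> ^ i)" for \<theta>
  show "T \<theta> - T (\<kappa> p) = G \<theta> * (\<theta> - \<kappa> p) ^ 1" for \<theta>
    unfolding T_def G_def power_mult_distrib right_diff_distrib[symmetric] power_diff_sumr2[of \<theta>] by simp
  show "G holomorphic_on ball 0 2" unfolding G_def by (intro holomorphic_intros)
  have "(\<Sum>i<w. \<kappa> p ^ (w - Suc i) * \<kappa> p ^ i) = (\<Sum>i<w. \<kappa> p ^ (w - 1))"
    by (intro sum.cong refl) (simp flip: power_add)
  then show "G (\<kappa> p) \<noteq> 0"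
    unfolding G_def using \<delta> w_pos \<kappa>_L(1)[OF assms] by simp
qed (use assms L_subset_R in auto)

section \<open>Power series expansions\<close>

text \<open>The power series of the cofactor, shifted by \<open>k\<close>.\<close>

lemma expansion_power_times:
  assumes h: "\<And>\<theta>. \<theta> \<in> ball 0 r \<Longrightarrow> h \<theta> = \<theta> ^ k * p \<theta>" and p: "p holomorphic_on ball 0 r"
  shows "expansion h r (p 0) k"
proof -
  define b where "b j = (if j < k then 0 else (deriv ^^ (j - k)) p 0 / fact (j - k))" for j
  have "(\<lambda>j. b j * \<theta> ^ j) sums h \<theta>" if \<theta>: "\<theta> \<in> ball 0 r" for \<theta>
  proof -
    have "(\<lambda>j. (deriv ^^ j) p 0 / fact j * (\<theta> - 0) ^ j) sums p \<theta>"
      by (rule holomorphic_power_series[OF p \<theta>])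
    from sums_mult[OF this, of "\<theta> ^ k"]
    have "(\<lambda>j. b (j + k) * \<theta> ^ (j + k)) sums h \<theta>"
      by (simp add: b_def h[OF \<theta>] power_add mult_ac)
    then show ?thesis by (subst (asm) sums_zero_iff_shift) (simp_all add: b_def)
  qed
  then show ?thesis unfolding expansion_def by (intro exI[of _ b]) (simp add: b_def)
qed

lemma expansion_\<tau>: "expansion (\<lambda>\<theta>. \<tau> (\<Theta> \<theta>)) 2 (of_real \<delta> ^ w) w"
proof (rule expansion_power_times[where p = "\<lambda>_. of_real \<delta> ^ w"])
  fix \<theta> :: complex assume "\<theta> \<in> ball 0 2"
  then have "\<tau> (\<Theta> \<theta>) = T \<theta>" by (intro \<tau>_\<Theta>) simp
  then show "\<tau> (\<Theta> \<theta>) = \<theta> ^ w * of_real \<delta> ^ w" by (simp add: T_def power_mult_distrib)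
qed (intro holomorphic_intros)

lemma expansion_u: "expansion (\<lambda>\<theta>. fst (\<Theta> \<theta>)) 2 (q 0) n1"
  by (rule expansion_power_times)
     (use u_eq D23(2) holomorphic_on_subset[OF hol(3)] in \<open>auto simp: \<Theta>_def\<close>)

end

section \<open>Blow-up loops at the node\<close>

theorem theorem8p5:
  fixes f g :: "complex poly poly" and m n1 n2 :: nat and e :: complex
    and c :: chart and d :: direction
  assumes m: "m = max (total_degree f) (total_degree g)" "m \<ge> 2"
    and equilibrium: "blowup_field c m f g (0, e) = (0, 0)"
    and n: "n1 > 0" "n2 > 0" "coprime n1 n2"
    and eigenvalue1: "- radial c m f g 0 e = of_real (dir_sign d) * of_nat n1"
    and eigenvalue2: "deriv (\<lambda>z. - z * radial c m f g 0 z + angular c m f g 0 z) e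
                        = of_real (dir_sign d) * of_nat n2"
    and nonresonant: "real n1 / real n2 \<in> (\<rat> - \<int>) \<union> {1}" "real n2 / real n1 \<in> (\<rat> - \<int>) \<union> {1}"
    and semisimple: "real n1 / real n2 = 1 \<Longrightarrow>
      semisimple_eigenvalue (frechet_derivative (blowup_field c m f g) (at (0, e)))
        (of_real (dir_sign d))"
  shows "\<forall>\<epsilon>>0. \<exists>U L R A \<tau> r \<Theta> a_t a_u \<gamma>t \<gamma>p \<xi> \<rho>.
    \<comment> \<open>a minimal loop in a local leaf, close to the equilibrium and to the blow-up time 0\<close>
    open U \<and> (0, e) \<in> U \<and> U \<subseteq> ball (0, e) \<epsilon> \<and>
    local_leaf (blowup_field c m f g) U L \<and> L \<subseteq> {p. fst p \<noteq> 0} \<and>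
    minimal_blowup_loop c m f g L (0, e) 0 d \<gamma>t \<gamma>p \<and> path_image \<gamma>t \<subseteq> ball 0 \<epsilon> \<and>
    \<comment> \<open>(i)\<close>
    R = L \<union> {(0, e)} \<and>
    riemann_surface (top_of_set R) A \<and> extends_leaf (blowup_field c m f g) L A \<and>
    leaf_time c m f g L \<tau> \<and> \<tau> (0, e) = 0 \<and>
    ramification A \<tau> (0, e) ((m - 1) * n1) \<and> (\<forall>p\<in>L. ramification A \<tau> p 1) \<and>
    \<comment> \<open>(ii)\<close>
    r > 1 \<and> bij_betw \<Theta> (ball 0 r) R \<and> \<Theta> 0 = (0, e) \<and> regular_into A (ball 0 r) \<Theta> \<and>
    (\<lambda>\<theta>. fst (\<Theta> \<theta>)) holomorphic_on ball 0 r \<and> (\<lambda>\<theta>. snd (\<Theta> \<theta>)) holomorphic_on ball 0 r \<and>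
    a_t \<noteq> 0 \<and> expansion (\<lambda>\<theta>. \<tau> (\<Theta> \<theta>)) r a_t ((m - 1) * n1) \<and>
    a_u \<noteq> 0 \<and> expansion (\<lambda>\<theta>. fst (\<Theta> \<theta>)) r a_u n1 \<and>
    (\<forall>s\<in>{0..1}. \<gamma>p s = \<Theta> (cis (2 * pi * s)) \<and> \<gamma>t s = \<tau> (\<gamma>p s)) \<and>
    \<comment> \<open>(iii)\<close>
    winding_number \<gamma>t 0 = of_nat ((m - 1) * n1) \<and> (m - 1) * n1 > 0 \<and>
    0 \<notin> path_image (fst \<circ> \<gamma>p) \<and> winding_number (fst \<circ> \<gamma>p) 0 = of_nat n1 \<and> n1 > 0 \<and>
    \<comment> \<open>(iv)\<close>
    real_time_star c f g L (0, e) 0 \<tau> \<Theta> r ((m - 1) * n1) \<xi> \<rho>"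
proof (intro allI impI, goal_cases)
  case \<epsilon>: (1 \<epsilon>)
  have s: "(of_real (dir_sign d) :: complex) \<noteq> 0" by (cases d) simp_all
  obtain \<rho>0 y where curve: "\<rho>0 > 0" "y holomorphic_on ball 0 \<rho>0" "y 0 = e"
    "inj_on (\<lambda>t. (t ^ n1, y t)) (ball 0 \<rho>0)"
    "\<And>t. t \<in> ball 0 \<rho>0 \<Longrightarrow> radial c m f g (t ^ n1) (y t) \<noteq> 0"
    "\<And>t. t \<in> ball 0 \<rho>0 \<Longrightarrow> \<exists>y'. DERIV y t :> y' \<and>
        t * y' * (- radial c m f g (t ^ n1) (y t)) = of_nat n1 * snd (blowup_field c m f g (t ^ n1, y t))"
    using node_curve[OF equilibrium n s eigenvalue1 eigenvalue2 nonresonant(2) semisimple] by blast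
  obtain \<delta> u z q where "leaf_disk c m f g n1 e \<delta> \<epsilon> u z q"
    using time_normalized_curve[OF m n(1) equilibrium \<epsilon> curve] by blast
  then interpret leaf_disk c m f g n1 e \<delta> \<epsilon> u z q .
  have path: "path_image (T \<circ> circle) \<subseteq> ball 0 \<epsilon>"
  proof -
    have "\<delta> ^ w \<le> (3 * \<delta>) ^ w" using \<delta> by (intro power_mono) auto
    then have "\<delta> ^ w < \<epsilon>" using small by (rule le_less_trans)
    moreover have "norm (T (circle s)) = \<delta> ^ w" for s
      using \<delta> by (simp add: T_def norm_power norm_mult circle_def)
    ultimately have "norm (T (circle s)) < \<epsilon>" for s by (simp only:)
    then show ?thesis by (auto simp: path_image_def)
  qed
  have bij: "bij_betw \<Theta> (ball 0 2) R"
    unfolding R_def by (rule inj_on_imp_bij_betw[OF inj_on_subset[OF inj_\<Theta> D23(2)]])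
  have hol_\<Theta>: "(\<lambda>\<theta>. fst (\<Theta> \<theta>)) holomorphic_on ball 0 2" "(\<lambda>\<theta>. snd (\<Theta> \<theta>)) holomorphic_on ball 0 2"
    unfolding \<Theta>_def fst_conv snd_conv using hol(1,2) D23(2) holomorphic_on_subset by blast+
  have loop: "\<forall>s\<in>{0..1}. (\<Theta> \<circ> circle) s = \<Theta> (cis (2 * pi * s)) \<and> (T \<circ> circle) s = \<tau> ((\<Theta> \<circ> circle) s)"
    using \<tau>_\<Theta> by (simp add: circle_def)
  have "fst \<circ> (\<Theta> \<circ> circle) = u \<circ> circle" by (simp add: fun_eq_iff \<Theta>_def)
  then have wind: "0 \<notin> path_image (fst \<circ> (\<Theta> \<circ> circle))" "winding_number (fst \<circ> (\<Theta> \<circ> circle)) 0 = of_nat n1"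
    using winding_number_u_circle by simp_all
  have \<tau>0: "\<tau> (0, e) = 0" by (simp only: \<tau>_def \<kappa>_P T_0)
  have U: "U \<subseteq> ball (0, e) \<epsilon>" unfolding U_def by blast
  have L: "L \<subseteq> {p. fst p \<noteq> 0}" using fst_L by blast
  have coeffs: "(of_real \<delta> :: complex) ^ w \<noteq> 0" "q 0 \<noteq> 0" using \<delta> q_nz by simp_all
  have ram: "\<forall>p\<in>L. ramification A \<tau> p 1" using ramification_L by blast
  have r: "(2::real) > 1" by simp
  show ?case
    by (rule exI[of _ U], rule exI[of _ L], rule exI[of _ R], rule exI[of _ A], rule exI[of _ \<tau>],
        rule exI[of _ "2::real"], rule exI[of _ \<Theta>], rule exI[of _ "of_real \<delta> ^ w"], rule exI[of _ "q 0"],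
        rule exI[of _ "T \<circ> circle"], rule exI[of _ "\<Theta> \<circ> circle"], rule exI[of _ \<xi>],
        rule exI[of _ "\<lambda>_. 2 * \<delta>"])
      (intro conjI open_U P_in_U U local_leaf L minimal_loop path R_eq riemann_surface extends_leaf leaf_time
        \<tau>0 ramification_P ram r bij \<Theta>_0 regular_\<Theta> hol_\<Theta> coeffs expansion_\<tau> expansion_u loop
        winding_number_T_circle w_pos wind n(1) real_time_star)
qed

end
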